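(* Let $k$ be a field of characteristic $2$ and let $C/k$ be an elliptic curve in split $\mu_4$-normal form $$(X_0+X_2)^2=c^2X_1X_3,\qquad (X_1+X_3)^2=c^2X_0X_2,\qquad \mathrm{O}=(c:1:0:1),$$ and let $T=(1:c:1:0)$. A basis for the space of addition laws of bidegree $(2,2)$ for $C$ is given by the four tuples $$\big((X_0Y_0+X_2Y_2)^2,\ c(X_0X_1Y_0Y_1+X_2X_3Y_2Y_3),\ (X_1Y_1+X_3Y_3)^2,\ c(X_0X_3Y_0Y_3+X_1X_2Y_1Y_2)\big),$$ $$\big(c(X_0X_1Y_0Y_3+X_2X_3Y_1Y_2),\ (X_1Y_0+X_3Y_2)^2,\ c(X_0X_3Y_2Y_3+X_1X_2Y_0Y_1),\ (X_0Y_3+X_2Y_1)^2\big),$$ $$\big((X_3Y_1+X_1Y_3)^2,\ c(X_0X_3Y_1Y_2+X_1X_2Y_0Y_3),\ (X_0Y_2+X_2Y_0)^2,\ c(X_0X_1Y_2Y_3+X_2X_3Y_0Y_1)\big),$$ $$\big(c(X_0X_3Y_0Y_1+X_1X_2Y_2Y_3),\ (X_0Y_1+X_2Y_3)^2,\ c(X_0X_1Y_1Y_2+X_2X_3Y_0Y_3),\ (X_1Y_2+X_3Y_0)^2\big).$$ The exceptional divisor of each of these addition laws is of the form $4\Delta_{nT}$ for some integer $n$.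
   Context: $X_i$ and $Y_i$ denote the coordinates on the first and second factor of $C\times C\subset\mathbb{P}^3\times\mathbb{P}^3$, and $\mu:C\times C\to C$ is the addition morphism. The point $T$ is a rational point of order 4 on $C$. An addition law of bidegree $(2,2)$ is a tuple $(p_0,p_1,p_2,p_3)$ of polynomials of bidegree $(2,2)$ in $(X_j),(Y_j)$, taken modulo the bihomogeneous ideal of $C\times C$, such that $(p_0:p_1:p_2:p_3)$ equals $\mu$ on the (nonempty open) complement of the common zeros of the $p_i$; together with the zero tuple these form a $k$-vector space. The exceptional divisor of an addition law is the divisor on $C\times C$ of common zeros of its entries. For a point $P$, $\Delta_P=\{(P+Q,Q)\mid Q\in C\}\subset C\times C$. *)

theory Defs
  imports
    "HOL-Algebra.Algebraic_Closure_Type"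
    "HOL-Library.Poly_Mapping"
    "HOL-Library.Numeral_Type"
    "HOL-Library.Extended_Nat"
begin

section \<open>Multivariate polynomials\<close>

text \<open>Polynomials in finitely many variables indexed by \<open>'v\<close>: monomials are exponent vectors
  \<open>'v \<Rightarrow>\<^sub>0 nat\<close>, and the ring operations are those of \<^theory>\<open>HOL-Library.Poly_Mapping\<close>.
  Forms on the projective 3-space use \<open>'v = 4\<close> (with 0, 1, 2, 3 as indices), bihomogeneous forms
  on a product of two copies use \<open>'v = 4 + 4\<close>.\<close>

type_synonym ('v, 'a) mpoly = "('v \<Rightarrow>\<^sub>0 nat) \<Rightarrow>\<^sub>0 'a"

definition Var :: "'v \<Rightarrow> ('v, 'a::comm_ring_1) mpoly" where
  "Var v = Poly_Mapping.single (Poly_Mapping.single v 1) 1"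

definition Const :: "'a::comm_ring_1 \<Rightarrow> ('v, 'a) mpoly" where
  "Const a = Poly_Mapping.single 0 a"

definition eval_mpoly :: "('v::finite \<Rightarrow> 'a) \<Rightarrow> ('v, 'a::comm_ring_1) mpoly \<Rightarrow> 'a" where
  "eval_mpoly x p =
     (\<Sum>m\<in>Poly_Mapping.keys p. Poly_Mapping.lookup p m * (\<Prod>v\<in>UNIV. x v ^ Poly_Mapping.lookup m v))"

definition mpderiv :: "'v \<Rightarrow> ('v, 'a::comm_ring_1) mpoly \<Rightarrow> ('v, 'a) mpoly" where
  "mpderiv v p =
     (\<Sum>m\<in>Poly_Mapping.keys p.
        Poly_Mapping.single (m - Poly_Mapping.single v 1)
          (of_nat (Poly_Mapping.lookup m v) * Poly_Mapping.lookup p m))"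

definition homogeneous :: "nat \<Rightarrow> ('v::finite, 'a::zero) mpoly \<Rightarrow> bool" where
  "homogeneous d p \<longleftrightarrow> (\<forall>m\<in>Poly_Mapping.keys p. (\<Sum>v\<in>UNIV. Poly_Mapping.lookup m v) = d)"

definition bihomogeneous :: "nat \<Rightarrow> nat \<Rightarrow> ('v::finite + 'w::finite, 'a::zero) mpoly \<Rightarrow> bool" where
  "bihomogeneous d e p \<longleftrightarrow>
     (\<forall>m\<in>Poly_Mapping.keys p.
        (\<Sum>v\<in>UNIV. Poly_Mapping.lookup m (Inl v)) = d \<and>
        (\<Sum>w\<in>UNIV. Poly_Mapping.lookup m (Inr w)) = e)"

text \<open>Extension of scalars to the algebraic closure.\<close>

definition ac_poly :: "('v, 'a::field) mpoly \<Rightarrow> ('v, 'a alg_closure) mpoly" where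
  "ac_poly p = Poly_Mapping.map to_ac p"

definition tuple4 :: "'b \<Rightarrow> 'b \<Rightarrow> 'b \<Rightarrow> 'b \<Rightarrow> (4 \<Rightarrow> 'b)" where
  "tuple4 a0 a1 a2 a3 = (\<lambda>i. if i = 0 then a0 else if i = 1 then a1 else if i = 2 then a2 else a3)"


section \<open>Projective points, ideals and orders of vanishing\<close>

text \<open>A point of projective 3-space is the set of all its homogeneous coordinate vectors.\<close>

type_synonym 'a point = "(4 \<Rightarrow> 'a) set"

definition proj_pt :: "(4 \<Rightarrow> 'a::field) \<Rightarrow> 'a point" where
  "proj_pt x = {\<lambda>i. a * x i | a. a \<noteq> 0}"

text \<open>All coordinate vectors of the points of a subset of the projective space, respectively of the
  product of two projective spaces.\<close>

definition cone :: "'a point set \<Rightarrow> (4 \<Rightarrow> 'a) set" where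
  "cone Z = \<Union>Z"

definition bicone :: "('a point \<times> 'a point) set \<Rightarrow> (4 + 4 \<Rightarrow> 'a) set" where
  "bicone Z = {case_sum x y | x y. \<exists>P Q. (P, Q) \<in> Z \<and> x \<in> P \<and> y \<in> Q}"

definition vanishing_ideal :: "('v::finite \<Rightarrow> 'a::field) set \<Rightarrow> ('v, 'a) mpoly set" where
  "vanishing_ideal S = {p. \<forall>x\<in>S. eval_mpoly x p = 0}"

definition ideal_power :: "'r::comm_ring_1 set \<Rightarrow> nat \<Rightarrow> 'r set" where
  "ideal_power I n = module.span times {prod_list fs | fs. length fs = n \<and> set fs \<subseteq> I}"

text \<open>Order of vanishing of a form \<open>F\<close> on a variety along a closed irreducible subvariety of
  codimension one at whose generic point the variety is regular, both given by their (bi)cones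
  \<open>V\<close> and \<open>Z\<close>: the largest \<open>n\<close> such that \<open>F\<close> lies in the \<open>n\<close>-th power of the maximal ideal of the
  local ring, which is the localisation at \<open>vanishing_ideal Z\<close> of the polynomial ring modulo
  \<open>vanishing_ideal V\<close>. The polynomial \<open>H\<close> is the denominator. The order is infinite for forms
  vanishing on the variety.\<close>

definition order_along ::
  "('v::finite \<Rightarrow> 'a::field) set \<Rightarrow> ('v \<Rightarrow> 'a) set \<Rightarrow> ('v, 'a) mpoly \<Rightarrow> enat" where
  "order_along V Z F =
     Sup {enat n | n. \<exists>H A B. H \<notin> vanishing_ideal Z \<and> A \<in> ideal_power (vanishing_ideal Z) n \<and>
                              B \<in> vanishing_ideal V \<and> H * F = A + B}"


section \<open>The curve and its group law\<close>

text \<open>The geometric notions below are meant for an algebraically closed coefficient field.\<close>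

definition mu4_eq1 :: "'a::field \<Rightarrow> (4, 'a) mpoly" where
  "mu4_eq1 c = (Var 0 + Var 2)^2 - Const (c^2) * Var 1 * Var 3"

definition mu4_eq2 :: "'a::field \<Rightarrow> (4, 'a) mpoly" where
  "mu4_eq2 c = (Var 1 + Var 3)^2 - Const (c^2) * Var 0 * Var 2"

definition mu4_curve :: "'a::field \<Rightarrow> 'a point set" where
  "mu4_curve c =
     {proj_pt x | x. x \<noteq> (\<lambda>_. 0) \<and> eval_mpoly x (mu4_eq1 c) = 0 \<and> eval_mpoly x (mu4_eq2 c) = 0}"

text \<open>Jacobian criterion: the gradients of the two equations are linearly independent at every
  point. A smooth complete intersection of two quadrics in projective 3-space is a geometrically
  irreducible curve of genus one, so together with the rational point \<open>mu4_O\<close> this says that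
  the curve is an elliptic curve.\<close>

definition mu4_smooth :: "'a::field \<Rightarrow> bool" where
  "mu4_smooth c \<longleftrightarrow>
     (\<forall>x\<in>cone (mu4_curve c). \<forall>a b.
        (\<forall>i. a * eval_mpoly x (mpderiv i (mu4_eq1 c)) + b * eval_mpoly x (mpderiv i (mu4_eq2 c)) = 0)
        \<longrightarrow> a = 0 \<and> b = 0)"

definition mu4_O :: "'a::field \<Rightarrow> 'a point" where
  "mu4_O c = proj_pt (tuple4 c 1 0 1)"

definition mu4_T :: "'a::field \<Rightarrow> 'a point" where
  "mu4_T c = proj_pt (tuple4 1 c 1 0)"

text \<open>Divisors on the curve are integer-valued functions on its points. Rational functions are
  quotients \<open>F / G\<close> of forms of equal degree not vanishing identically on the curve.\<close>

definition lin_equiv :: "'a::field \<Rightarrow> ('a point \<Rightarrow> int) \<Rightarrow> ('a point \<Rightarrow> int) \<Rightarrow> bool" where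
  "lin_equiv c D E \<longleftrightarrow>
     (\<exists>d F G. homogeneous d F \<and> homogeneous d G \<and>
        F \<notin> vanishing_ideal (cone (mu4_curve c)) \<and> G \<notin> vanishing_ideal (cone (mu4_curve c)) \<and>
        (\<forall>S\<in>mu4_curve c.
           D S - E S = int (the_enat (order_along (cone (mu4_curve c)) (cone {S}) F))
                     - int (the_enat (order_along (cone (mu4_curve c)) (cone {S}) G))))"

definition pt_div :: "'a point \<Rightarrow> 'a point \<Rightarrow> int" where
  "pt_div P = (\<lambda>S. if S = P then 1 else 0)"

text \<open>The group law of the elliptic curve with origin \<open>mu4_O\<close>, transported from the Picard group:
  \<open>(P) - (O) + (Q) - (O)\<close> is linearly equivalent to \<open>(P + Q) - (O)\<close>.\<close>

definition ell_add :: "'a::field \<Rightarrow> 'a point \<Rightarrow> 'a point \<Rightarrow> 'a point" where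
  "ell_add c P Q =
     (THE R. R \<in> mu4_curve c \<and>
        lin_equiv c (\<lambda>S. pt_div P S + pt_div Q S) (\<lambda>S. pt_div R S + pt_div (mu4_O c) S))"

definition ell_neg :: "'a::field \<Rightarrow> 'a point \<Rightarrow> 'a point" where
  "ell_neg c P = (THE Q. Q \<in> mu4_curve c \<and> ell_add c P Q = mu4_O c)"

definition ell_mult :: "'a::field \<Rightarrow> int \<Rightarrow> 'a point \<Rightarrow> 'a point" where
  "ell_mult c n P =
     (if n \<ge> 0 then (ell_add c P ^^ nat n) (mu4_O c)
      else (ell_add c (ell_neg c P) ^^ nat (- n)) (mu4_O c))"

definition mu4_surface :: "'a::field \<Rightarrow> ('a point \<times> 'a point) set" where
  "mu4_surface c = mu4_curve c \<times> mu4_curve c"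

definition Delta :: "'a::field \<Rightarrow> 'a point \<Rightarrow> ('a point \<times> 'a point) set" where
  "Delta c P = {(ell_add c P Q, Q) | Q. Q \<in> mu4_curve c}"


section \<open>Divisors on the product of the curve with itself\<close>

definition zclosed :: "'a::field \<Rightarrow> ('a point \<times> 'a point) set \<Rightarrow> bool" where
  "zclosed c Z \<longleftrightarrow>
     (\<exists>A. (\<forall>F\<in>A. \<exists>d e. bihomogeneous d e F) \<and>
          Z = {z \<in> mu4_surface c. \<forall>F\<in>A. F \<in> vanishing_ideal (bicone {z})})"

definition zirreducible :: "'a::field \<Rightarrow> ('a point \<times> 'a point) set \<Rightarrow> bool" where
  "zirreducible c Z \<longleftrightarrow>
     zclosed c Z \<and> Z \<noteq> {} \<and>
     (\<forall>Z1 Z2. zclosed c Z1 \<and> zclosed c Z2 \<and> Z = Z1 \<union> Z2 \<longrightarrow> Z = Z1 \<or> Z = Z2)"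

text \<open>Irreducible closed subsets of codimension one in the (irreducible) surface.\<close>

definition prime_divisor :: "'a::field \<Rightarrow> ('a point \<times> 'a point) set \<Rightarrow> bool" where
  "prime_divisor c Z \<longleftrightarrow>
     zirreducible c Z \<and> Z \<noteq> mu4_surface c \<and>
     (\<forall>W. zirreducible c W \<and> Z \<subset> W \<longrightarrow> W = mu4_surface c)"

text \<open>Divisors are integer-valued functions on sets that vanish off the prime divisors; in
  particular, \<open>four_Delta c P\<close> is a divisor only if \<open>Delta c P\<close> is a prime divisor. The coefficient
  of a prime divisor in the divisor of common zeros of a tuple is the least order of vanishing of an
  entry.\<close>

definition common_zero_divisor ::
  "'a::field \<Rightarrow> (4 \<Rightarrow> (4 + 4, 'a) mpoly) \<Rightarrow> ('a point \<times> 'a point) set \<Rightarrow> int" where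
  "common_zero_divisor c p =
     (\<lambda>Z. if prime_divisor c Z
          then int (the_enat (INF i. order_along (bicone (mu4_surface c)) (bicone Z) (p i)))
          else 0)"

definition four_Delta :: "'a::field \<Rightarrow> 'a point \<Rightarrow> ('a point \<times> 'a point) set \<Rightarrow> int" where
  "four_Delta c P = (\<lambda>Z. if Z = Delta c P then 4 else 0)"


section \<open>Addition laws of bidegree (2,2)\<close>

text \<open>From here on, \<open>c\<close> and the tuples have coefficients in the ground field, and the geometry takes
  place over its algebraic closure.\<close>

definition surface_ideal :: "'a::field \<Rightarrow> (4 + 4, 'a) mpoly set" where
  "surface_ideal c = {p. ac_poly p \<in> vanishing_ideal (bicone (mu4_surface (to_ac c)))}"

definition tuple_at :: "(4 \<Rightarrow> (4 + 4, 'a::field) mpoly) \<Rightarrow>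
    (4 \<Rightarrow> 'a alg_closure) \<Rightarrow> (4 \<Rightarrow> 'a alg_closure) \<Rightarrow> (4 \<Rightarrow> 'a alg_closure)" where
  "tuple_at p x y = (\<lambda>i. eval_mpoly (case_sum x y) (ac_poly (p i)))"

definition addition_law :: "'a::field \<Rightarrow> (4 \<Rightarrow> (4 + 4, 'a) mpoly) \<Rightarrow> bool" where
  "addition_law c p \<longleftrightarrow>
     (\<forall>i. bihomogeneous 2 2 (p i)) \<and>
     (\<exists>P\<in>mu4_curve (to_ac c). \<exists>Q\<in>mu4_curve (to_ac c). \<exists>x\<in>P. \<exists>y\<in>Q. tuple_at p x y \<noteq> (\<lambda>_. 0)) \<and>
     (\<forall>P\<in>mu4_curve (to_ac c). \<forall>Q\<in>mu4_curve (to_ac c). \<forall>x\<in>P. \<forall>y\<in>Q.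
        tuple_at p x y \<noteq> (\<lambda>_. 0) \<longrightarrow> proj_pt (tuple_at p x y) = ell_add (to_ac c) P Q)"

definition exceptional_divisor :: "'a::field \<Rightarrow> (4 \<Rightarrow> (4 + 4, 'a) mpoly) \<Rightarrow>
    ('a alg_closure point \<times> 'a alg_closure point) set \<Rightarrow> int" where
  "exceptional_divisor c p = common_zero_divisor (to_ac c) (\<lambda>i. ac_poly (p i))"

definition tuple_cong ::
  "'a::field \<Rightarrow> (4 \<Rightarrow> (4 + 4, 'a) mpoly) \<Rightarrow> (4 \<Rightarrow> (4 + 4, 'a) mpoly) \<Rightarrow> bool" where
  "tuple_cong c p q \<longleftrightarrow> (\<forall>i. p i - q i \<in> surface_ideal c)"

text \<open>All representatives of the elements of the space of addition laws: the addition laws, and the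
  representatives of the zero tuple.\<close>

definition addition_law_space :: "'a::field \<Rightarrow> (4 \<Rightarrow> (4 + 4, 'a) mpoly) set" where
  "addition_law_space c =
     {p. (\<forall>i. bihomogeneous 2 2 (p i)) \<and> (addition_law c p \<or> tuple_cong c p (\<lambda>_. 0))}"

definition lin_comb ::
  "('j::finite \<Rightarrow> 'a::field) \<Rightarrow> ('j \<Rightarrow> 4 \<Rightarrow> (4 + 4, 'a) mpoly) \<Rightarrow> 4 \<Rightarrow> (4 + 4, 'a) mpoly" where
  "lin_comb a B = (\<lambda>i. \<Sum>j\<in>UNIV. Const (a j) * B j i)"

text \<open>The classes of the \<open>B j\<close> modulo \<open>surface_ideal\<close> are linearly independent, and their span is
  exactly the space of addition laws (which is thereby a vector space).\<close>

definition basis_of_addition_laws ::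
  "'a::field \<Rightarrow> ('j::finite \<Rightarrow> 4 \<Rightarrow> (4 + 4, 'a) mpoly) \<Rightarrow> bool" where
  "basis_of_addition_laws c B \<longleftrightarrow>
     (\<forall>a. tuple_cong c (lin_comb a B) (\<lambda>_. 0) \<longrightarrow> (\<forall>j. a j = 0)) \<and>
     (\<forall>a. lin_comb a B \<in> addition_law_space c) \<and>
     (\<forall>p\<in>addition_law_space c. \<exists>a. tuple_cong c p (lin_comb a B))"

abbreviation VX :: "4 \<Rightarrow> (4 + 4, 'a::field) mpoly" where "VX i \<equiv> Var (Inl i)"
abbreviation VY :: "4 \<Rightarrow> (4 + 4, 'a::field) mpoly" where "VY i \<equiv> Var (Inr i)"

definition mu4_law0 :: "'a::field \<Rightarrow> 4 \<Rightarrow> (4 + 4, 'a) mpoly" where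
  "mu4_law0 c = tuple4
     ((VX 0 * VY 0 + VX 2 * VY 2)^2)
     (Const c * (VX 0 * VX 1 * VY 0 * VY 1 + VX 2 * VX 3 * VY 2 * VY 3))
     ((VX 1 * VY 1 + VX 3 * VY 3)^2)
     (Const c * (VX 0 * VX 3 * VY 0 * VY 3 + VX 1 * VX 2 * VY 1 * VY 2))"

definition mu4_law1 :: "'a::field \<Rightarrow> 4 \<Rightarrow> (4 + 4, 'a) mpoly" where
  "mu4_law1 c = tuple4
     (Const c * (VX 0 * VX 1 * VY 0 * VY 3 + VX 2 * VX 3 * VY 1 * VY 2))
     ((VX 1 * VY 0 + VX 3 * VY 2)^2)
     (Const c * (VX 0 * VX 3 * VY 2 * VY 3 + VX 1 * VX 2 * VY 0 * VY 1))
     ((VX 0 * VY 3 + VX 2 * VY 1)^2)"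

definition mu4_law2 :: "'a::field \<Rightarrow> 4 \<Rightarrow> (4 + 4, 'a) mpoly" where
  "mu4_law2 c = tuple4
     ((VX 3 * VY 1 + VX 1 * VY 3)^2)
     (Const c * (VX 0 * VX 3 * VY 1 * VY 2 + VX 1 * VX 2 * VY 0 * VY 3))
     ((VX 0 * VY 2 + VX 2 * VY 0)^2)
     (Const c * (VX 0 * VX 1 * VY 2 * VY 3 + VX 2 * VX 3 * VY 0 * VY 1))"

definition mu4_law3 :: "'a::field \<Rightarrow> 4 \<Rightarrow> (4 + 4, 'a) mpoly" where
  "mu4_law3 c = tuple4
     (Const c * (VX 0 * VX 3 * VY 0 * VY 1 + VX 1 * VX 2 * VY 2 * VY 3))
     ((VX 0 * VY 1 + VX 2 * VY 3)^2)
     (Const c * (VX 0 * VX 1 * VY 1 * VY 2 + VX 2 * VX 3 * VY 0 * VY 3))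
     ((VX 1 * VY 2 + VX 3 * VY 0)^2)"

definition mu4_laws :: "'a::field \<Rightarrow> 4 \<Rightarrow> 4 \<Rightarrow> (4 + 4, 'a) mpoly" where
  "mu4_laws c = tuple4 (mu4_law0 c) (mu4_law1 c) (mu4_law2 c) (mu4_law3 c)"

end

theory Submission
  imports Defs
begin

text \<open>The chart \<open>X\<^sub>2 = c\<close> turns the curve into the affine cubic \<open>Y\<^sup>2 + c\<^sup>2 v Y = c\<^sup>2 v\<^sup>3 + 1\<close>, whose coordinate
  ring is free over the polynomials in \<open>v\<close> with basis \<open>1, Y\<close>. Degrees of norms bound orders of
  vanishing and show that no function has a single simple pole, so the sum of two points is unique;
  chords and tangents construct it, and the values of the four tuples are proportional to the result
  because the minors of their matrix vanish on \<open>C \<times> C\<close>.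

  For the basis, let \<open>p\<close> be an addition law and \<open>L\<close> the third of the four tuples. Then
  \<open>p\<^sub>0 L\<^sub>2 = p\<^sub>2 L\<^sub>0\<close> on \<open>C \<times> C\<close>, and comparing coefficients in a basis of forms on the curve shows that
  \<open>p\<^sub>0\<close> is a combination of the first entries of the four tuples. The remaining entries of \<open>p\<close> follow
  by proportionality.

  For the exceptional divisors, translation by \<open>n T\<close> is the cyclic shift of the coordinates by \<open>n\<close>. Law
  \<open>n + 2\<close> (indices modulo 4) has common zeros exactly on the graph of this shift, along which
  \<open>t = Y\<^sub>2 (X\<^bsub>n+1\<^esub> + X\<^bsub>n+3\<^esub>) + (Y\<^sub>1 + Y\<^sub>3) X\<^bsub>n+2\<^esub>\<close> is a local parameter whose fourth power is the entry
  \<open>n + 2\<close> times the unit \<open>(c\<^sup>2 X\<^bsub>n+2\<^esub> Y\<^sub>2)\<^sup>2\<close>.\<close>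

section \<open>Evaluation and substitution of polynomials\<close>

text \<open>\<open>ell_add\<close> is a definite description over the Picard group, so no sum can be
  computed before existence and uniqueness of the point are settled; this is why divisor theory
  precedes every formula. The plane X2 = 0 meets the curve in 4 O, so the chart omits O alone,
  functions regular on it have their poles at O, and the degree of the norm measures that pole. One
  degree count thus gives integrality of the coordinate ring, finiteness of orders and the absence
  of functions with one simple pole. No single law gives the sum everywhere, since each vanishes on
  a whole diagonal. Law 2 is evaluated on chords, law 0 on tangents, law 0 or 1 on opposite points.
  Orders are suprema over powers of ideals and become computable once a local parameter is
  exhibited, which is done at points and along the four diagonals. Along any other prime divisor
  some entry of the law has order 0. Divisors live over the algebraic closure, the basis over the
  ground field; coefficients descend because quadratic forms on the curve reduce with the constants
  0, 1 and 1/c^2 only.\<close>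

lemma eval_mpoly_superset:
  assumes "finite A" "Poly_Mapping.keys p \<subseteq> A"
  shows "eval_mpoly x p =
    (\<Sum>m\<in>A. Poly_Mapping.lookup p m * (\<Prod>v\<in>UNIV. x v ^ Poly_Mapping.lookup m v))"
  unfolding eval_mpoly_def using assms
  by (intro sum.mono_neutral_left) (auto simp: in_keys_iff)

lemma eval_mpoly_zero [simp]: "eval_mpoly x 0 = 0"
  by (simp add: eval_mpoly_def)

lemma eval_mpoly_add [simp]: "eval_mpoly x (p + q) = eval_mpoly x p + eval_mpoly x q"
proof -
  let ?A = "Poly_Mapping.keys p \<union> Poly_Mapping.keys q"
  have "Poly_Mapping.keys (p + q) \<subseteq> ?A" by (rule Poly_Mapping.keys_add)
  then show ?thesis
    by (subst (1 2 3) eval_mpoly_superset[of ?A])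
       (auto simp: lookup_add distrib_right sum.distrib)
qed

lemma eval_mpoly_single [simp]:
  "eval_mpoly x (Poly_Mapping.single m a) = a * (\<Prod>v\<in>UNIV. x v ^ Poly_Mapping.lookup m v)"
  by (subst eval_mpoly_superset[of "{m}"]) auto

lemma eval_mpoly_uminus [simp]: "eval_mpoly x (- p) = - eval_mpoly x p"
proof -
  have "eval_mpoly x (- p) + eval_mpoly x p = 0"
    unfolding eval_mpoly_add[symmetric] by simp
  then show ?thesis by (simp add: eq_neg_iff_add_eq_0)
qed

lemma eval_mpoly_diff [simp]: "eval_mpoly x (p - q) = eval_mpoly x p - eval_mpoly x q"
  using eval_mpoly_add[of x p "- q"] by simp

lemma eval_mpoly_sum [simp]: "eval_mpoly x (sum f A) = (\<Sum>a\<in>A. eval_mpoly x (f a))"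
  by (induction A rule: infinite_finite_induct) auto

lemma mpoly_eq_sum_single:
  fixes p :: "('v, 'a::comm_ring_1) mpoly"
  shows "p = (\<Sum>m\<in>Poly_Mapping.keys p. Poly_Mapping.single m (Poly_Mapping.lookup p m))"
proof (rule poly_mapping_eqI)
  fix k
  show "Poly_Mapping.lookup p k = Poly_Mapping.lookup
      (\<Sum>m\<in>Poly_Mapping.keys p. Poly_Mapping.single m (Poly_Mapping.lookup p m)) k"
    by (auto simp: lookup_sum lookup_single when_def in_keys_iff)
qed

lemma eval_mpoly_mult [simp]: "eval_mpoly x (p * q) = eval_mpoly x p * eval_mpoly x q"
proof -
  have *: "eval_mpoly x (Poly_Mapping.single m a * Poly_Mapping.single k b) =
      eval_mpoly x (Poly_Mapping.single m a) * eval_mpoly x (Poly_Mapping.single k b)" for m k a b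
    by (simp add: mult_single lookup_add power_add prod.distrib)
  show ?thesis
    by (subst (1 2) mpoly_eq_sum_single[of p], subst (1 2) mpoly_eq_sum_single[of q])
       (simp only: sum_product eval_mpoly_sum *)
qed

lemma eval_mpoly_Const [simp]: "eval_mpoly x (Const a) = a"
  by (simp add: Const_def)

lemma eval_mpoly_one [simp]: "eval_mpoly x 1 = 1"
  using eval_mpoly_Const[of x 1] by (simp add: Const_def)

lemma eval_mpoly_Var [simp]: "eval_mpoly x (Var v) = x v"
proof -
  have "(\<Prod>u\<in>UNIV. x u ^ (Poly_Mapping.lookup (Poly_Mapping.single v (1::nat)) u)) =
      (\<Prod>u\<in>UNIV. if u = v then x v else 1)"
    by (intro prod.cong) (auto simp: lookup_single when_def)
  then show ?thesis by (simp add: Var_def)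
qed

lemma eval_mpoly_power [simp]: "eval_mpoly x (p ^ n) = eval_mpoly x p ^ n"
  by (induction n) auto

lemma eval_mpoly_prod [simp]: "eval_mpoly x (prod f A) = (\<Prod>a\<in>A. eval_mpoly x (f a))"
  by (induction A rule: infinite_finite_induct) auto

lemma Var_power: "Var v ^ n = Poly_Mapping.single (Poly_Mapping.single v n) 1"
  by (induction n) (auto simp: Var_def mult_single simp flip: single_add)

lemma single_conv_prod:
  fixes a :: "'a::comm_ring_1" and m :: "'v::finite \<Rightarrow>\<^sub>0 nat"
  shows "Poly_Mapping.single m a = Const a * (\<Prod>v\<in>UNIV. Var v ^ Poly_Mapping.lookup m v)"
proof -
  have "(\<Prod>v\<in>A. Var v ^ Poly_Mapping.lookup m v) = Poly_Mapping.single
      (\<Sum>v\<in>A. Poly_Mapping.single v (Poly_Mapping.lookup m v)) (1::'a)" if "finite A" for A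
    using that by induction (auto simp: Var_power mult_single)
  moreover have "(\<Sum>v\<in>UNIV. Poly_Mapping.single v (Poly_Mapping.lookup m v)) = m"
    by (rule poly_mapping_eqI) (auto simp: lookup_sum lookup_single when_def)
  ultimately show ?thesis by (simp add: Const_def mult_single)
qed

lemma mpoly_induct [case_names Const Var add mult]:
  fixes p :: "('v::finite, 'a::comm_ring_1) mpoly"
  assumes const: "\<And>a. P (Const a)" and var: "\<And>v. P (Var v)"
    and add: "\<And>p q. P p \<Longrightarrow> P q \<Longrightarrow> P (p + q)" and mult: "\<And>p q. P p \<Longrightarrow> P q \<Longrightarrow> P (p * q)"
  shows "P p"
proof -
  have zero: "P 0" and one: "P 1" using const[of 0] const[of 1] by (simp_all add: Const_def)
  have pow: "P (q ^ n)" if "P q" for q n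
    using that by (induction n) (auto intro: one mult)
  have prod: "P (\<Prod>v\<in>A. Var v ^ f v)" if "finite A" for A f
    using that by induction (auto intro: one mult pow var)
  have single: "P (Poly_Mapping.single m a)" for m a
    unfolding single_conv_prod by (intro mult const prod) simp
  have "P (\<Sum>m\<in>A. Poly_Mapping.single m (f m))" if "finite A" for A f
    using that by induction (auto intro: zero add single)
  then show ?thesis by (subst mpoly_eq_sum_single) simp
qed

definition subst_mpoly :: "('v \<Rightarrow> ('w, 'a) mpoly) \<Rightarrow> ('v::finite, 'a::comm_ring_1) mpoly \<Rightarrow> ('w, 'a) mpoly"
  where "subst_mpoly g p = (\<Sum>m\<in>Poly_Mapping.keys p.
    Const (Poly_Mapping.lookup p m) * (\<Prod>v\<in>UNIV. g v ^ Poly_Mapping.lookup m v))"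

lemma eval_subst_mpoly [simp]:
  "eval_mpoly x (subst_mpoly g p) = eval_mpoly (\<lambda>v. eval_mpoly x (g v)) p"
  by (simp add: subst_mpoly_def) (simp add: eval_mpoly_def)

lemma UNIV_sum_prod:
  fixes f :: "'v::finite + 'w::finite \<Rightarrow> 'a::comm_monoid_mult"
  shows "(\<Prod>v\<in>UNIV. f v) = (\<Prod>v\<in>UNIV. f (Inl v)) * (\<Prod>w\<in>UNIV. f (Inr w))"
  using prod.Plus[of UNIV UNIV f] by (simp add: comp_def)

section \<open>Homogeneous and bihomogeneous polynomials\<close>

lemma keys_Const: "Poly_Mapping.keys (Const a) \<subseteq> {0}"
  by (simp add: Const_def)

lemma keys_Var: "Poly_Mapping.keys (Var v :: ('v, 'a::comm_ring_1) mpoly) \<subseteq> {Poly_Mapping.single v 1}"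
  by (simp add: Var_def)

lemma homogeneous_Const: "homogeneous 0 (Const a)"
  using keys_Const[of a] by (auto simp: homogeneous_def)

lemma homogeneous_Var: "homogeneous 1 (Var v)"
  using keys_Var[of v] by (auto simp: homogeneous_def lookup_single when_def)

lemma homogeneous_add: "homogeneous d p \<Longrightarrow> homogeneous d q \<Longrightarrow> homogeneous d (p + q)"
  using Poly_Mapping.keys_add[of p q] by (fastforce simp: homogeneous_def)

lemma homogeneous_mult:
  "homogeneous d p \<Longrightarrow> homogeneous e q \<Longrightarrow> homogeneous (d + e) (p * q)"
  using keys_mult[of p q] by (fastforce simp: homogeneous_def lookup_add sum.distrib)

lemma bihomogeneous_Const: "bihomogeneous 0 0 (Const a)"
  using keys_Const[of a] by (auto simp: bihomogeneous_def)

lemma bihomogeneous_Inl: "bihomogeneous 1 0 (Var (Inl v))"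
  using keys_Var[of "Inl v"] by (auto simp: bihomogeneous_def lookup_single when_def)

lemma bihomogeneous_Inr: "bihomogeneous 0 1 (Var (Inr v))"
  using keys_Var[of "Inr v"] by (auto simp: bihomogeneous_def lookup_single when_def)

lemma bihomogeneous_zero: "bihomogeneous d e 0"
  by (simp add: bihomogeneous_def)

lemma bihomogeneous_add:
  "bihomogeneous d e p \<Longrightarrow> bihomogeneous d e q \<Longrightarrow> bihomogeneous d e (p + q)"
  using Poly_Mapping.keys_add[of p q] by (fastforce simp: bihomogeneous_def)

lemma bihomogeneous_diff:
  "bihomogeneous d e p \<Longrightarrow> bihomogeneous d e q \<Longrightarrow> bihomogeneous d e (p - q)"
  using keys_diff[of p q] by (fastforce simp: bihomogeneous_def)

lemma bihomogeneous_mult: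
  "bihomogeneous d e p \<Longrightarrow> bihomogeneous d' e' q \<Longrightarrow> bihomogeneous (d + d') (e + e') (p * q)"
  using keys_mult[of p q] by (fastforce simp: bihomogeneous_def lookup_add sum.distrib)

lemma bihomogeneous_sum:
  "(\<And>a. a \<in> A \<Longrightarrow> bihomogeneous d e (f a)) \<Longrightarrow> bihomogeneous d e (sum f A)"
  by (induction A rule: infinite_finite_induct) (auto simp: bihomogeneous_zero bihomogeneous_add)

lemma eval_bihomogeneous_scale:
  assumes "bihomogeneous d e p"
  shows "eval_mpoly (case_sum (\<lambda>i. a * x i) (\<lambda>i. b * y i)) p
    = a ^ d * b ^ e * eval_mpoly (case_sum x y) p"
proof -
  have "Poly_Mapping.lookup p m * (\<Prod>v\<in>UNIV. case_sum (\<lambda>i. a * x i) (\<lambda>i. b * y i) v ^ Poly_Mapping.lookup m v)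
     = a ^ d * b ^ e * (Poly_Mapping.lookup p m * (\<Prod>v\<in>UNIV. case_sum x y v ^ Poly_Mapping.lookup m v))"
    if "m \<in> Poly_Mapping.keys p" for m
  proof -
    have "(\<Sum>v\<in>UNIV. Poly_Mapping.lookup m (Inl v)) = d" "(\<Sum>w\<in>UNIV. Poly_Mapping.lookup m (Inr w)) = e"
      using assms that by (auto simp: bihomogeneous_def)
    then show ?thesis
      by (auto simp: UNIV_sum_prod power_mult_distrib prod.distrib simp flip: power_sum)
  qed
  then show ?thesis by (simp add: eval_mpoly_def sum_distrib_left)
qed

text \<open>\<open>zclosed\<close> uses bihomogeneous forms, whereas \<open>irred_set\<close> tests
  all polynomials. Splitting into bihomogeneous components reconciles the two in
  \<open>irred_if_zirreducible\<close>.\<close>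

definition bicomponent :: "nat \<Rightarrow> nat \<Rightarrow> ('v::finite + 'w::finite, 'a::comm_ring_1) mpoly \<Rightarrow> ('v + 'w, 'a) mpoly"
  where "bicomponent d e p = (\<Sum>m \<in> {m \<in> Poly_Mapping.keys p.
      (\<Sum>v\<in>UNIV. Poly_Mapping.lookup m (Inl v)) = d \<and> (\<Sum>w\<in>UNIV. Poly_Mapping.lookup m (Inr w)) = e}.
    Poly_Mapping.single m (Poly_Mapping.lookup p m))"

lemma bihomogeneous_bicomponent: "bihomogeneous d e (bicomponent d e p)"
  unfolding bicomponent_def by (intro bihomogeneous_sum) (auto simp: bihomogeneous_def)

lemma sum_bicomponent:
  obtains N where "p = (\<Sum>d<N. \<Sum>e<N. bicomponent d e p)"
proof -
  let ?f = "\<lambda>m. (\<Sum>v\<in>UNIV. Poly_Mapping.lookup m (Inl v))"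
  let ?g = "\<lambda>m. (\<Sum>w\<in>UNIV. Poly_Mapping.lookup m (Inr w))"
  let ?K = "Poly_Mapping.keys p"
  define N where "N = Suc (Max (insert 0 (?f ` ?K \<union> ?g ` ?K)))"
  have N: "?f m < N" "?g m < N" if "m \<in> ?K" for m
    using that by (auto simp: N_def less_Suc_eq_le intro!: Max_ge)
  have "(\<Sum>d<N. \<Sum>e<N. bicomponent d e p) =
      (\<Sum>d<N. \<Sum>e<N. \<Sum>m\<in>?K. if ?f m = d \<and> ?g m = e then Poly_Mapping.single m (Poly_Mapping.lookup p m) else 0)"
    by (simp add: bicomponent_def sum.inter_filter)
  also have "\<dots> = (\<Sum>m\<in>?K. \<Sum>d<N. \<Sum>e<N. if ?f m = d \<and> ?g m = e then Poly_Mapping.single m (Poly_Mapping.lookup p m) else 0)"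
    by (subst sum.swap[of _ "{..<N}" ?K], subst sum.swap[of _ "{..<N}" ?K]) (rule refl)
  also have "\<dots> = (\<Sum>m\<in>?K. Poly_Mapping.single m (Poly_Mapping.lookup p m))"
  proof (rule sum.cong)
    fix m assume m: "m \<in> ?K"
    let ?s = "Poly_Mapping.single m (Poly_Mapping.lookup p m)"
    have "(\<Sum>d<N. \<Sum>e<N. if ?f m = d \<and> ?g m = e then ?s else 0) = (\<Sum>d<N. if ?f m = d then ?s else 0)"
      using N[OF m] by (intro sum.cong) auto
    also have "\<dots> = ?s" using N[OF m] by simp
    finally show "(\<Sum>d<N. \<Sum>e<N. if ?f m = d \<and> ?g m = e then ?s else 0) = ?s" .
  qed simp
  also have "\<dots> = p" using mpoly_eq_sum_single[of p] by simp
  finally show ?thesis using that by metis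
qed

section \<open>Extension of scalars\<close>

lemma lookup_ac_poly [simp]: "Poly_Mapping.lookup (ac_poly p) m = to_ac (Poly_Mapping.lookup p m)"
  by (simp add: ac_poly_def map.rep_eq when_def)

lemma keys_ac_poly [simp]: "Poly_Mapping.keys (ac_poly p) = Poly_Mapping.keys p"
  by (auto simp: in_keys_iff)

lemma ac_poly_zero [simp]: "ac_poly 0 = 0"
  by (rule poly_mapping_eqI) simp

lemma ac_poly_add [simp]: "ac_poly (p + q) = ac_poly p + ac_poly q"
  by (rule poly_mapping_eqI) (simp add: lookup_add)

lemma ac_poly_diff [simp]: "ac_poly (p - q) = ac_poly p - ac_poly q"
  by (rule poly_mapping_eqI) (simp add: lookup_minus)

lemma ac_poly_single [simp]: "ac_poly (Poly_Mapping.single m a) = Poly_Mapping.single m (to_ac a)"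
  by (rule poly_mapping_eqI) (simp add: lookup_single when_def)

lemma ac_poly_sum [simp]: "ac_poly (sum f A) = (\<Sum>a\<in>A. ac_poly (f a))"
  by (induction A rule: infinite_finite_induct) auto

lemma ac_poly_mult [simp]: "ac_poly (p * q) = ac_poly p * ac_poly q"
proof -
  have *: "ac_poly (Poly_Mapping.single m a * Poly_Mapping.single k b) =
      ac_poly (Poly_Mapping.single m a) * ac_poly (Poly_Mapping.single k b)" for m k a b
    by (simp add: mult_single)
  show ?thesis
    by (subst (1 2) mpoly_eq_sum_single[of p], subst (1 2) mpoly_eq_sum_single[of q])
       (simp only: sum_product ac_poly_sum *)
qed

lemma ac_poly_Const [simp]: "ac_poly (Const a) = Const (to_ac a)"
  by (simp add: Const_def)

lemma ac_poly_Var [simp]: "ac_poly (Var v) = Var v"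
  by (simp add: Var_def)

lemma ac_poly_one [simp]: "ac_poly 1 = 1"
  using ac_poly_Const[of 1] by (simp add: Const_def)

lemma ac_poly_power [simp]: "ac_poly (p ^ n) = ac_poly p ^ n"
  by (induction n) auto

section \<open>Irreducible sets\<close>

lemma vanishing_idealI: "(\<And>x. x \<in> S \<Longrightarrow> eval_mpoly x p = 0) \<Longrightarrow> p \<in> vanishing_ideal S"
  by (simp add: vanishing_ideal_def)

lemma vanishing_idealD: "p \<in> vanishing_ideal S \<Longrightarrow> x \<in> S \<Longrightarrow> eval_mpoly x p = 0"
  by (simp add: vanishing_ideal_def)

lemma not_vanishing_idealE:
  assumes "p \<notin> vanishing_ideal S"
  obtains x where "x \<in> S" "eval_mpoly x p \<noteq> 0"
  using assms by (auto simp: vanishing_ideal_def)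

lemma vanishing_ideal_add: "p \<in> vanishing_ideal S \<Longrightarrow> q \<in> vanishing_ideal S \<Longrightarrow> p + q \<in> vanishing_ideal S"
  by (simp add: vanishing_ideal_def)

lemma vanishing_ideal_diff: "p \<in> vanishing_ideal S \<Longrightarrow> q \<in> vanishing_ideal S \<Longrightarrow> p - q \<in> vanishing_ideal S"
  by (simp add: vanishing_ideal_def)

lemma vanishing_ideal_mult: "q \<in> vanishing_ideal S \<Longrightarrow> p * q \<in> vanishing_ideal S"
  by (simp add: vanishing_ideal_def)

lemma vanishing_ideal_mono: "S \<subseteq> T \<Longrightarrow> vanishing_ideal T \<subseteq> vanishing_ideal S"
  by (auto simp: vanishing_ideal_def)

text \<open>Primality of the vanishing ideal of an arbitrary set, so that the notion applies to
  charts, cones and products alike.\<close>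

definition irred_set :: "('v::finite \<Rightarrow> 'a::field) set \<Rightarrow> bool" where
  "irred_set S \<longleftrightarrow> S \<noteq> {} \<and> (\<forall>F G. F * G \<in> vanishing_ideal S \<longrightarrow>
     F \<in> vanishing_ideal S \<or> G \<in> vanishing_ideal S)"

lemma irred_setD:
  "irred_set S \<Longrightarrow> F * G \<in> vanishing_ideal S \<Longrightarrow> F \<in> vanishing_ideal S \<or> G \<in> vanishing_ideal S"
  by (simp add: irred_set_def)

lemma irred_set_mult_iff:
  "irred_set S \<Longrightarrow> F * G \<in> vanishing_ideal S \<longleftrightarrow> F \<in> vanishing_ideal S \<or> G \<in> vanishing_ideal S"
  by (auto dest: irred_setD simp: vanishing_ideal_def)

lemma irred_set_mult:
  "irred_set S \<Longrightarrow> F \<notin> vanishing_ideal S \<Longrightarrow> G \<notin> vanishing_ideal S \<Longrightarrow> F * G \<notin> vanishing_ideal S"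
  by (auto dest: irred_setD)

lemma vanishing_ideal_zero [simp]: "0 \<in> vanishing_ideal S"
  by (simp add: vanishing_ideal_def)

lemma irred_set_one: "irred_set S \<Longrightarrow> 1 \<notin> vanishing_ideal S"
  by (auto simp: irred_set_def vanishing_ideal_def)

lemma irred_set_power: "irred_set S \<Longrightarrow> F ^ n \<in> vanishing_ideal S \<Longrightarrow> F \<in> vanishing_ideal S"
  by (induction n) (auto simp: irred_set_mult_iff irred_set_one)

lemma irred_set_singleton: "irred_set {x}"
  by (simp add: irred_set_def vanishing_ideal_def)

text \<open>The vanishing ideal of the image is the preimage of a prime ideal under
  substitution.\<close>

lemma irred_set_image:
  assumes "irred_set Q"
  shows "irred_set ((\<lambda>q v. eval_mpoly q (g v)) ` Q)"
proof -
  have *: "F \<in> vanishing_ideal ((\<lambda>q v. eval_mpoly q (g v)) ` Q) \<longleftrightarrow> subst_mpoly g F \<in> vanishing_ideal Q" for F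
    by (simp add: vanishing_ideal_def)
  have "subst_mpoly g F \<in> vanishing_ideal Q \<or> subst_mpoly g G \<in> vanishing_ideal Q"
    if "subst_mpoly g (F * G) \<in> vanishing_ideal Q" for F G
  proof -
    have "subst_mpoly g F * subst_mpoly g G \<in> vanishing_ideal Q"
      using that by (simp add: vanishing_ideal_def)
    with assms show ?thesis by (rule irred_setD)
  qed
  with assms show ?thesis unfolding irred_set_def * by auto
qed

text \<open>If F is nonzero at (x1, y1) and G at (x2, y2), irreducibility of B gives one y that
  works with x1 for F and with x2 for G; irreducibility of A then gives one x for both.\<close>

lemma irred_set_Times:
  assumes A: "irred_set (A :: ('v::finite \<Rightarrow> 'a::field) set)" and B: "irred_set (B :: ('w::finite \<Rightarrow> 'a) set)"
  shows "irred_set {case_sum x y | x y. x \<in> A \<and> y \<in> B}" (is "irred_set ?S")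
proof -
  define L where "L = (\<lambda>(F::('v+'w,'a) mpoly) y. subst_mpoly (case_sum Var (\<lambda>w. Const (y w))) F)"
  define R where "R = (\<lambda>(F::('v+'w,'a) mpoly) x. subst_mpoly (case_sum (\<lambda>v. Const (x v)) Var) F)"
  have L: "eval_mpoly x (L F y) = eval_mpoly (case_sum x y) F" for F x y
    unfolding L_def eval_subst_mpoly by (rule arg_cong2[of _ _ _ _ eval_mpoly]) (auto split: sum.split)
  have R: "eval_mpoly y (R F x) = eval_mpoly (case_sum x y) F" for F x y
    unfolding R_def eval_subst_mpoly by (rule arg_cong2[of _ _ _ _ eval_mpoly]) (auto split: sum.split)
  have "F \<in> vanishing_ideal ?S \<or> G \<in> vanishing_ideal ?S" if FG: "F * G \<in> vanishing_ideal ?S" for F G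
  proof (rule ccontr)
    assume "\<not> ?thesis"
    then obtain x1 y1 x2 y2 where xy: "x1 \<in> A" "y1 \<in> B" "x2 \<in> A" "y2 \<in> B"
      "eval_mpoly (case_sum x1 y1) F \<noteq> 0" "eval_mpoly (case_sum x2 y2) G \<noteq> 0"
      by (auto simp: vanishing_ideal_def)
    then have "R F x1 \<notin> vanishing_ideal B" "R G x2 \<notin> vanishing_ideal B"
      by (auto simp: vanishing_ideal_def R)
    then have "R F x1 * R G x2 \<notin> vanishing_ideal B" using B by (simp add: irred_set_mult_iff)
    then obtain y where y: "y \<in> B" "eval_mpoly (case_sum x1 y) F \<noteq> 0" "eval_mpoly (case_sum x2 y) G \<noteq> 0"
      by (auto simp: vanishing_ideal_def R)
    with xy have "L F y \<notin> vanishing_ideal A" "L G y \<notin> vanishing_ideal A"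
      by (auto simp: vanishing_ideal_def L)
    then have "L F y * L G y \<notin> vanishing_ideal A" using A by (simp add: irred_set_mult_iff)
    then obtain x where "x \<in> A" "eval_mpoly (case_sum x y) F \<noteq> 0" "eval_mpoly (case_sum x y) G \<noteq> 0"
      by (auto simp: vanishing_ideal_def L)
    with y FG show False by (auto simp: vanishing_ideal_def)
  qed
  moreover have "?S \<noteq> {}" using A B by (auto simp: irred_set_def)
  ultimately show ?thesis by (auto simp: irred_set_def)
qed

text \<open>Otherwise the product of all X - a, plus 1, would have no root.\<close>

lemma infinite_alg_closed: "infinite (UNIV :: 'a::alg_closed_field set)"
proof
  assume fin: "finite (UNIV :: 'a set)"
  define p :: "'a poly" where "p = 1 + (\<Prod>a\<in>UNIV. [:-a, 1:])"
  have "degree (\<Prod>a\<in>UNIV. [:-a, 1::'a:]) = card (UNIV :: 'a set)"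
    by (subst degree_prod_eq_sum_degree) auto
  moreover have "card (UNIV :: 'a set) > 0" using fin by (simp add: card_gt_0_iff)
  ultimately have "degree p > 0"
    unfolding p_def by (subst degree_add_eq_right) auto
  then obtain x where "poly p x = 0" using alg_closed_imp_poly_has_root by blast
  moreover have "poly (\<Prod>a\<in>UNIV. [:-a, 1::'a:]) x = 0"
    using fin by (auto simp: poly_prod prod_zero_iff)
  ultimately show False by (simp add: p_def)
qed

lemma poly_zero_cofinite:
  fixes p :: "'a::alg_closed_field poly"
  assumes "finite B" "\<And>x. x \<notin> B \<Longrightarrow> poly p x = 0"
  shows "p = 0"
proof (rule ccontr)
  assume "p \<noteq> 0"
  then have "finite {x. poly p x = 0}" by (rule poly_roots_finite)
  moreover have "UNIV \<subseteq> B \<union> {x. poly p x = 0}" using assms by auto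
  ultimately show False using infinite_alg_closed assms(1) by (meson finite_Un finite_subset)
qed

text \<open>Along the scaling, F and G become polynomials in the factor a, so some nonzero a suits
  both. With W the full index set this passes from an affine chart to its cone; with W one block of
  coordinates it produces bicones.\<close>

lemma irred_set_scale:
  fixes Q :: "('v::finite \<Rightarrow> 'a::alg_closed_field) set"
  assumes Q: "irred_set Q"
  shows "irred_set {\<lambda>v. if v \<in> W then a * q v else q v | a q. a \<noteq> 0 \<and> q \<in> Q}" (is "irred_set ?S")
proof -
  define s where "s = (\<lambda>a (q::'v\<Rightarrow>'a) v. if v \<in> W then a * q v else q v)"
  define L where "L = (\<lambda>(F::('v,'a) mpoly) a. subst_mpoly (\<lambda>v. if v \<in> W then Const a * Var v else Var v) F)"
  have L: "eval_mpoly q (L F a) = eval_mpoly (s a q) F" for F q a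
    unfolding L_def eval_subst_mpoly s_def by (rule arg_cong2[of _ _ _ _ eval_mpoly]) auto
  have P: "\<exists>f. \<forall>a. eval_mpoly (s a q) F = poly f a" for F q
  proof (induction F rule: mpoly_induct)
    case (Const a) show ?case by (rule exI[of _ "[:a:]"]) simp
  next
    case (Var v) show ?case
      by (rule exI[of _ "if v \<in> W then [:0, q v:] else [:q v:]"]) (simp add: s_def)
  next
    case (add p p') then show ?case by (metis eval_mpoly_add poly_add)
  next
    case (mult p p') then show ?case by (metis eval_mpoly_mult poly_mult)
  qed
  have S: "?S = {s a q | a q. a \<noteq> 0 \<and> q \<in> Q}" by (simp add: s_def)
  have "F \<in> vanishing_ideal ?S \<or> G \<in> vanishing_ideal ?S" if FG: "F * G \<in> vanishing_ideal ?S" for F G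
  proof (rule ccontr)
    assume "\<not> ?thesis"
    then obtain a1 q1 a2 q2 where q: "q1 \<in> Q" "q2 \<in> Q"
      "eval_mpoly (s a1 q1) F \<noteq> 0" "eval_mpoly (s a2 q2) G \<noteq> 0"
      unfolding S by (auto simp: vanishing_ideal_def)
    obtain f g where fg: "\<And>a. eval_mpoly (s a q1) F = poly f a" "\<And>a. eval_mpoly (s a q2) G = poly g a"
      using P by metis
    with q have "f \<noteq> 0" "g \<noteq> 0" by auto
    then have "f * g \<noteq> 0" by simp
    then obtain a where a: "a \<noteq> 0" "poly (f * g) a \<noteq> 0"
      using poly_zero_cofinite[of "{0}" "f * g"] by auto
    then have "L F a \<notin> vanishing_ideal Q" "L G a \<notin> vanishing_ideal Q"
      using vanishing_idealD[of "L F a" Q q1] vanishing_idealD[of "L G a" Q q2] q(1,2) fg(1)[of a] fg(2)[of a] a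
      by (auto simp: L)
    then have "L F a * L G a \<notin> vanishing_ideal Q" using Q by (simp add: irred_set_mult_iff)
    then obtain q where "q \<in> Q" "eval_mpoly (s a q) (F * G) \<noteq> 0"
      by (auto simp: vanishing_ideal_def L)
    with a FG show False unfolding S by (auto simp: vanishing_ideal_def)
  qed
  moreover have "?S \<noteq> {}" using Q unfolding S irred_set_def by (auto intro: exI[of _ 1])
  ultimately show ?thesis by (auto simp: irred_set_def)
qed

section \<open>Local parameters and orders of vanishing\<close>

text \<open>The polynomials divisible by t in the local ring of V along Z, with the denominator H
  cleared.\<close>

definition local_ideal ::
  "('v::finite \<Rightarrow> 'a::field) set \<Rightarrow> ('v \<Rightarrow> 'a) set \<Rightarrow> ('v, 'a) mpoly \<Rightarrow> ('v, 'a) mpoly set" where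
  "local_ideal V Z t = {A. \<exists>H G. H \<notin> vanishing_ideal Z \<and> H * A - t * G \<in> vanishing_ideal V}"

text \<open>A polynomial \<open>t\<close> is a local parameter when it generates the maximal ideal of the local ring of
  \<open>V\<close> along \<open>Z\<close>; orders of vanishing are then exponents of \<open>t\<close> up to units.\<close>

definition local_param ::
  "('v::finite \<Rightarrow> 'a::field) set \<Rightarrow> ('v \<Rightarrow> 'a) set \<Rightarrow> ('v, 'a) mpoly \<Rightarrow> bool" where
  "local_param V Z t \<longleftrightarrow> irred_set V \<and> irred_set Z \<and> Z \<subseteq> V \<and>
     t \<in> vanishing_ideal Z \<and> t \<notin> vanishing_ideal V \<and> vanishing_ideal Z \<subseteq> local_ideal V Z t"

definition has_order ::
  "('v::finite \<Rightarrow> 'a::field) set \<Rightarrow> ('v \<Rightarrow> 'a) set \<Rightarrow> ('v, 'a) mpoly \<Rightarrow> ('v, 'a) mpoly \<Rightarrow> nat \<Rightarrow> bool" where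
  "has_order V Z t F k \<longleftrightarrow>
     (\<exists>H U. H \<notin> vanishing_ideal Z \<and> U \<notin> vanishing_ideal Z \<and> H * F - t ^ k * U \<in> vanishing_ideal V)"

lemma local_idealI:
  "H \<notin> vanishing_ideal Z \<Longrightarrow> H * A - t * G \<in> vanishing_ideal V \<Longrightarrow> A \<in> local_ideal V Z t"
  by (auto simp: local_ideal_def)

lemma local_ideal_add:
  assumes "irred_set Z" "A \<in> local_ideal V Z t" "B \<in> local_ideal V Z t"
  shows "A + B \<in> local_ideal V Z t"
proof -
  obtain H G H' G' where *: "H \<notin> vanishing_ideal Z" "H * A - t * G \<in> vanishing_ideal V"
    "H' \<notin> vanishing_ideal Z" "H' * B - t * G' \<in> vanishing_ideal V"
    using assms(2,3) by (auto simp: local_ideal_def)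
  have "H' * (H * A - t * G) + H * (H' * B - t * G') \<in> vanishing_ideal V"
    using * by (intro vanishing_ideal_add vanishing_ideal_mult)
  also have "H' * (H * A - t * G) + H * (H' * B - t * G') = (H * H') * (A + B) - t * (H' * G + H * G')"
    by (simp add: algebra_simps)
  finally show ?thesis using * assms(1) by (intro local_idealI[of "H * H'"] irred_set_mult)
qed

lemma local_ideal_mult:
  assumes "A \<in> local_ideal V Z t" shows "B * A \<in> local_ideal V Z t"
proof -
  obtain H G where *: "H \<notin> vanishing_ideal Z" "H * A - t * G \<in> vanishing_ideal V"
    using assms by (auto simp: local_ideal_def)
  have "B * (H * A - t * G) \<in> vanishing_ideal V"
    using * by (intro vanishing_ideal_mult)
  also have "B * (H * A - t * G) = H * (B * A) - t * (B * G)"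
    by (simp add: algebra_simps)
  finally show ?thesis using * by (auto simp: local_ideal_def)
qed

lemma local_ideal_vanishing:
  assumes "irred_set Z" "A \<in> vanishing_ideal V" shows "A \<in> local_ideal V Z t"
  using assms by (intro local_idealI[of 1 _ _ _ 0]) (simp_all add: irred_set_one)

lemma local_ideal_cancel:
  assumes "irred_set Z" "M \<notin> vanishing_ideal Z" "M * A \<in> local_ideal V Z t"
  shows "A \<in> local_ideal V Z t"
proof -
  obtain H G where *: "H \<notin> vanishing_ideal Z" "H * (M * A) - t * G \<in> vanishing_ideal V"
    using assms by (auto simp: local_ideal_def)
  then have "(H * M) * A - t * G \<in> vanishing_ideal V" by (simp add: mult.assoc)
  with * assms show ?thesis by (intro local_idealI[of "H * M"] irred_set_mult)
qed

text \<open>The point \<open>g / D\<close> is a retraction onto \<open>Z\<close>, defined where \<open>M\<close> does not vanish, that is the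
  identity modulo the local ideal.\<close>

lemma vanishing_ideal_subset_local_ideal:
  assumes Z: "irred_set Z" and M: "M \<notin> vanishing_ideal Z" and D: "D \<notin> vanishing_ideal Z"
    and g: "\<And>v. D * Var v - g v \<in> local_ideal V Z t"
    and retr: "\<And>x. x \<in> V \<Longrightarrow> eval_mpoly x M \<noteq> 0 \<Longrightarrow>
      eval_mpoly x D \<noteq> 0 \<and> (\<lambda>v. eval_mpoly x (g v) / eval_mpoly x D) \<in> Z"
  shows "vanishing_ideal Z \<subseteq> local_ideal V Z t"
proof
  let ?L = "local_ideal V Z t"
  let ?r = "\<lambda>x v. eval_mpoly x (g v) / eval_mpoly x D"
  \<comment> \<open>Up to a power of D, each A is congruent to a B whose value at x is, up to the
    same power, that of A at the retracted point. If A vanishes on Z, then M * B vanishes on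
    V.\<close>
  have ind: "\<exists>N B. D ^ N * A - B \<in> ?L \<and>
      (\<forall>x. eval_mpoly x D \<noteq> 0 \<longrightarrow> eval_mpoly x B = eval_mpoly x D ^ N * eval_mpoly (?r x) A)" for A
  proof (induction A rule: mpoly_induct)
    case (Const a)
    show ?case by (rule exI[of _ 0], rule exI[of _ "Const a"])
      (simp add: local_ideal_vanishing[OF Z] vanishing_ideal_def)
  next
    case (Var v)
    show ?case by (rule exI[of _ 1], rule exI[of _ "g v"]) (simp add: g)
  next
    case (add A A')
    then obtain N B N' B' where *: "D ^ N * A - B \<in> ?L" "D ^ N' * A' - B' \<in> ?L"
      "\<And>x. eval_mpoly x D \<noteq> 0 \<Longrightarrow> eval_mpoly x B = eval_mpoly x D ^ N * eval_mpoly (?r x) A"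
      "\<And>x. eval_mpoly x D \<noteq> 0 \<Longrightarrow> eval_mpoly x B' = eval_mpoly x D ^ N' * eval_mpoly (?r x) A'"
      by metis
    have "D ^ N' * (D ^ N * A - B) + D ^ N * (D ^ N' * A' - B') \<in> ?L"
      using * by (intro local_ideal_add[OF Z] local_ideal_mult)
    also have "D ^ N' * (D ^ N * A - B) + D ^ N * (D ^ N' * A' - B') =
      D ^ (N + N') * (A + A') - (D ^ N' * B + D ^ N * B')"
      by (simp add: algebra_simps power_add)
    finally show ?case
      by (intro exI[of _ "N + N'"] exI[of _ "D ^ N' * B + D ^ N * B'"])
         (simp add: * power_add algebra_simps)
  next
    case (mult A A')
    then obtain N B N' B' where *: "D ^ N * A - B \<in> ?L" "D ^ N' * A' - B' \<in> ?L"
      "\<And>x. eval_mpoly x D \<noteq> 0 \<Longrightarrow> eval_mpoly x B = eval_mpoly x D ^ N * eval_mpoly (?r x) A"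
      "\<And>x. eval_mpoly x D \<noteq> 0 \<Longrightarrow> eval_mpoly x B' = eval_mpoly x D ^ N' * eval_mpoly (?r x) A'"
      by metis
    have "(D ^ N * A) * (D ^ N' * A' - B') + B' * (D ^ N * A - B) \<in> ?L"
      using * by (intro local_ideal_add[OF Z] local_ideal_mult)
    also have "(D ^ N * A) * (D ^ N' * A' - B') + B' * (D ^ N * A - B) =
      D ^ (N + N') * (A * A') - B * B'"
      by (simp add: algebra_simps power_add)
    finally show ?case
      by (intro exI[of _ "N + N'"] exI[of _ "B * B'"])
         (simp add: * power_add)
  qed
  fix A assume A: "A \<in> vanishing_ideal Z"
  obtain N B where *: "D ^ N * A - B \<in> ?L"
    "\<And>x. eval_mpoly x D \<noteq> 0 \<Longrightarrow> eval_mpoly x B = eval_mpoly x D ^ N * eval_mpoly (?r x) A"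
    using ind by blast
  have "M * B \<in> vanishing_ideal V"
  proof (rule vanishing_idealI)
    fix x assume "x \<in> V"
    then show "eval_mpoly x (M * B) = 0"
      using retr[of x] *(2)[of x] vanishing_idealD[OF A, of "?r x"]
      by (cases "eval_mpoly x M = 0") auto
  qed
  then have "M * B \<in> ?L" by (rule local_ideal_vanishing[OF Z])
  then have "M * (D ^ N * A - B) + M * B \<in> ?L"
    using * by (intro local_ideal_add[OF Z]) (auto intro: local_ideal_mult)
  then have "(M * D ^ N) * A \<in> ?L" by (simp add: algebra_simps)
  moreover have "M * D ^ N \<notin> vanishing_ideal Z"
    using M D irred_set_power[OF Z] by (intro irred_set_mult[OF Z]) auto
  ultimately show "A \<in> ?L" using local_ideal_cancel[OF Z] by blast
qed

section \<open>Powers of the maximal ideal and exponents of a local parameter\<close>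

lemma module_times: "Modules.module (times :: 'r::comm_ring_1 \<Rightarrow> 'r \<Rightarrow> 'r)"
  unfolding Modules.module_def by (simp add: algebra_simps)

lemma ideal_power_induct [consumes 1, case_names base step]:
  fixes I :: "'r::comm_ring_1 set"
  assumes "x \<in> ideal_power I n" "P 0"
    "\<And>r fs y. length fs = n \<Longrightarrow> set fs \<subseteq> I \<Longrightarrow> P y \<Longrightarrow> P (r * prod_list fs + y)"
  shows "P x"
  using assms(1) unfolding ideal_power_def
  by (rule Modules.module.span_induct_alt[OF module_times]) (use assms(2,3) in auto)

text \<open>The combination that multiplies two congruences h b = p g and h' a = q g' modulo an
  ideal.\<close>

lemma local_product_identity:
  fixes a :: "'r::comm_ring_1"
  shows "(h' * a) * (h * b - p * g) + (p * g) * (h' * a - q * g') = (h' * h) * (a * b) - (q * p) * (g * g')"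
  by (simp add: algebra_simps)

text \<open>A generator of the n-th power is a product of n elements of
  \<open>vanishing_ideal Z\<close>, each a multiple of t up to a unit; multiplying and summing keeps
  the factor t^n.\<close>

lemma ideal_power_local:
  assumes lp: "local_param V Z t" and A: "A \<in> ideal_power (vanishing_ideal Z) n"
  shows "\<exists>H G. H \<notin> vanishing_ideal Z \<and> H * A - t ^ n * G \<in> vanishing_ideal V"
proof -
  have Z: "irred_set Z" using lp by (simp add: local_param_def)
  have prods: "\<exists>H G. H \<notin> vanishing_ideal Z \<and> H * prod_list fs - t ^ length fs * G \<in> vanishing_ideal V"
    if "set fs \<subseteq> vanishing_ideal Z" for fs
    using that
  proof (induction fs)
    case Nil
    show ?case by (rule exI[of _ 1], rule exI[of _ 1]) (simp add: irred_set_one[OF Z])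
  next
    case (Cons f fs)
    then obtain H G where 1: "H \<notin> vanishing_ideal Z" "H * prod_list fs - t ^ length fs * G \<in> vanishing_ideal V"
      by auto
    have "f \<in> local_ideal V Z t" using Cons lp by (auto simp: local_param_def)
    then obtain H' G' where 2: "H' \<notin> vanishing_ideal Z" "H' * f - t * G' \<in> vanishing_ideal V"
      by (auto simp: local_ideal_def)
    have "(H' * f) * (H * prod_list fs - t ^ length fs * G) + (t ^ length fs * G) * (H' * f - t * G')
        \<in> vanishing_ideal V"
      using 1 2 by (intro vanishing_ideal_add vanishing_ideal_mult)
    also have "(H' * f) * (H * prod_list fs - t ^ length fs * G) + (t ^ length fs * G) * (H' * f - t * G')
       = (H' * H) * prod_list (f # fs) - t ^ length (f # fs) * (G * G')"
      using local_product_identity[of H' f H "prod_list fs" "t ^ length fs" G t G'] by simp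
    finally show ?case using irred_set_mult[OF Z 2(1) 1(1)] by blast
  qed
  from A show ?thesis
  proof (induction rule: ideal_power_induct)
    case base
    show ?case by (rule exI[of _ 1], rule exI[of _ 0]) (simp add: irred_set_one[OF Z])
  next
    case (step r fs y)
    define x where "x = prod_list fs"
    obtain H G where 1: "H \<notin> vanishing_ideal Z" "H * x - t ^ n * G \<in> vanishing_ideal V"
      using prods[OF step(2)] step by (auto simp: x_def)
    obtain H' G' where 2: "H' \<notin> vanishing_ideal Z" "H' * y - t ^ n * G' \<in> vanishing_ideal V"
      using step by auto
    have "(H' * r) * (H * x - t ^ n * G) + H * (H' * y - t ^ n * G') \<in> vanishing_ideal V"
      using 1 2 by (intro vanishing_ideal_add vanishing_ideal_mult)
    also have "(H' * r) * (H * x - t ^ n * G) + H * (H' * y - t ^ n * G')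
       = (H' * H) * (r * x + y) - t ^ n * (H' * r * G + H * G')"
      by (simp add: algebra_simps)
    finally show ?case using irred_set_mult[OF Z 2(1) 1(1)] unfolding x_def by blast
  qed
qed

lemma power_mem_ideal_power: "t \<in> I \<Longrightarrow> t ^ k * U \<in> ideal_power I k"
  unfolding ideal_power_def
  by (subst mult.commute, intro Modules.module.span_scale[OF module_times] Modules.module.span_base[OF module_times] CollectI exI[of _ "replicate k t"])
     (auto simp: prod_list_replicate set_replicate_conv_if)

lemma order_along_ge:
  assumes "t \<in> vanishing_ideal Z" "H \<notin> vanishing_ideal Z" "H * F - t ^ k * U \<in> vanishing_ideal V"
  shows "enat k \<le> order_along V Z F"
  unfolding order_along_def
proof (rule Sup_upper, intro CollectI exI conjI)
  show "H * F = t ^ k * U + (H * F - t ^ k * U)" by simp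
qed (use assms in \<open>auto intro: power_mem_ideal_power\<close>)

lemma local_difference_identity:
  fixes p :: "'r::comm_ring_1"
  shows "h * (h' * f - p * u) - h' * (h * f - (p * q) * g) = p * (q * (h' * g)) - p * (h * u)"
  by (simp add: algebra_simps)

lemma local_step_identity:
  fixes p :: "'r::comm_ring_1"
  shows "h' * (h * f - p * g) + p * (h' * g - t * g') = (h' * h) * f - (t * p) * g'"
  by (simp add: algebra_simps)

lemma cancel_param_power:
  assumes lp: "local_param V Z t" and "t ^ k * A - t ^ k * B \<in> vanishing_ideal V"
  shows "A - B \<in> vanishing_ideal V"
proof -
  have "t ^ k * (A - B) \<in> vanishing_ideal V" using assms(2) by (simp add: right_diff_distrib)
  then show ?thesis using lp irred_set_power[of V t k] irred_setD[of V "t ^ k" "A - B"]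
    unfolding local_param_def by blast
qed

text \<open>For n > k, cancelling t^k leaves a product of two units equal to a multiple of t on V,
  which would have to vanish on Z.\<close>

lemma has_order_bound:
  assumes lp: "local_param V Z t" and ho: "has_order V Z t F k"
    and H: "H \<notin> vanishing_ideal Z" "H * F - t ^ n * G \<in> vanishing_ideal V"
  shows "n \<le> k"
proof (rule ccontr)
  assume "\<not> n \<le> k"
  then obtain j where n: "n = k + Suc j" by (metis add_Suc_right less_imp_Suc_add not_le)
  have Z: "irred_set Z" "Z \<subseteq> V" "t \<in> vanishing_ideal Z" using lp by (auto simp: local_param_def)
  obtain H' U where 1: "H' \<notin> vanishing_ideal Z" "U \<notin> vanishing_ideal Z" "H' * F - t ^ k * U \<in> vanishing_ideal V"
    using ho by (auto simp: has_order_def)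
  have "H * (H' * F - t ^ k * U) - H' * (H * F - t ^ n * G) \<in> vanishing_ideal V"
    using vanishing_ideal_mult[OF 1(3)] vanishing_ideal_mult[OF H(2)] by (rule vanishing_ideal_diff)
  also have "H * (H' * F - t ^ k * U) - H' * (H * F - t ^ n * G) =
     t ^ k * (t ^ Suc j * (H' * G)) - t ^ k * (H * U)"
    unfolding n power_add by (rule local_difference_identity)
  finally have "t ^ Suc j * (H' * G) - H * U \<in> vanishing_ideal V" by (rule cancel_param_power[OF lp])
  then have "t ^ Suc j * (H' * G) - H * U \<in> vanishing_ideal Z"
    using Z vanishing_ideal_mono by blast
  moreover have "t ^ Suc j * (H' * G) \<in> vanishing_ideal Z"
    using Z(3) by (simp add: vanishing_ideal_def)
  ultimately have "H * U \<in> vanishing_ideal Z"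
    by (simp add: vanishing_ideal_def)
  then show False using irred_set_mult[OF Z(1) H(1) 1(2)] by blast
qed

lemma order_along_eq:
  assumes lp: "local_param V Z t" and ho: "has_order V Z t F k"
  shows "order_along V Z F = enat k"
proof (rule antisym)
  obtain H' U where 1: "H' \<notin> vanishing_ideal Z" "U \<notin> vanishing_ideal Z" "H' * F - t ^ k * U \<in> vanishing_ideal V"
    using ho by (auto simp: has_order_def)
  then show "enat k \<le> order_along V Z F" using lp
    by (intro order_along_ge[of t Z]) (auto simp: local_param_def)
  have Z: "irred_set Z" using lp by (auto simp: local_param_def)
  show "order_along V Z F \<le> enat k" unfolding order_along_def
  proof (rule Sup_least, clarsimp)
    fix n H A B assume H: "H \<notin> vanishing_ideal Z" "A \<in> ideal_power (vanishing_ideal Z) n"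
      "B \<in> vanishing_ideal V" "H * F = A + B"
    obtain H1 G where G: "H1 \<notin> vanishing_ideal Z" "H1 * A - t ^ n * G \<in> vanishing_ideal V"
      using ideal_power_local[OF lp H(2)] by blast
    have "(H1 * A - t ^ n * G) + H1 * B \<in> vanishing_ideal V"
      using G H by (intro vanishing_ideal_add vanishing_ideal_mult)
    also have "(H1 * A - t ^ n * G) + H1 * B = (H1 * H) * F - t ^ n * G"
      unfolding mult.assoc H(4) by (simp add: algebra_simps)
    finally show "n \<le> k" using irred_set_mult[OF Z G(1) H(1)] by (intro has_order_bound[OF lp ho])
  qed
qed

text \<open>Serves the prime divisors other than the diagonals, along which no local parameter is at
  hand. For n > 0 the n-th power of the ideal stays inside the prime ideal of Z.\<close>

lemma order_along_zero:
  assumes Z: "irred_set Z" "Z \<subseteq> V" and F: "F \<notin> vanishing_ideal Z"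
  shows "order_along V Z F = 0"
proof -
  have "n = 0" if H: "H \<notin> vanishing_ideal Z" "A \<in> ideal_power (vanishing_ideal Z) n"
      "B \<in> vanishing_ideal V" "H * F = A + B" for n H A B
  proof (rule ccontr)
    assume n: "n \<noteq> 0"
    have "A \<in> vanishing_ideal Z"
      using H(2)
    proof (induction rule: ideal_power_induct)
      case base show ?case by (simp add: vanishing_ideal_def)
    next
      case (step r fs y)
      with n obtain f fs' where "fs = f # fs'" by (cases fs) auto
      with step have "prod_list fs \<in> vanishing_ideal Z" by (auto simp: vanishing_ideal_def)
      then show ?case using step by (intro vanishing_ideal_add vanishing_ideal_mult)
    qed
    then have "H * F \<in> vanishing_ideal Z" using H vanishing_ideal_mono[OF Z(2)]
      by (auto intro: vanishing_ideal_add)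
    then show False using irred_setD[OF Z(1)] H(1) F by blast
  qed
  then have "order_along V Z F \<le> 0" unfolding order_along_def
    by (intro Sup_least) (auto simp: enat_0_iff)
  then show ?thesis by simp
qed

lemma has_orderI:
  "H \<notin> vanishing_ideal Z \<Longrightarrow> U \<notin> vanishing_ideal Z \<Longrightarrow> H * F - t ^ k * U \<in> vanishing_ideal V
    \<Longrightarrow> has_order V Z t F k"
  by (auto simp: has_order_def)

lemma has_order_zero: "local_param V Z t \<Longrightarrow> F \<notin> vanishing_ideal Z \<Longrightarrow> has_order V Z t F 0"
  unfolding has_order_def local_param_def
  by (intro exI[of _ 1] exI[of _ F]) (simp add: irred_set_one)

lemma has_order_mult:
  assumes lp: "local_param V Z t" and F: "has_order V Z t F k" and G: "has_order V Z t G l"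
  shows "has_order V Z t (F * G) (k + l)"
proof -
  have Z: "irred_set Z" using lp by (auto simp: local_param_def)
  obtain H U where 1: "H \<notin> vanishing_ideal Z" "U \<notin> vanishing_ideal Z" "H * F - t ^ k * U \<in> vanishing_ideal V"
    using F by (auto simp: has_order_def)
  obtain H' U' where 2: "H' \<notin> vanishing_ideal Z" "U' \<notin> vanishing_ideal Z" "H' * G - t ^ l * U' \<in> vanishing_ideal V"
    using G by (auto simp: has_order_def)
  have "(H' * G) * (H * F - t ^ k * U) + (t ^ k * U) * (H' * G - t ^ l * U') \<in> vanishing_ideal V"
    using 1 2 by (intro vanishing_ideal_add vanishing_ideal_mult)
  also have "(H' * G) * (H * F - t ^ k * U) + (t ^ k * U) * (H' * G - t ^ l * U')
    = (H * H') * (F * G) - t ^ (k + l) * (U * U')"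
    using local_product_identity[of H' G H F "t ^ k" U "t ^ l" U'] by (simp only: power_add ac_simps)
  finally show ?thesis using 1 2 Z by (intro has_orderI[of "H * H'" _ "U * U'"] irred_set_mult)
qed

lemma has_order_unique:
  "local_param V Z t \<Longrightarrow> has_order V Z t F k \<Longrightarrow> has_order V Z t F l \<Longrightarrow> k = l"
  using order_along_eq[of V Z t F k] order_along_eq[of V Z t F l] by simp

text \<open>The bound provides a greatest exponent. Its cofactor G is a unit, since otherwise G
  would supply one more factor t.\<close>

lemma has_order_exists:
  assumes lp: "local_param V Z t"
    and bound: "\<And>n H G. H \<notin> vanishing_ideal Z \<Longrightarrow> H * F - t ^ n * G \<in> vanishing_ideal V \<Longrightarrow> n \<le> N"
  obtains k where "has_order V Z t F k"
proof -
  have Z: "irred_set Z" using lp by (auto simp: local_param_def)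
  define P where "P = (\<lambda>n. \<exists>H G. H \<notin> vanishing_ideal Z \<and> H * F - t ^ n * G \<in> vanishing_ideal V)"
  have P0: "P 0" unfolding P_def by (rule exI[of _ 1], rule exI[of _ F]) (simp add: irred_set_one[OF Z])
  have Pb: "n \<le> N" if "P n" for n using that bound unfolding P_def by blast
  have k: "P (Greatest P)" using P0 Pb by (rule GreatestI_nat)
  define k where "k = Greatest P"
  obtain H G where 1: "H \<notin> vanishing_ideal Z" "H * F - t ^ k * G \<in> vanishing_ideal V"
    using k unfolding P_def k_def by blast
  have "G \<notin> vanishing_ideal Z"
  proof
    assume "G \<in> vanishing_ideal Z"
    then obtain H' G' where 2: "H' \<notin> vanishing_ideal Z" "H' * G - t * G' \<in> vanishing_ideal V"
      using lp unfolding local_param_def local_ideal_def by blast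
    have "H' * (H * F - t ^ k * G) + t ^ k * (H' * G - t * G') \<in> vanishing_ideal V"
      using 1 2 by (intro vanishing_ideal_add vanishing_ideal_mult)
    also have "H' * (H * F - t ^ k * G) + t ^ k * (H' * G - t * G') = (H' * H) * F - t ^ Suc k * G'"
      unfolding power_Suc by (rule local_step_identity)
    finally have "(H' * H) * F - t ^ Suc k * G' \<in> vanishing_ideal V" .
    moreover have "H' * H \<notin> vanishing_ideal Z" using 1 2 Z by (intro irred_set_mult)
    ultimately have "P (Suc k)" unfolding P_def by blast
    then have "Suc k \<le> Greatest P" using Pb by (rule Greatest_le_nat)
    then show False by (simp add: k_def)
  qed
  with 1 have "has_order V Z t F k" by (intro has_orderI[of H _ G])
  then show ?thesis by (rule that)
qed

section \<open>Four cyclic coordinates\<close>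

lemma exhaust_4: "(x::4) = 0 \<or> x = 1 \<or> x = 2 \<or> x = 3"
proof (induct x)
  case (of_int z)
  then have "z = 0 \<or> z = 1 \<or> z = 2 \<or> z = 3" by auto
  then show ?case by auto
qed

lemma index_cases: "j = i \<or> j = i + 1 \<or> j = i + 2 \<or> j = i + (3::4)"
  using exhaust_4[of "j - i"] by (auto simp: diff_eq_eq add.commute)

lemma forall_4: "(\<forall>i::4. P i) \<longleftrightarrow> P 0 \<and> P 1 \<and> P 2 \<and> P 3"
  by (metis exhaust_4)

lemma UNIV_4: "(UNIV::4 set) = {0, 1, 2, 3}"
  using exhaust_4 by auto

lemma sum_4: "(\<Sum>i\<in>UNIV. f (i::4)) = (f 0 :: 'b::comm_monoid_add) + f 1 + f 2 + f 3"
proof -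
  have "(\<Sum>i\<in>UNIV. f (i::4)) = sum f {0, 1, 2, 3}" by (simp only: UNIV_4)
  also have "\<dots> = f 0 + (f 1 + (f 2 + f 3))" by simp
  finally show ?thesis by (simp only: add.assoc)
qed

lemma index_4_simps [simp]:
  "(4::4) = 0" "(5::4) = 1" "(6::4) = 2" "(- 1::4) = 3" "(- 2::4) = 2" "(- 3::4) = 1"
  by simp_all

lemma tuple4_simps [simp]:
  "tuple4 a b c d 0 = a" "tuple4 a b c d 1 = b" "tuple4 a b c d 2 = c" "tuple4 a b c d 3 = d"
  by (simp_all add: tuple4_def)

lemma fun_4_eqI:
  assumes "x 0 = y 0" "x 1 = y 1" "x 2 = y 2" "x 3 = y 3" shows "x = (y :: 4 \<Rightarrow> 'b)"
proof
  fix i show "x i = y i" using exhaust_4[of i] assms by (elim disjE) (simp_all only:)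
qed

section \<open>Projective points\<close>

lemma mem_proj_pt: "y \<in> proj_pt x \<longleftrightarrow> (\<exists>a. a \<noteq> 0 \<and> y = (\<lambda>i. a * x i))"
  by (auto simp: proj_pt_def)

lemma self_mem_proj_pt: "x \<in> proj_pt x"
  by (auto simp: mem_proj_pt intro!: exI[of _ 1])

lemma proj_pt_scale: "a \<noteq> 0 \<Longrightarrow> proj_pt (\<lambda>i. a * x i) = proj_pt x"
proof -
  assume a: "a \<noteq> 0"
  have "\<exists>b. b \<noteq> 0 \<and> (\<lambda>i. r * x i) = (\<lambda>i. b * (a * x i))" if "r \<noteq> 0" for r
    using a that by (intro exI[of _ "r / a"]) auto
  moreover have "\<exists>b. b \<noteq> 0 \<and> (\<lambda>i. r * (a * x i)) = (\<lambda>i. b * x i)" if "r \<noteq> 0" for r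
    using a that by (intro exI[of _ "r * a"]) auto
  ultimately show ?thesis by (auto simp: set_eq_iff mem_proj_pt)
qed

lemma proj_pt_eq_iff: "proj_pt x = proj_pt y \<longleftrightarrow> (\<exists>a. a \<noteq> 0 \<and> y = (\<lambda>i. a * x i))"
  by (metis mem_proj_pt proj_pt_scale self_mem_proj_pt)

lemma cone_singleton: "cone {proj_pt x} = proj_pt x"
  by (simp add: cone_def)

section \<open>The curve in characteristic two\<close>

locale mu4 =
  fixes c :: "'a::alg_closed_field"
  assumes char2: "CHAR('a) = 2" and c0: "c \<noteq> 0"
begin

lemma two: "(2::'a) = 0"
  using of_nat_CHAR[where 'a='a] char2 by simp

lemma add_self: "(x::'a) + x = 0"
  by (metis mult_2 mult_zero_left two)

lemma add_self_left: "(x::'a) + (x + y) = y"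
  by (simp add: add_self flip: add.assoc)

lemma minus_eq: "(x::'a) - y = x + y" "- x = x"
  using uminus_CHAR_2[OF char2] minus_CHAR_2[OF char2] by auto

lemma bit0: "(numeral (Num.Bit0 n)::'a) = 0"
  unfolding numeral_Bit0 by (rule add_self)

lemma bit1: "(numeral (Num.Bit1 n)::'a) = 1"
  unfolding numeral_Bit1 by (simp only: add_self) simp

lemma add_eq_0: "(x::'a) + y = 0 \<longleftrightarrow> x = y"
  by (metis add_self add_self_left add_0_right)

lemma power4: "(x::'a) ^ 4 = x * (x * (x * x))"
  by (simp add: power4_eq_xxxx mult.assoc)

text \<open>Rewriting to sorted sums of sorted monomials in which equal terms cancel in pairs; this
  settles polynomial identities in characteristic 2.\<close>

lemmas ring2 = add_self add_self_left minus_eq bit0 bit1 distrib_left distrib_right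
  mult.assoc mult.commute mult.left_commute add.assoc add.commute add.left_commute
  mult_zero_left mult_zero_right add_0_left add_0_right mult_1_left mult_1_right
  power2_eq_square power3_eq_cube power4

lemma square_eq_iff2: "(x::'a)^2 = y^2 \<longleftrightarrow> x = y"
proof -
  have "x^2 + y^2 = (x + y)^2" by (simp only: ring2)
  then show ?thesis by (metis add_eq_0 power2_eq_square mult_eq_0_iff)
qed

abbreviation C where "C \<equiv> cone (mu4_curve c)"

lemma mem_C: "x \<in> C \<longleftrightarrow> x \<noteq> (\<lambda>_. 0) \<and> (x 0 + x 2)^2 = c^2 * x 1 * x 3 \<and> (x 1 + x 3)^2 = c^2 * x 0 * x 2"
proof -
  have *: "eval_mpoly x (mu4_eq1 c) = 0 \<longleftrightarrow> (x 0 + x 2)^2 = c^2 * x 1 * x 3"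
    "eval_mpoly x (mu4_eq2 c) = 0 \<longleftrightarrow> (x 1 + x 3)^2 = c^2 * x 0 * x 2" for x
    by (simp_all add: mu4_eq1_def mu4_eq2_def)
  have s: "(a * x 0 + a * x 2)^2 = c^2 * (a * x 1) * (a * x 3)" "(a * x 1 + a * x 3)^2 = c^2 * (a * x 0) * (a * x 2)"
    if "(x 0 + x 2)^2 = c^2 * x 1 * x 3" "(x 1 + x 3)^2 = c^2 * x 0 * x 2" for a and x :: "4 \<Rightarrow> 'a"
  proof -
    have "(a * x 0 + a * x 2)^2 = a^2 * (x 0 + x 2)^2" "(a * x 1 + a * x 3)^2 = a^2 * (x 1 + x 3)^2"
      by (simp_all only: power_mult_distrib flip: distrib_left)
    with that show "(a * x 0 + a * x 2)^2 = c^2 * (a * x 1) * (a * x 3)" "(a * x 1 + a * x 3)^2 = c^2 * (a * x 0) * (a * x 2)"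
      by (simp_all add: power2_eq_square)
  qed
  show ?thesis
  proof
    assume "x \<in> C"
    then obtain y a where "y \<noteq> (\<lambda>_. 0)" "a \<noteq> 0" "x = (\<lambda>i. a * y i)"
       "(y 0 + y 2)^2 = c^2 * y 1 * y 3" "(y 1 + y 3)^2 = c^2 * y 0 * y 2"
      by (auto simp: cone_def mu4_curve_def mem_proj_pt *)
    then show "x \<noteq> (\<lambda>_. 0) \<and> (x 0 + x 2)^2 = c^2 * x 1 * x 3 \<and> (x 1 + x 3)^2 = c^2 * x 0 * x 2"
      using s[of y a] by (auto simp: fun_eq_iff)
  next
    assume "x \<noteq> (\<lambda>_. 0) \<and> (x 0 + x 2)^2 = c^2 * x 1 * x 3 \<and> (x 1 + x 3)^2 = c^2 * x 0 * x 2"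
    then show "x \<in> C" using self_mem_proj_pt[of x] by (auto simp: cone_def mu4_curve_def *)
  qed
qed

text \<open>Both equations in cyclic form: even i gives the first, odd i the second.\<close>

lemma curve_eq: "x \<in> C \<Longrightarrow> (x i + x (i + 2))^2 = c^2 * x (i + 1) * x (i + 3)"
  using exhaust_4[of i] by (auto simp: mem_C ac_simps)

lemma C_nonzero: "x \<in> C \<Longrightarrow> \<exists>i. x i \<noteq> 0"
  by (auto simp: mem_C)

lemma C_I: "x i \<noteq> 0 \<Longrightarrow> (x 0 + x 2)^2 = c^2 * x 1 * x 3 \<Longrightarrow> (x 1 + x 3)^2 = c^2 * x 0 * x 2 \<Longrightarrow> x \<in> C"
  by (auto simp: mem_C)

lemma C_scale:
  assumes "x \<in> C" "a \<noteq> 0" shows "(\<lambda>i. a * x i) \<in> C"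
proof -
  obtain i where "x i \<noteq> 0" using C_nonzero assms by blast
  moreover have "(a * x 0 + a * x 2)^2 = a^2 * (x 0 + x 2)^2" "(a * x 1 + a * x 3)^2 = a^2 * (x 1 + x 3)^2"
    by (simp_all only: power_mult_distrib flip: distrib_left)
  ultimately show ?thesis using assms
    by (intro C_I[of _ i]) (auto simp: mem_C power2_eq_square)
qed

lemma proj_pt_in_curve [simp]: "x \<in> C \<Longrightarrow> proj_pt x \<in> mu4_curve c"
  unfolding mem_C by (auto simp: mu4_curve_def mu4_eq1_def mu4_eq2_def)

lemma curve_iff: "S \<in> mu4_curve c \<longleftrightarrow> (\<exists>x\<in>C. S = proj_pt x)"
proof
  assume S: "S \<in> mu4_curve c"
  then obtain x where x: "S = proj_pt x" by (auto simp: mu4_curve_def)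
  with S have "x \<in> C" using self_mem_proj_pt[of x] by (auto simp: cone_def)
  with x show "\<exists>x\<in>C. S = proj_pt x" by blast
qed auto

lemma mem_curve_point:
  assumes "S \<in> mu4_curve c" "x \<in> S" shows "x \<in> C" "S = proj_pt x"
proof -
  obtain y where y: "y \<in> C" "S = proj_pt y" using assms curve_iff by blast
  then obtain a where "a \<noteq> 0" "x = (\<lambda>i. a * y i)" using assms by (auto simp: mem_proj_pt)
  with y show "x \<in> C" "S = proj_pt x" using C_scale proj_pt_scale by metis+
qed

lemma C_shift: assumes "x \<in> C" shows "(\<lambda>j. x (j - n)) \<in> C"
proof -
  obtain i where "x i \<noteq> 0" using C_nonzero assms by blast
  then show ?thesis using exhaust_4[of n] curve_eq[OF assms, of 0] curve_eq[OF assms, of 1]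
    by (intro C_I[of _ "i + n"]) (elim disjE; simp add: mult_ac add.commute)+
qed

text \<open>Two opposite charts therefore cover the curve. If two opposite coordinates vanished, one
  equation would make the other two equal and the other equation would make their product
  zero.\<close>

lemma C_opposite:
  assumes x: "x \<in> C" "x i = 0" shows "x (i + 2) \<noteq> 0"
proof
  assume 2: "x (i + 2) = 0"
  have "(x (i + 1) + x (i + 3))^2 = 0"
    using curve_eq[OF x(1), of "i + 1"] x(2) 2 by (simp add: add.assoc)
  then have e: "x (i + 1) = x (i + 3)" by (simp add: add_eq_0)
  have "c^2 * (x (i + 1) * x (i + 3)) = 0" using curve_eq[OF x(1), of i] x(2) 2 by (simp add: mult.assoc)
  then have "x (i + 1) = 0" "x (i + 3) = 0" using e c0 by auto
  then have "x j = 0" for j using x 2 index_cases[of j i] by metis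
  then show False using C_nonzero x by blast
qed

section \<open>The affine chart\<close>

text \<open>The chart \<open>X\<^sub>2 = c\<close> with coordinates \<open>v = (X\<^sub>1 + X\<^sub>3) / c\<^sup>2\<close> and \<open>Y = X\<^sub>1 + v\<^sup>2\<close>. Changing the sign of a
  point exchanges \<open>X\<^sub>1\<close> and \<open>X\<^sub>3\<close>, hence sends \<open>Y\<close> to \<open>Y + c\<^sup>2 v\<close>.\<close>

definition onE where "onE v Y \<longleftrightarrow> Y * Y = c * (c * (v * Y)) + c * (c * (v * (v * v))) + (1 :: 'a)"

text \<open>With X2 = c and X1 + X3 = c^2 v the second curve equation gives X0 = c v^2. Shifting X1
  by v^2 cancels v^4 in the first one and leaves the cubic \<open>onE\<close>.\<close>

definition apt :: "'a \<Rightarrow> 'a \<Rightarrow> 4 \<Rightarrow> 'a" where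
  "apt v Y = tuple4 (c * (v * v)) (Y + v * v) c (Y + v * v + c * (c * v))"

lemma apt_simps [simp]:
  "apt v Y 0 = c * (v * v)" "apt v Y 1 = Y + v * v" "apt v Y 2 = c" "apt v Y 3 = Y + v * v + c * (c * v)"
  by (simp_all add: apt_def)

lemma onE_square: "onE v Y \<Longrightarrow> Y * Y = c * (c * (v * Y)) + c * (c * (v * (v * v))) + 1"
  "onE v Y \<Longrightarrow> Y * (Y * z) = (c * (c * (v * Y)) + c * (c * (v * (v * v))) + 1) * z"
  by (simp_all add: onE_def flip: mult.assoc)

lemma apt_in_C: "onE v Y \<Longrightarrow> apt v Y \<in> C"
proof -
  assume Y: "onE v Y"
  have "apt v Y 2 \<noteq> 0" using c0 by simp
  then have "apt v Y \<noteq> (\<lambda>_. 0)" by metis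
  moreover have "(apt v Y 0 + apt v Y 2)\<^sup>2 = c\<^sup>2 * apt v Y 1 * apt v Y 3"
    unfolding apt_simps by (simp only: ring2 onE_square[OF Y])
  moreover have "(apt v Y 1 + apt v Y 3)\<^sup>2 = c\<^sup>2 * apt v Y 0 * apt v Y 2"
    unfolding apt_simps by (simp only: ring2)
  ultimately show ?thesis unfolding mem_C by blast
qed

lemma onE_conj: "onE v Y \<Longrightarrow> onE v (Y + c * (c * v))"
  unfolding onE_def by (simp only: ring2 onE_square)

lemma onE_exists: "\<exists>Y. onE v Y"
proof -
  have "\<exists>Y. poly [:c * (c * (v * (v * v))) + 1, c * (c * v), 1:] Y = 0"
    by (rule alg_closed_imp_poly_has_root) simp
  then obtain Y where "c * (c * (v * (v * v))) + 1 + Y * (c * (c * v) + Y) = 0" by auto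
  then have "(c * (c * (v * Y)) + c * (c * (v * (v * v))) + 1) + Y * Y = 0" by (simp only: ring2)
  then have "Y * Y = c * (c * (v * Y)) + c * (c * (v * (v * v))) + 1" by (simp only: add_eq_0)
  then show ?thesis unfolding onE_def by auto
qed

lemma C_apt:
  assumes x: "x \<in> C" "x 2 \<noteq> 0"
  obtains v Y where "onE v Y" "x = (\<lambda>i. (x 2 / c) * apt v Y i)"
proof -
  define u where "u = x 2 / c"
  define v where "v = (x 1 + x 3) / (c * c * u)"
  define Y where "Y = x 1 / u + v * v"
  have u: "u \<noteq> 0" "x 2 = u * c" using x c0 by (auto simp: u_def)
  have e: "(x 1 + x 3)^2 = c^2 * x 0 * x 2" "(x 0 + x 2)^2 = c^2 * x 1 * x 3" using x by (auto simp: mem_C)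
  have 13: "x 1 + x 3 = c * c * u * v" using u c0 by (simp add: v_def)
  have "(c * c * c * u) * x 0 = (c * c * c * u) * (u * (c * (v * v)))"
    using e(1) unfolding 13 u by (simp only: ring2)
  then have 0: "x 0 = u * (c * (v * v))" using u c0 by simp
  have 1: "x 1 = u * (Y + v * v)" using u by (simp add: Y_def add.assoc add_self)
  have "x 1 + (x 1 + x 3) = x 1 + u * (c * (c * v))" unfolding 13 by (simp only: ac_simps)
  then have 3: "x 3 = u * (Y + v * v + c * (c * v))" unfolding add_self_left unfolding 1 by (simp only: distrib_left)
  have "(u * (c * (v * v)) + u * c)^2 = c^2 * (u * (Y + v * v)) * (u * (Y + v * v + c * (c * v)))"
    using e(2) unfolding 0 1 3 u(2) .
  then have "(c * c * u * u) * (Y * Y) = (c * c * u * u) * (c * (c * (v * Y)) + c * (c * (v * (v * v))) + 1)"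
    unfolding add_eq_0[symmetric, of "(u * (c * (v * v)) + u * c)^2"] add_eq_0[symmetric, of "(c * c * u * u) * (Y * Y)"]
    by (simp only: ring2)
  then have "onE v Y" unfolding onE_def using u c0 by simp
  moreover have "x = (\<lambda>i. u * apt v Y i)"
    using 0 1 3 u by (intro fun_4_eqI) simp_all
  ultimately show ?thesis unfolding u_def by (rule that)
qed

section \<open>Polynomial functions on the affine chart\<close>

definition represents :: "'a poly \<Rightarrow> 'a poly \<Rightarrow> ('a \<Rightarrow> 'a \<Rightarrow> 'a) \<Rightarrow> bool" where
  "represents a b f \<longleftrightarrow> (\<forall>v Y. onE v Y \<longrightarrow> f v Y = poly a v + poly b v * Y)"

text \<open>The functions \<open>v\<close> and \<open>Y\<close> have poles of order 2 and 3 at infinity.\<close>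

definition pole_bound :: "nat \<Rightarrow> 'a poly \<Rightarrow> 'a poly \<Rightarrow> bool" where
  "pole_bound n a b \<longleftrightarrow> 2 * degree a \<le> n \<and> (b = 0 \<or> 2 * degree b + 3 \<le> n)"

text \<open>The Riemann-Roch space L(n O), where O is the point at infinity of the chart.\<close>

definition regular :: "nat \<Rightarrow> ('a \<Rightarrow> 'a \<Rightarrow> 'a) \<Rightarrow> bool" where
  "regular n f \<longleftrightarrow> (\<exists>a b. represents a b f \<and> pole_bound n a b)"

lemma regular_mono: "regular n f \<Longrightarrow> n \<le> m \<Longrightarrow> regular m f"
proof -
  assume "regular n f" "n \<le> m"
  then obtain a b where "represents a b f" "pole_bound n a b" by (auto simp: regular_def)
  moreover from this(2) \<open>n \<le> m\<close> have "pole_bound m a b" by (auto simp: pole_bound_def)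
  ultimately show ?thesis by (auto simp: regular_def)
qed

lemma regular_const: "regular n (\<lambda>v Y. k)"
  unfolding regular_def represents_def pole_bound_def
  by (intro exI[of _ "[:k:]"] exI[of _ 0]) simp

lemma regular_add: "regular n f \<Longrightarrow> regular n g \<Longrightarrow> regular n (\<lambda>v Y. f v Y + g v Y)"
proof -
  assume "regular n f" "regular n g"
  then obtain a b a' b' where *: "represents a b f" "represents a' b' g"
    "pole_bound n a b" "pole_bound n a' b'" by (auto simp: regular_def)
  have "degree (a + a') \<le> max (degree a) (degree a')" "degree (b + b') \<le> max (degree b) (degree b')"
    by (rule degree_add_le_max)+
  with *(3,4) have "pole_bound n (a + a') (b + b')" by (auto simp: pole_bound_def)
  then show ?thesis unfolding regular_def using *(1,2)
    by (intro exI[of _ "a + a'"] exI[of _ "b + b'"]) (auto simp: represents_def algebra_simps)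
qed

lemma degree_mult_bound: "degree (p * q :: 'a poly) \<le> degree p + degree q"
  by (rule degree_mult_le)

text \<open>Coefficients of the product of a + b Y and a' + b' Y, reduced by Y^2 = c^2 v Y + (1 +
  c^2 v^3).\<close>

definition mulA where "mulA a b a' b' = (a * a' + [:1, 0, 0, c * c:] * (b * b') :: 'a poly)"
definition mulB where "mulB a b a' b' = (a * b' + a' * b + [:0, c * c:] * (b * b') :: 'a poly)"

lemma represents_mult:
  assumes "represents a b f" "represents a' b' g"
  shows "represents (mulA a b a' b') (mulB a b a' b') (\<lambda>v Y. f v Y * g v Y)"
  unfolding represents_def
proof (intro allI impI)
  fix v Y assume Y: "onE v Y"
  then have *: "f v Y = poly a v + poly b v * Y" "g v Y = poly a' v + poly b' v * Y"
    using assms by (auto simp: represents_def)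
  show "f v Y * g v Y = poly (mulA a b a' b') v + poly (mulB a b a' b') v * Y"
    unfolding * mulA_def mulB_def poly_add poly_mult poly_pCons poly_0
    by (simp only: ring2 onE_square[OF Y])
qed

lemma regular_mult:
  assumes "regular n f" "regular m g" shows "regular (n + m) (\<lambda>v Y. f v Y * g v Y)"
proof -
  obtain a b a' b' where *: "represents a b f" "represents a' b' g"
    "pole_bound n a b" "pole_bound m a' b'" using assms by (auto simp: regular_def)
  have deg: "degree ([:1, 0, 0, c * c:] :: 'a poly) = 3" "degree ([:0, c * c:] :: 'a poly) = 1" using c0 by auto
  have 1: "2 * degree (a * a') \<le> n + m"
    using degree_mult_bound[of a a'] *(3,4) by (auto simp: pole_bound_def)
  have 2: "2 * degree ([:1, 0, 0, c * c:] * (b * b')) \<le> n + m"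
  proof (cases "b = 0 \<or> b' = 0")
    case False
    then show ?thesis
      using degree_mult_bound[of "[:1, 0, 0, c * c:]" "b * b'"] degree_mult_bound[of b b'] *(3,4) deg
      by (auto simp: pole_bound_def)
  qed auto
  have 3: "a * b' = 0 \<or> 2 * degree (a * b') + 3 \<le> n + m"
    using degree_mult_bound[of a b'] *(3,4) by (auto simp: pole_bound_def)
  have 4: "a' * b = 0 \<or> 2 * degree (a' * b) + 3 \<le> n + m"
    using degree_mult_bound[of a' b] *(3,4) by (auto simp: pole_bound_def)
  have 5: "b * b' = 0 \<or> 2 * degree ([:0, c * c:] * (b * b')) + 3 \<le> n + m"
    using degree_mult_bound[of "[:0, c * c:]" "b * b'"] degree_mult_bound[of b b'] *(3,4) deg
    by (auto simp: pole_bound_def)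
  have "2 * degree (mulA a b a' b') \<le> n + m"
    unfolding mulA_def using 1 2 degree_add_le_max[of "a * a'" "[:1, 0, 0, c * c:] * (b * b')"] by auto
  moreover have "pole_bound (n + m) 0 (a * b' + a' * b + [:0, c * c:] * (b * b'))"
  proof -
    have add: "pole_bound k 0 (p + q)" if "pole_bound k 0 p" "pole_bound k 0 q" for k p q
      using that degree_add_le_max[of p q] by (auto simp: pole_bound_def)
    show ?thesis
      by (intro add) (use 3 4 5 in \<open>auto simp: pole_bound_def\<close>)
  qed
  ultimately have "pole_bound (n + m) (mulA a b a' b') (mulB a b a' b')"
    by (auto simp: pole_bound_def mulB_def)
  with represents_mult[OF *(1,2)] show ?thesis by (auto simp: regular_def)
qed

lemma regular_power: "regular n f \<Longrightarrow> regular (k * n) (\<lambda>v Y. f v Y ^ k)"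
  by (induction k) (auto intro: regular_const regular_mult)

lemma regular_sum: "(\<And>i. i \<in> A \<Longrightarrow> regular n (f i)) \<Longrightarrow> regular n (\<lambda>v Y. \<Sum>i\<in>A. f i v Y)"
  by (induction A rule: infinite_finite_induct) (auto intro: regular_const regular_add)

lemma regular_prod:
  "finite A \<Longrightarrow> (\<And>i. i \<in> A \<Longrightarrow> regular (n i) (f i)) \<Longrightarrow> regular (\<Sum>i\<in>A. n i) (\<lambda>v Y. \<Prod>i\<in>A. f i v Y)"
  by (induction A rule: finite_induct) (auto intro: regular_const regular_mult)

lemma regular_v: "regular 2 (\<lambda>v Y. v)"
  unfolding regular_def represents_def pole_bound_def
  by (intro exI[of _ "[:0, 1:]"] exI[of _ 0]) simp

lemma regular_Y: "regular 3 (\<lambda>v Y. Y)"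
  unfolding regular_def represents_def pole_bound_def
  by (intro exI[of _ 0] exI[of _ 1]) simp

text \<open>The 4 is the degree of the curve: the plane X2 = 0 cuts out 4 O.\<close>

lemma regular_apt: "regular 4 (\<lambda>v Y. apt v Y i)"
proof -
  have 1: "regular 4 (\<lambda>v Y. v * v)" using regular_mult[OF regular_v regular_v] by simp
  have 2: "regular 4 (\<lambda>v Y. c * (v * v))" using regular_mult[OF regular_const 1, of 0 c] by simp
  have 3: "regular 4 (\<lambda>v Y. c * (c * v))" using regular_mult[OF regular_const regular_v, of 2 "c * c"] by (simp add: mult.assoc)
  have 4: "regular 4 (\<lambda>v Y. Y)" using regular_Y by (rule regular_mono) simp
  show ?thesis using exhaust_4[of i] 1 2 3 4 regular_const
    by (elim disjE) (simp_all add: regular_add)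
qed

lemma regular_homogeneous:
  assumes "homogeneous k F" "\<And>i. regular m (\<lambda>v Y. g v Y i)"
  shows "regular (k * m) (\<lambda>v Y. eval_mpoly (g v Y) F)"
  unfolding eval_mpoly_def
proof (rule regular_sum)
  fix u assume u: "u \<in> Poly_Mapping.keys F"
  have "regular (\<Sum>i\<in>UNIV. Poly_Mapping.lookup u i * m) (\<lambda>v Y. \<Prod>i\<in>UNIV. g v Y i ^ Poly_Mapping.lookup u i)"
    by (intro regular_prod regular_power assms) simp
  moreover have "(\<Sum>i\<in>UNIV. Poly_Mapping.lookup u i * m) = k * m"
    using assms(1) u by (simp add: homogeneous_def flip: sum_distrib_right)
  ultimately show "regular (k * m) (\<lambda>v Y. Poly_Mapping.lookup F u * (\<Prod>i\<in>UNIV. g v Y i ^ Poly_Mapping.lookup u i))"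
    using regular_mult[OF regular_const, of "k * m" _ 0] by simp
qed

lemma regular_bihomogeneous:
  assumes "bihomogeneous k l F" "\<And>i. regular m (\<lambda>v Y. g v Y i)"
  shows "regular (k * m) (\<lambda>v Y. eval_mpoly (case_sum (g v Y) y) F)"
  unfolding eval_mpoly_def
proof (rule regular_sum)
  fix u assume u: "u \<in> Poly_Mapping.keys F"
  have "regular (\<Sum>i\<in>UNIV. Poly_Mapping.lookup u (Inl i) * m) (\<lambda>v Y. \<Prod>i\<in>UNIV. g v Y i ^ Poly_Mapping.lookup u (Inl i))"
    by (intro regular_prod regular_power assms) simp
  moreover have "(\<Sum>i\<in>UNIV. Poly_Mapping.lookup u (Inl i) * m) = k * m"
    using assms(1) u by (simp add: bihomogeneous_def flip: sum_distrib_right)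
  ultimately show "regular (k * m) (\<lambda>v Y. Poly_Mapping.lookup F u *
      (\<Prod>i\<in>UNIV. case_sum (g v Y) y i ^ Poly_Mapping.lookup u i))"
    using regular_mult[OF regular_mult[OF regular_const regular_const], of "k * m" _ 0 0]
    by (simp add: UNIV_sum_prod mult_ac)
qed

lemma regular_eval: "\<exists>n. regular n (\<lambda>v Y. eval_mpoly (apt v Y) F)"
proof (induction F rule: mpoly_induct)
  case (add p q)
  then obtain n m where "regular n (\<lambda>v Y. eval_mpoly (apt v Y) p)" "regular m (\<lambda>v Y. eval_mpoly (apt v Y) q)" by blast
  then have "regular (max n m) (\<lambda>v Y. eval_mpoly (apt v Y) p)" "regular (max n m) (\<lambda>v Y. eval_mpoly (apt v Y) q)"
    by (auto intro: regular_mono)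
  then show ?case using regular_add by fastforce
next
  case (mult p q)
  then show ?case using regular_mult by fastforce
qed (auto intro: regular_const regular_apt)

text \<open>For v nonzero the points Y and Y + c^2 v over v are distinct; subtracting the two values
  isolates b(v).\<close>

lemma represents_unique:
  assumes "represents a b f" "represents a' b' f" shows "a = a' \<and> b = b'"
proof -
  have *: "poly (a - a') v = 0 \<and> poly (b - b') v = 0" if v: "v \<notin> {0}" for v
  proof -
    obtain Y where Y: "onE v Y" using onE_exists by blast
    have "poly a v + poly b v * Z = poly a' v + poly b' v * Z" if "onE v Z" for Z
      using assms that unfolding represents_def by metis
    then have 1: "poly (a - a') v + poly (b - b') v * Z = 0" if "onE v Z" for Z
      using that by (simp add: algebra_simps)
    from 1[OF Y] 1[OF onE_conj[OF Y]] have "poly (b - b') v * (c * (c * v)) = 0"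
      by (simp add: distrib_left del: poly_diff flip: add.assoc)
    then have "poly (b - b') v = 0" using v c0 by (simp del: poly_diff)
    with 1[OF Y] show ?thesis by simp
  qed
  then have "a - a' = 0" "b - b' = 0" using poly_zero_cofinite[of "{0}"] by blast+
  then show ?thesis by simp
qed

text \<open>The norm to polynomials in v: the product of a + b Y with its conjugate a + b (Y + c^2
  v), using Y (Y + c^2 v) = c^2 v^3 + 1.\<close>

definition nrm :: "'a poly \<Rightarrow> 'a poly \<Rightarrow> 'a poly" where
  "nrm a b = a * a + [:0, c * c:] * (a * b) + [:1, 0, 0, c * c:] * (b * b)"

lemma poly_nrm:
  "onE v Y \<Longrightarrow> poly (nrm a b) v = (poly a v + poly b v * Y) * (poly a v + poly b v * (Y + c * (c * v)))"
  unfolding nrm_def poly_add poly_mult poly_pCons poly_0 by (simp only: ring2 onE_square)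

text \<open>The outer terms have degrees of opposite parity and cannot cancel, and the degree of the
  cross term lies below their mean. The degree of the norm is thus the pole order of a + b Y at
  O.\<close>

lemma degree_nrm:
  assumes "a \<noteq> 0 \<or> b \<noteq> 0"
  shows "nrm a b \<noteq> 0 \<and> degree (nrm a b) = (if b = 0 then 2 * degree a else max (2 * degree a) (2 * degree b + 3))"
proof -
  have deg: "degree ([:1, 0, 0, c * c:] :: 'a poly) = 3" "degree ([:0, c * c:] :: 'a poly) = 1"
    "[:0, c * c:] \<noteq> 0" "[:1, 0, 0, c * c:] \<noteq> (0::'a poly)" using c0 by auto
  let ?A = "a * a" and ?M = "[:0, c * c:] * (a * b)" and ?B = "[:1, 0, 0, c * c:] * (b * b)"
  have A: "degree ?A = 2 * degree a" by (cases "a = 0") (auto simp: degree_mult_eq)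
  have B: "degree ?B = 2 * degree b + 3" if "b \<noteq> 0"
    using that deg by (subst degree_mult_eq; simp add: degree_mult_eq del: mult_pCons_left)
  have M: "degree ?M = degree a + degree b + 1" if "a \<noteq> 0" "b \<noteq> 0"
    using that deg by (subst degree_mult_eq; simp add: degree_mult_eq del: mult_pCons_left)
  have "degree (nrm a b) = (if b = 0 then 2 * degree a else max (2 * degree a) (2 * degree b + 3))"
  proof (cases "b = 0")
    case True then show ?thesis by (simp add: nrm_def degree_mult_eq[of a a] del: degree_mult_eq) (cases "a = 0"; simp add: degree_mult_eq)
  next
    case b: False
    show ?thesis
    proof (cases "a = 0")
      case True
      then show ?thesis using b B by (simp add: nrm_def del: mult_pCons_left)
    next
      case a: False
      show ?thesis
      proof (cases "degree a \<ge> degree b + 2")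
        case True
        then have "degree (?A + ?M + ?B) = degree ?A"
          using A M[OF a b] B[OF b] by (subst degree_add_eq_left; (subst degree_add_eq_left)?; simp del: mult_pCons_left)
        then show ?thesis using A b True unfolding nrm_def by (simp del: mult_pCons_left)
      next
        case False
        have "degree (?A + ?M) \<le> max (degree ?A) (degree ?M)" by (rule degree_add_le_max)
        then have "degree (?A + ?M + ?B) = degree ?B"
          using A M[OF a b] B[OF b] False by (subst degree_add_eq_right; simp del: mult_pCons_left)
        then show ?thesis using B[OF b] b False unfolding nrm_def by (simp del: mult_pCons_left)
      qed
    qed
  qed
  moreover have "nrm a b \<noteq> 0"
  proof (cases "b = 0")
    case True then show ?thesis using assms by (simp add: nrm_def)
  next
    case False then show ?thesis using calculation by (intro notI) (simp add: max_def split: if_splits)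
  qed
  ultimately show ?thesis by blast
qed

lemma nrm_mult:
  assumes "represents a b f" "represents a' b' g" "represents p q (\<lambda>v Y. f v Y * g v Y)"
  shows "nrm p q = nrm a b * nrm a' b'"
proof -
  have "poly (nrm p q - nrm a b * nrm a' b') v = 0" for v
  proof -
    obtain Y where Y: "onE v Y" using onE_exists by blast
    note Y' = onE_conj[OF Y]
    have "poly p v + poly q v * Y = f v Y * g v Y"
      "poly p v + poly q v * (Y + c * (c * v)) = f v (Y + c * (c * v)) * g v (Y + c * (c * v))"
      using assms(3) Y Y' unfolding represents_def by auto
    moreover have "f v Y = poly a v + poly b v * Y" "f v (Y + c * (c * v)) = poly a v + poly b v * (Y + c * (c * v))"
      "g v Y = poly a' v + poly b' v * Y" "g v (Y + c * (c * v)) = poly a' v + poly b' v * (Y + c * (c * v))"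
      using assms(1,2) Y Y' unfolding represents_def by auto
    ultimately show ?thesis unfolding poly_diff poly_mult poly_nrm[OF Y] by (simp only: mult_ac) simp
  qed
  then have "nrm p q - nrm a b * nrm a' b' = 0" using poly_zero_cofinite[of "{}"] by blast
  then show ?thesis by simp
qed

section \<open>Irreducibility of the curve\<close>

text \<open>The norm is multiplicative and vanishes only at zero, so the coordinate ring of the
  chart is a domain.\<close>

lemma irred_apt: "irred_set {apt v Y | v Y. onE v Y}"
proof -
  have "F \<in> vanishing_ideal {apt v Y | v Y. onE v Y} \<or> G \<in> vanishing_ideal {apt v Y | v Y. onE v Y}"
    if FG: "F * G \<in> vanishing_ideal {apt v Y | v Y. onE v Y}" for F G
  proof -
    obtain a b a' b' where r: "represents a b (\<lambda>v Y. eval_mpoly (apt v Y) F)"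
      "represents a' b' (\<lambda>v Y. eval_mpoly (apt v Y) G)"
      using regular_eval[of F] regular_eval[of G] unfolding regular_def by blast
    have "represents 0 0 (\<lambda>v Y. eval_mpoly (apt v Y) F * eval_mpoly (apt v Y) G)"
      using FG by (auto simp: represents_def vanishing_ideal_def)
    from nrm_mult[OF r this] have "nrm a b = 0 \<or> nrm a' b' = 0" by (simp add: nrm_def)
    then have "(a = 0 \<and> b = 0) \<or> (a' = 0 \<and> b' = 0)" using degree_nrm by metis
    then show ?thesis using r by (auto simp: represents_def vanishing_ideal_def)
  qed
  moreover have "{apt v Y | v Y. onE v Y} \<noteq> {}" using onE_exists by auto
  ultimately show ?thesis by (auto simp: irred_set_def)
qed

lemma irred_chart: "irred_set {x \<in> C. x i \<noteq> 0}"
proof -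
  have "{x \<in> C. x 2 \<noteq> 0} = {\<lambda>v. if v \<in> UNIV then a * q v else q v | a q. a \<noteq> 0 \<and> q \<in> {apt v Y | v Y. onE v Y}}"
  proof (intro Set.set_eqI iffI)
    fix x assume "x \<in> {x \<in> C. x 2 \<noteq> 0}"
    then have "x \<in> C" "x 2 \<noteq> 0" by auto
    from C_apt[OF this] obtain v Y where "onE v Y" "x = (\<lambda>i. x 2 / c * apt v Y i)" .
    then have "x = (\<lambda>j. if j \<in> UNIV then x 2 / c * apt v Y j else apt v Y j)"
      "apt v Y \<in> {apt v Y | v Y. onE v Y}" by auto
    moreover have "x 2 / c \<noteq> 0" using \<open>x 2 \<noteq> 0\<close> c0 by simp
    ultimately show "x \<in> {\<lambda>v. if v \<in> UNIV then a * q v else q v | a q. a \<noteq> 0 \<and> q \<in> {apt v Y | v Y. onE v Y}}"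
      by blast
  next
    fix x assume "x \<in> {\<lambda>v. if v \<in> UNIV then a * q v else q v | a q. a \<noteq> 0 \<and> q \<in> {apt v Y | v Y. onE v Y}}"
    then obtain a v Y where "x = (\<lambda>j. a * apt v Y j)" "a \<noteq> 0" "onE v Y" by auto
    then show "x \<in> {x \<in> C. x 2 \<noteq> 0}" using C_scale[OF apt_in_C, of v Y a] c0 by simp
  qed
  then have *: "irred_set {x \<in> C. x 2 \<noteq> 0}" using irred_set_scale[OF irred_apt, of UNIV] by simp
  have "{x \<in> C. x i \<noteq> 0} = (\<lambda>q v. eval_mpoly q (Var (v - (i - 2)))) ` {x \<in> C. x 2 \<noteq> 0}"
  proof (intro Set.set_eqI iffI)
    fix x assume x: "x \<in> {x \<in> C. x i \<noteq> 0}"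
    define y where "y = (\<lambda>j. x (j - (2 - i)))"
    have "y \<in> C" "y 2 \<noteq> 0" "x = (\<lambda>v. eval_mpoly y (Var (v - (i - 2))))"
      using x C_shift[of x "2 - i"] by (auto simp: y_def)
    then show "x \<in> (\<lambda>q v. eval_mpoly q (Var (v - (i - 2)))) ` {x \<in> C. x 2 \<noteq> 0}"
      by blast
  next
    fix x assume "x \<in> (\<lambda>q v. eval_mpoly q (Var (v - (i - 2)))) ` {x \<in> C. x 2 \<noteq> 0}"
    then obtain y where "y \<in> C" "y 2 \<noteq> 0" "x = (\<lambda>v. y (v - (i - 2)))" by auto
    then show "x \<in> {x \<in> C. x i \<noteq> 0}" using C_shift[of y "i - 2"] by simp
  qed
  then show ?thesis using irred_set_image[OF *, of "\<lambda>v. Var (v - (i - 2))"] by simp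
qed

lemma Var_chart: "Var i * F \<in> vanishing_ideal C \<longleftrightarrow> F \<in> vanishing_ideal {x \<in> C. x i \<noteq> 0}"
  by (auto simp: vanishing_ideal_def)

text \<open>Coordinates of the multiple n T; the identification comes later, in
  \<open>ell_mult_T\<close>.\<close>

definition Opt :: "4 \<Rightarrow> 4 \<Rightarrow> 'a" where "Opt n j = tuple4 c 1 0 1 (j - n)"

lemma Opt_in_C: "Opt n \<in> C"
proof -
  have "tuple4 c 1 0 1 \<in> C" unfolding mem_C using c0 by (auto simp: fun_eq_iff forall_4 add_self)
  then show ?thesis unfolding Opt_def[abs_def] by (rule C_shift)
qed

text \<open>The charts X0 and X2 cover the curve and meet, for instance at T. A polynomial vanishing
  on one chart therefore vanishes on the other.\<close>

lemma irred_C: "irred_set C"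
proof -
  have nv: "Var 2 \<notin> vanishing_ideal {x \<in> C. x 0 \<noteq> 0}"
  proof
    assume "Var 2 \<in> vanishing_ideal {x \<in> C. x 0 \<noteq> 0}"
    from vanishing_idealD[OF this, of "Opt 1"] show False
      using Opt_in_C[of 1] by (simp add: Opt_def)
  qed
  have all: "F \<in> vanishing_ideal C" if "F \<in> vanishing_ideal {x \<in> C. x 2 \<noteq> 0}" for F
  proof -
    have "Var 2 * F \<in> vanishing_ideal C" using that Var_chart by blast
    then have "Var 2 * F \<in> vanishing_ideal {x \<in> C. x 0 \<noteq> 0}" using vanishing_ideal_mono[of "{x \<in> C. x 0 \<noteq> 0}" C] by blast
    then have "F \<in> vanishing_ideal {x \<in> C. x 0 \<noteq> 0}" using irred_setD[OF irred_chart] nv by blast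
    with that C_opposite[of _ 0] show ?thesis by (auto simp: vanishing_ideal_def)
  qed
  have "F \<in> vanishing_ideal C \<or> G \<in> vanishing_ideal C" if "F * G \<in> vanishing_ideal C" for F G
  proof -
    have "F * G \<in> vanishing_ideal {x \<in> C. x 2 \<noteq> 0}" using that by (auto simp: vanishing_ideal_def)
    then show ?thesis using irred_setD[OF irred_chart] all by blast
  qed
  moreover have "C \<noteq> {}" using Opt_in_C by blast
  ultimately show ?thesis by (auto simp: irred_set_def)
qed

section \<open>Local parameters on the curve\<close>

text \<open>Up to units, the function (X_(i+1) + X_(i+3)) / X_i minus its value at p. For i = 2 that
  function is a multiple of v.\<close>

definition tpar :: "4 \<Rightarrow> (4 \<Rightarrow> 'a) \<Rightarrow> (4, 'a) mpoly" where
  "tpar i p = Const (p i) * (Var (i + 1) + Var (i + 3)) + Const (p (i + 1) + p (i + 3)) * Var i"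

lemma irred_point: "irred_set (proj_pt (p :: 4 \<Rightarrow> 'a))"
proof -
  have "irred_set {\<lambda>v. if v \<in> UNIV then a * q v else q v | a q. a \<noteq> 0 \<and> q \<in> {p}}"
    by (intro irred_set_scale irred_set_singleton)
  then show ?thesis by (simp add: proj_pt_def)
qed

lemma not_vanishing_proj_pt: "eval_mpoly p F \<noteq> 0 \<Longrightarrow> F \<notin> vanishing_ideal (proj_pt p)"
  using self_mem_proj_pt by (auto simp: vanishing_ideal_def)

lemma proj_pt_subset_C: "p \<in> C \<Longrightarrow> proj_pt p \<subseteq> C"
  by (auto simp: mem_proj_pt C_scale)

lemma local_ideal_cong:
  assumes "irred_set Z" "B \<in> local_ideal V Z t" "\<And>x. x \<in> V \<Longrightarrow> eval_mpoly x A = eval_mpoly x B"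
  shows "A \<in> local_ideal V Z t"
proof -
  have "A - B \<in> vanishing_ideal V" using assms(3) by (auto simp: vanishing_ideal_def)
  then have "B + (A - B) \<in> local_ideal V Z t"
    by (intro local_ideal_add local_ideal_vanishing assms)
  then show ?thesis by simp
qed

text \<open>Nonvanishing of p_i and p_(i+2) makes e = p_(i+1) + p_(i+3) nonzero, which says that
  (X_(i+1) + X_(i+3)) / X_i is unramified at p. The ratios of all coordinates are then determined
  modulo t.\<close>

lemma local_param_point:
  assumes p: "p \<in> C" and i: "p i \<noteq> 0" "p (i + 2) \<noteq> 0"
  shows "local_param C (proj_pt p) (tpar i p)"
proof -
  let ?Z = "proj_pt p" and ?t = "tpar i p"
  let ?L = "local_ideal C ?Z ?t"
  define e where "e = p (i + 1) + p (i + 3)"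
  have t: "eval_mpoly x ?t = p i * (x (i + 1) + x (i + 3)) + e * x i" for x
    by (simp add: tpar_def e_def)
  have e2: "e^2 = c^2 * p i * p (i + 2)" using curve_eq[OF p, of "i + 1"] by (simp add: e_def mult_ac add.commute)
  then have e0: "e \<noteq> 0" using i c0 by auto
  have Z: "irred_set ?Z" by (rule irred_point)
  have tL: "?t * G \<in> ?L" for G
    by (rule local_idealI[of 1 _ _ _ G]) (simp_all add: irred_set_one[OF Z])
  \<comment> \<open>On the curve, t^2 equals c^2 p_i X_i times this difference.\<close>
  have 2: "Const (p i) * Var (i + 2) - Const (p (i + 2)) * Var i \<in> ?L" (is "?A2 \<in> _")
  proof (rule local_ideal_cancel[OF Z, of "Const (c^2 * p i) * Var i"])
    show "Const (c^2 * p i) * Var i \<notin> vanishing_ideal ?Z"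
      by (rule not_vanishing_proj_pt) (simp add: i c0)
    show "Const (c^2 * p i) * Var i * ?A2 \<in> ?L"
    proof (rule local_ideal_cong[OF Z tL[of ?t]])
      fix x assume "x \<in> C"
      then have "(x (i + 1) + x (i + 3))^2 = c^2 * x (i + 2) * x i" using curve_eq[of x "i + 1"] by (simp add: add.commute)
      moreover have "(p i * (x (i + 1) + x (i + 3)) + e * x i)^2 = p i^2 * (x (i + 1) + x (i + 3))^2 + e^2 * x i^2"
        by (simp only: ring2)
      ultimately have "(p i * (x (i + 1) + x (i + 3)) + e * x i)^2 = p i^2 * (c^2 * x (i + 2) * x i) + c^2 * p i * p (i + 2) * x i^2"
        unfolding e2 by simp
      then show "eval_mpoly x (Const (c^2 * p i) * Var i * ?A2) = eval_mpoly x (?t * ?t)"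
        unfolding eval_mpoly_mult t power2_eq_square[of "_ + _", symmetric]
        by (simp only: eval_mpoly_Const eval_mpoly_Var eval_mpoly_diff eval_mpoly_mult) (simp only: ring2)
    qed
  qed
  \<comment> \<open>Multiplied by its conjugate, in which p_(i+3) replaces p_(i+1), this form is a
    multiple of t plus the square of the previous difference. The conjugate is a unit, as its value
    at p is p_i e.\<close>
  have 1: "Const (p i) * Var (i + 1) - Const (p (i + 1)) * Var i \<in> ?L" (is "?A1 \<in> _")
  proof (rule local_ideal_cancel[OF Z, of "Const (c^2) * (Const (p i) * Var (i + 1) + Const (p (i + 3)) * Var i)"])
    have "p i * p (i + 1) + p (i + 3) * p i = p i * e" by (simp add: e_def algebra_simps)
    then show "Const (c^2) * (Const (p i) * Var (i + 1) + Const (p (i + 3)) * Var i) \<notin> vanishing_ideal ?Z"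
      using i e0 c0 by (intro not_vanishing_proj_pt) simp
    show "Const (c^2) * (Const (p i) * Var (i + 1) + Const (p (i + 3)) * Var i) * ?A1 \<in> ?L"
    proof (rule local_ideal_cong[OF Z])
      show "?t * (Const (c^2 * p i) * Var (i + 1)) + ?A2 * ?A2 \<in> ?L"
        by (intro local_ideal_add[OF Z] tL local_ideal_mult 2)
      fix x assume x: "x \<in> C"
      have "c^2 * (p i * x (i + 1) + p (i + 3) * x i) * (p i * x (i + 1) + p (i + 1) * x i) =
        (p i * (x (i + 1) + x (i + 3)) + e * x i) * (c^2 * p i * x (i + 1)) + p i^2 * (c^2 * x (i + 1) * x (i + 3))
          + x i^2 * (c^2 * p (i + 1) * p (i + 3))"
        unfolding e_def by (simp only: ring2)
      also have "\<dots> = (p i * (x (i + 1) + x (i + 3)) + e * x i) * (c^2 * p i * x (i + 1)) +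
          (p i * x (i + 2) + p (i + 2) * x i) * (p i * x (i + 2) + p (i + 2) * x i)"
        unfolding curve_eq[OF x, symmetric] curve_eq[OF p, symmetric] by (simp only: ring2)
      finally show "eval_mpoly x (Const (c^2) * (Const (p i) * Var (i + 1) + Const (p (i + 3)) * Var i) * ?A1) =
          eval_mpoly x (?t * (Const (c^2 * p i) * Var (i + 1)) + ?A2 * ?A2)"
        by (simp add: t minus_eq)
    qed
  qed
  have 3: "Const (p i) * Var (i + 3) - Const (p (i + 3)) * Var i \<in> ?L"
  proof (rule local_ideal_cong[OF Z])
    show "?t * 1 + Const (-1) * (Const (p i) * Var (i + 1) - Const (p (i + 1)) * Var i) \<in> ?L"
      by (intro local_ideal_add[OF Z] tL local_ideal_mult 1)
  qed (simp add: t e_def, simp only: ring2)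
  have 0: "Const (p i) * Var i - Const (p i) * Var i \<in> ?L"
    by (intro local_ideal_vanishing[OF Z]) simp
  have "vanishing_ideal ?Z \<subseteq> ?L"
  proof (rule vanishing_ideal_subset_local_ideal[OF Z, of "Var i" "Const (p i)" "\<lambda>j. Const (p j) * Var i"])
    show "Var i \<notin> vanishing_ideal ?Z" "Const (p i) \<notin> vanishing_ideal ?Z"
      by (rule not_vanishing_proj_pt, simp add: i)+
    show "Const (p i) * Var j - Const (p j) * Var i \<in> ?L" for j
      using index_cases[of j i] 0 1 2 3 by (elim disjE) (simp_all only:)
    fix x assume "x \<in> C" "eval_mpoly x (Var i) \<noteq> 0"
    then show "eval_mpoly x (Const (p i)) \<noteq> 0 \<and> (\<lambda>v. eval_mpoly x (Const (p v) * Var i) / eval_mpoly x (Const (p i))) \<in> ?Z"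
      using i unfolding mem_proj_pt by (intro conjI exI[of _ "x i / p i"]) (auto simp: mult.commute)
  qed
  moreover have "?t \<in> vanishing_ideal ?Z"
  proof (rule vanishing_idealI)
    fix x assume "x \<in> ?Z"
    then obtain a where x: "x = (\<lambda>j. a * p j)" by (auto simp: mem_proj_pt)
    show "eval_mpoly x ?t = 0" unfolding t e_def x by (simp only: ring2)
  qed
  moreover have "?t \<notin> vanishing_ideal C"
  proof
    assume "?t \<in> vanishing_ideal C"
    from vanishing_idealD[OF this Opt_in_C[of i]] show False
      using c0 e0 by (simp add: t Opt_def add_self)
  qed
  ultimately show ?thesis
    unfolding local_param_def using irred_C Z proj_pt_subset_C[OF p] by blast
qed

end

section \<open>Scaling of forms and further rules for orders\<close>

lemma eval_homogeneous_scale: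
  assumes "homogeneous k F"
  shows "eval_mpoly (\<lambda>i. a * x i) F = a ^ k * eval_mpoly x F"
proof -
  have "Poly_Mapping.lookup F m * (\<Prod>v\<in>UNIV. (a * x v) ^ Poly_Mapping.lookup m v)
     = a ^ k * (Poly_Mapping.lookup F m * (\<Prod>v\<in>UNIV. x v ^ Poly_Mapping.lookup m v))"
    if "m \<in> Poly_Mapping.keys F" for m
  proof -
    have "(\<Sum>v\<in>UNIV. Poly_Mapping.lookup m v) = k" using assms that by (auto simp: homogeneous_def)
    then show ?thesis by (auto simp: power_mult_distrib prod.distrib simp flip: power_sum)
  qed
  then show ?thesis by (simp add: eval_mpoly_def sum_distrib_left)
qed

lemma has_order_nonvanishing:
  assumes lp: "local_param V Z t" and "has_order V Z t F k" shows "F \<notin> vanishing_ideal V"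
proof
  assume F: "F \<in> vanishing_ideal V"
  have V: "irred_set V" "vanishing_ideal V \<subseteq> vanishing_ideal Z" using lp vanishing_ideal_mono by (auto simp: local_param_def)
  obtain H U where 1: "H \<notin> vanishing_ideal Z" "U \<notin> vanishing_ideal Z" "H * F - t ^ k * U \<in> vanishing_ideal V"
    using assms by (auto simp: has_order_def)
  have "H * F - (H * F - t ^ k * U) \<in> vanishing_ideal V" using vanishing_ideal_mult[OF F] 1(3) by (rule vanishing_ideal_diff)
  then have "t ^ k * U \<in> vanishing_ideal V" by simp
  then show False using irred_setD[OF V(1)] irred_set_power[OF V(1)] 1(2) V(2) lp unfolding local_param_def by blast
qed

lemma has_order_cancel_unit:
  assumes lp: "local_param V Z t" and A: "A \<notin> vanishing_ideal Z" and "has_order V Z t (A * F) k"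
  shows "has_order V Z t F k"
proof -
  have Z: "irred_set Z" using lp by (auto simp: local_param_def)
  obtain H U where 1: "H \<notin> vanishing_ideal Z" "U \<notin> vanishing_ideal Z" "H * (A * F) - t ^ k * U \<in> vanishing_ideal V"
    using assms by (auto simp: has_order_def)
  then show ?thesis using irred_set_mult[OF Z 1(1) A] by (intro has_orderI[of "H * A" _ U]) (auto simp: mult.assoc)
qed

lemma has_order_cong:
  assumes "has_order V Z t F k" "F - G \<in> vanishing_ideal V"
  shows "has_order V Z t G k"
proof -
  obtain H U where 1: "H \<notin> vanishing_ideal Z" "U \<notin> vanishing_ideal Z" "H * F - t ^ k * U \<in> vanishing_ideal V"
    using assms by (auto simp: has_order_def)
  have "(H * F - t ^ k * U) - H * (F - G) \<in> vanishing_ideal V"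
    using 1(3) vanishing_ideal_mult[OF assms(2)] by (rule vanishing_ideal_diff)
  then have "H * G - t ^ k * U \<in> vanishing_ideal V" by (simp add: right_diff_distrib)
  then show ?thesis using 1 by (intro has_orderI)
qed

text \<open>Turns an inequality of orders into local divisibility, as \<open>pole_division\<close>
  requires.\<close>

lemma has_order_quotient:
  fixes F :: "('v::finite, 'b::field) mpoly"
  assumes Z: "irred_set Z" and F: "has_order V Z t F k" and G: "has_order V Z t G l" and "l \<le> k"
  obtains H M where "H \<notin> vanishing_ideal Z" "H * F - G * M \<in> vanishing_ideal V"
proof -
  obtain H1 U1 where 1: "H1 \<notin> vanishing_ideal Z" "U1 \<notin> vanishing_ideal Z" "H1 * F - t ^ k * U1 \<in> vanishing_ideal V"
    using F by (auto simp: has_order_def)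
  obtain H2 U2 where 2: "H2 \<notin> vanishing_ideal Z" "U2 \<notin> vanishing_ideal Z" "H2 * G - t ^ l * U2 \<in> vanishing_ideal V"
    using G by (auto simp: has_order_def)
  have k: "t ^ k = t ^ (k - l) * t ^ l" using \<open>l \<le> k\<close> by (simp flip: power_add)
  have "(H1 * U2) * F - G * (t ^ (k - l) * U1 * H2) \<in> vanishing_ideal V"
  proof (rule vanishing_idealI)
    fix x assume x: "x \<in> V"
    have "eval_mpoly x H1 * eval_mpoly x F = eval_mpoly x (t ^ (k - l)) * eval_mpoly x (t ^ l) * eval_mpoly x U1"
      using vanishing_idealD[OF 1(3) x] unfolding k by simp
    moreover have "eval_mpoly x H2 * eval_mpoly x G = eval_mpoly x (t ^ l) * eval_mpoly x U2"
      using vanishing_idealD[OF 2(3) x] by simp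
    moreover have "h1 * u2 * f = g * (s * u1 * h2)" if "h1 * f = s * q * u1" "h2 * g = q * u2" for h1 u2 f g s u1 h2 q :: 'b
    proof -
      have "h1 * u2 * f = u2 * (h1 * f)" by (simp add: mult_ac)
      also have "\<dots> = s * u1 * (q * u2)" unfolding that(1) by (simp add: mult_ac)
      also have "\<dots> = g * (s * u1 * h2)" unfolding that(2)[symmetric] by (simp add: mult_ac)
      finally show ?thesis .
    qed
    ultimately have "eval_mpoly x H1 * eval_mpoly x U2 * eval_mpoly x F =
        eval_mpoly x G * (eval_mpoly x (t ^ (k - l)) * eval_mpoly x U1 * eval_mpoly x H2)"
      by blast
    then show "eval_mpoly x ((H1 * U2) * F - G * (t ^ (k - l) * U1 * H2)) = 0" by simp
  qed
  with irred_set_mult[OF Z 1(1) 2(2)] show ?thesis by (rule that)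
qed

context mu4
begin

section \<open>Regular functions on the affine curve\<close>

definition reg :: "('a \<Rightarrow> 'a \<Rightarrow> 'a) \<Rightarrow> bool" where "reg f \<longleftrightarrow> (\<exists>n. regular n f)"

lemma reg_const: "reg (\<lambda>v Y. k)" using regular_const by (auto simp: reg_def)

lemma reg_v: "reg (\<lambda>v Y. v)" using regular_v by (auto simp: reg_def)

lemma reg_add: "reg f \<Longrightarrow> reg g \<Longrightarrow> reg (\<lambda>v Y. f v Y + g v Y)"
  unfolding reg_def by (metis regular_mono regular_add max.cobounded1 max.cobounded2)

lemma reg_mult: "reg f \<Longrightarrow> reg g \<Longrightarrow> reg (\<lambda>v Y. f v Y * g v Y)"
  unfolding reg_def by (metis regular_mult)

lemma reg_power: "reg f \<Longrightarrow> reg (\<lambda>v Y. f v Y ^ k)"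
  unfolding reg_def by (metis regular_power)

lemma reg_eval: "(\<And>i. reg (\<lambda>v Y. g v Y i)) \<Longrightarrow> reg (\<lambda>v Y. eval_mpoly (g v Y) F)"
  by (induction F rule: mpoly_induct) (auto intro: reg_const reg_add reg_mult)

lemma reg_apt: "reg (\<lambda>v Y. apt v Y i)"
  using regular_apt by (auto simp: reg_def)

lemma reg_represents: "reg f \<longleftrightarrow> (\<exists>a b. represents a b f)"
proof
  assume "\<exists>a b. represents a b f"
  then obtain a b where *: "represents a b f" by blast
  have "pole_bound (2 * degree a + 2 * degree b + 3) a b" by (simp add: pole_bound_def)
  with * show "reg f" by (auto simp: reg_def regular_def)
qed (auto simp: reg_def regular_def)

lemma reg_poly: "reg (\<lambda>v Y. poly p v)"
  unfolding reg_represents represents_def by (intro exI[of _ p] exI[of _ 0]) simp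

lemma reg_conj: "reg f \<Longrightarrow> reg (\<lambda>v Y. f v (Y + c * (c * v)))"
proof -
  assume "reg f"
  then obtain a b where "represents a b f" by (auto simp: reg_represents)
  then have "represents (a + [:0, c * c:] * b) b (\<lambda>v Y. f v (Y + c * (c * v)))"
    using onE_conj by (auto simp: represents_def algebra_simps)
  then show ?thesis by (auto simp: reg_represents)
qed

text \<open>Multiplying by the polynomial with root set B gives the zero function; uniqueness of the
  representation then lets that polynomial be cancelled.\<close>

lemma reg_zero:
  assumes "reg f" and B: "finite B" "\<And>v Y. onE v Y \<Longrightarrow> v \<notin> B \<Longrightarrow> f v Y = 0" and "onE v Y"
  shows "f v Y = 0"
proof -
  obtain a b where ab: "represents a b f" using assms by (auto simp: reg_represents)
  define p where "p = (\<Prod>u\<in>B. [:- u, 1:])"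
  have p: "poly p u = 0 \<longleftrightarrow> u \<in> B" for u using B(1) by (auto simp: p_def poly_prod prod_zero_iff)
  have "represents (p * a) (p * b) (\<lambda>v Y. 0)" unfolding represents_def
  proof (intro allI impI)
    fix u Z assume Z: "onE u Z"
    show "0 = poly (p * a) u + poly (p * b) u * Z"
    proof (cases "u \<in> B")
      case True then have "poly p u = 0" using p by blast
      then show ?thesis by simp
    next
      case False
      then have "0 = poly a u + poly b u * Z" using B(2)[OF Z] ab Z by (simp add: represents_def)
      then have "poly p u * (poly a u + poly b u * Z) = 0" by simp
      then show ?thesis by (simp add: algebra_simps)
    qed
  qed
  moreover have "represents 0 0 (\<lambda>v Y. 0)" by (simp add: represents_def)
  ultimately have "p * a = 0 \<and> p * b = 0" by (rule represents_unique)
  moreover have "p \<noteq> 0" unfolding p_def using B(1) by (subst prod_zero_iff) auto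
  ultimately show ?thesis using ab \<open>onE v Y\<close> by (simp add: represents_def)
qed

lemma onE_two: "onE v Y \<Longrightarrow> onE v Z \<Longrightarrow> Z = Y \<or> Z = Y + c * (c * v)"
proof -
  assume Y: "onE v Y" and Z: "onE v Z"
  have "(Z + Y) * (Z + (Y + c * (c * v))) = (Z * Z + c * (c * (v * Z))) + (Y * Y + c * (c * (v * Y)))"
    by (simp only: ring2)
  also have "\<dots> = 0" using Y Z unfolding onE_def by (simp only: ring2)
  finally show ?thesis by (simp only: mult_eq_0_iff add_eq_0)
qed

definition norm_of :: "('a \<Rightarrow> 'a \<Rightarrow> 'a) \<Rightarrow> 'a poly" where
  "norm_of f = (THE n. \<exists>a b. represents a b f \<and> n = nrm a b)"

lemma norm_of_eq: "represents a b f \<Longrightarrow> norm_of f = nrm a b"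
  unfolding norm_of_def using represents_unique by (intro the_equality) blast+

lemma poly_norm_of: "reg f \<Longrightarrow> onE v Y \<Longrightarrow> poly (norm_of f) v = f v Y * f v (Y + c * (c * v))"
proof -
  assume "reg f" and Y: "onE v Y"
  then obtain a b where ab: "represents a b f" by (auto simp: reg_represents)
  then show ?thesis using poly_nrm[OF Y, of a b] Y onE_conj[OF Y] unfolding norm_of_eq[OF ab] by (simp add: represents_def)
qed

lemma norm_of_mult: "reg f \<Longrightarrow> reg g \<Longrightarrow> norm_of (\<lambda>v Y. f v Y * g v Y) = norm_of f * norm_of g"
proof -
  assume "reg f" "reg g"
  moreover from this have "reg (\<lambda>v Y. f v Y * g v Y)" by (rule reg_mult)
  ultimately obtain a b a' b' p q where "represents a b f" "represents a' b' g" "represents p q (\<lambda>v Y. f v Y * g v Y)"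
    by (auto simp: reg_represents)
  then show ?thesis using nrm_mult by (simp add: norm_of_eq)
qed

lemma norm_of_cong: "(\<And>v Y. onE v Y \<Longrightarrow> f v Y = g v Y) \<Longrightarrow> norm_of f = norm_of g"
  unfolding norm_of_def represents_def by (metis (no_types, lifting))

lemma norm_of_nonzero: "reg f \<Longrightarrow> onE v Y \<Longrightarrow> f v Y \<noteq> 0 \<Longrightarrow> norm_of f \<noteq> 0"
proof -
  assume "reg f" and Y: "onE v Y" and f: "f v Y \<noteq> 0"
  then obtain a b where ab: "represents a b f" by (auto simp: reg_represents)
  with Y f have "a \<noteq> 0 \<or> b \<noteq> 0" by (auto simp: represents_def)
  then show ?thesis using degree_nrm ab by (simp add: norm_of_eq)
qed

lemma degree_norm_of: "regular n f \<Longrightarrow> degree (norm_of f) \<le> n"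
proof -
  assume "regular n f"
  then obtain a b where ab: "represents a b f" "pole_bound n a b" by (auto simp: regular_def)
  show ?thesis
  proof (cases "a = 0 \<and> b = 0")
    case True then show ?thesis using ab by (simp add: norm_of_eq nrm_def)
  next
    case False
    then show ?thesis using degree_nrm[of a b] ab by (auto simp: norm_of_eq pole_bound_def)
  qed
qed

text \<open>By \<open>degree_nrm\<close> the norm has degree at least 3 as soon as Y occurs.\<close>

lemma norm_of_small_degree:
  assumes "reg f" "norm_of f \<noteq> 0" "degree (norm_of f) \<le> 2"
  obtains \<alpha> \<beta> where "\<And>v Y. onE v Y \<Longrightarrow> f v Y = \<alpha> + \<beta> * v"
proof -
  obtain a b where ab: "represents a b f" using assms by (auto simp: reg_represents)
  have "a \<noteq> 0 \<or> b \<noteq> 0" using norm_of_eq[OF ab] assms(2) by (auto simp: nrm_def)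
  then have "b = 0 \<and> degree a \<le> 1" using degree_nrm[of a b] ab assms(3) by (auto simp: norm_of_eq split: if_splits)
  then have "b = 0" "a = [:coeff a 0, coeff a 1:]"
    by (auto intro!: poly_eqI simp: coeff_pCons coeff_eq_0 split: nat.split)
  then have "poly a v + poly b v * Y = coeff a 0 + coeff a 1 * v" for v Y
    by (metis (no_types, lifting) add.right_neutral mult.commute mult_zero_left poly_0 poly_pCons)
  then show ?thesis using ab by (intro that[of "coeff a 0" "coeff a 1"]) (auto simp: represents_def)
qed

text \<open>The polynomials \<open>n(v)\<close> with \<open>n f\<close> divisible by \<open>g\<close> form an ideal; the local conditions and norms
  provide elements without a common zero, so the ideal contains 1.\<close>

lemma reg_dvd_local:
  assumes f: "reg f" and g: "reg g"
    and loc: "\<And>v Y. onE v Y \<Longrightarrow> \<exists>h m. reg h \<and> reg m \<and> h v Y \<noteq> 0 \<and> (\<forall>u Z. onE u Z \<longrightarrow> h u Z * f u Z = g u Z * m u Z)"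
  obtains m where "reg m" "\<And>v Y. onE v Y \<Longrightarrow> f v Y = g v Y * m v Y"
proof -
  define J where "J = {n. \<exists>m. reg m \<and> (\<forall>u Z. onE u Z \<longrightarrow> poly n u * f u Z = g u Z * m u Z)}"
  have J_ex: "\<exists>n\<in>J. poly n v \<noteq> 0" for v
  proof -
    obtain Y where Y: "onE v Y" using onE_exists by blast
    note Y' = onE_conj[OF Y]
    let ?Y' = "Y + c * (c * v)"
    obtain h1 m1 where 1: "reg h1" "reg m1" "h1 v Y \<noteq> 0" "\<And>u Z. onE u Z \<Longrightarrow> h1 u Z * f u Z = g u Z * m1 u Z"
      using loc[OF Y] by blast
    obtain h2 m2 where 2: "reg h2" "reg m2" "h2 v ?Y' \<noteq> 0" "\<And>u Z. onE u Z \<Longrightarrow> h2 u Z * f u Z = g u Z * m2 u Z"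
      using loc[OF Y'] by blast
    \<comment> \<open>If each of h1 and h2 vanishes at the point of the other, their sum vanishes at
      neither; otherwise one of them already works.\<close>
    obtain h m where h: "reg h" "reg m" "h v Y \<noteq> 0" "h v ?Y' \<noteq> 0" "\<And>u Z. onE u Z \<Longrightarrow> h u Z * f u Z = g u Z * m u Z"
    proof (cases "h1 v ?Y' = 0 \<and> h2 v Y = 0")
      case True
      show ?thesis
        by (rule that[of "\<lambda>v Y. h1 v Y + h2 v Y" "\<lambda>v Y. m1 v Y + m2 v Y"])
           (use 1 2 True in \<open>auto intro: reg_add simp: distrib_left distrib_right\<close>)
    next
      case False
      then show ?thesis using that[of h1 m1] that[of h2 m2] 1 2 by blast
    qed
    \<comment> \<open>Multiplying by the conjugate of h replaces h by a polynomial in v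
      alone.\<close>
    have "norm_of h \<in> J"
      unfolding J_def
    proof (intro CollectI exI conjI allI impI)
      show "reg (\<lambda>v Y. m v Y * h v (Y + c * (c * v)))" by (intro reg_mult reg_conj h)
      fix u Z assume Z: "onE u Z"
      show "poly (norm_of h) u * f u Z = g u Z * (m u Z * h u (Z + c * (c * u)))"
        unfolding poly_norm_of[OF h(1) Z] using h(5)[OF Z] by (simp add: mult_ac)
    qed
    moreover have "poly (norm_of h) v \<noteq> 0" using poly_norm_of[OF h(1) Y] h by simp
    ultimately show ?thesis by blast
  qed
  have J_lin: "p * n + q * n' \<in> J" if J: "n \<in> J" "n' \<in> J" for p q n n'
  proof -
    obtain m where m: "reg m" "\<And>u Z. onE u Z \<Longrightarrow> poly n u * f u Z = g u Z * m u Z"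
      using J(1) by (auto simp: J_def)
    obtain m' where m': "reg m'" "\<And>u Z. onE u Z \<Longrightarrow> poly n' u * f u Z = g u Z * m' u Z"
      using J(2) by (auto simp: J_def)
    have "reg (\<lambda>u Z. poly p u * m u Z + poly q u * m' u Z)"
      by (intro reg_add reg_mult reg_poly m m')
    moreover have "poly (p * n + q * n') u * f u Z = g u Z * (poly p u * m u Z + poly q u * m' u Z)" if "onE u Z" for u Z
    proof -
      have "poly (p * n + q * n') u * f u Z = poly p u * (poly n u * f u Z) + poly q u * (poly n' u * f u Z)"
        by (simp add: algebra_simps)
      then show ?thesis unfolding m(2)[OF that] m'(2)[OF that] by (simp add: algebra_simps)
    qed
    ultimately show ?thesis unfolding J_def by blast
  qed
  \<comment> \<open>A nonzero element of least degree divides every element of the ideal J, so a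
    root of it would be a common root.\<close>
  obtain n0 where n0: "n0 \<in> J" "n0 \<noteq> 0" "\<And>n. n \<in> J \<Longrightarrow> n \<noteq> 0 \<Longrightarrow> degree n0 \<le> degree n"
  proof -
    obtain n1 where "n1 \<in> J" "poly n1 0 \<noteq> 0" using J_ex[of 0] by blast
    then have "n1 \<in> J \<and> n1 \<noteq> 0" by auto
    from ex_has_least_nat[of "\<lambda>n. n \<in> J \<and> n \<noteq> 0", OF this, of degree] show ?thesis using that by blast
  qed
  have "degree n0 = 0"
  proof (rule ccontr)
    assume "degree n0 \<noteq> 0"
    then obtain v where v: "poly n0 v = 0" using alg_closed_imp_poly_has_root by blast
    obtain n where n: "n \<in> J" "poly n v \<noteq> 0" using J_ex by blast
    have "n mod n0 = 1 * n + (- (n div n0)) * n0" by (simp add: algebra_simps minus_div_mult_eq_mod)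
    also have "\<dots> \<in> J" using n n0 by (intro J_lin)
    finally have "n mod n0 \<in> J" .
    then have "n mod n0 = 0" using n0(3)[of "n mod n0"] degree_mod_less[OF n0(2), of n] by (meson not_le)
    then have "n0 dvd n" by auto
    then show False using v n(2) by (auto elim!: dvdE)
  qed
  then obtain k where k: "n0 = [:k:]" by (metis degree_0_id)
  then have k0: "k \<noteq> 0" using n0 by auto
  obtain m where m: "reg m" "\<And>u Z. onE u Z \<Longrightarrow> k * f u Z = g u Z * m u Z"
    using n0(1) unfolding J_def k by auto
  show ?thesis
  proof (rule that[of "\<lambda>u Z. inverse k * m u Z"])
    show "reg (\<lambda>u Z. inverse k * m u Z)" by (intro reg_mult reg_const m)
    fix u Z assume "onE u Z"
    from m(2)[OF this] show "f u Z = g u Z * (inverse k * m u Z)" using k0 by (simp add: field_simps)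
  qed
qed

text \<open>After taking norms, a high power of \<open>t\<close> in \<open>f\<close> becomes a high power of \<open>v - v\<^sub>0\<close> in a polynomial of
  degree at most \<open>N\<close>.\<close>

lemma vanishing_bound:
  assumes "reg h" "reg g" "reg r" "regular N f" and f0: "onE v1 Y1" "f v1 Y1 \<noteq> 0"
    and eq: "\<And>v Y. onE v Y \<Longrightarrow> h v Y * f v Y = t v Y ^ k * g v Y"
    and t: "\<And>v Y. onE v Y \<Longrightarrow> t v Y ^ 2 = (v - v0) * r v Y"
    and h: "onE v0 Y0" "h v0 Y0 \<noteq> 0"
  shows "k \<le> 2 * N"
proof (rule ccontr)
  assume "\<not> k \<le> 2 * N"
  have f: "reg f" using assms by (auto simp: reg_def)
  define n where "n = norm_of f"
  have n0: "n \<noteq> 0" unfolding n_def using f f0 by (rule norm_of_nonzero)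
  define m where "m = order v0 n"
  obtain n1 where n1: "n = [:- v0, 1:] ^ m * n1" "\<not> [:- v0, 1:] dvd n1"
    using order_decomp[OF n0] unfolding m_def by blast
  have "m \<le> degree n" unfolding m_def using n0 by (rule order_degree)
  also have "\<dots> \<le> N" unfolding n_def using assms by (intro degree_norm_of)
  finally have "2 * m < k" using \<open>\<not> k \<le> 2 * N\<close> by linarith
  then obtain j where k: "k = 2 * m + Suc j" using less_imp_Suc_add by fastforce
  \<comment> \<open>Squares are compared because, where v is ramified, only t^2 is a multiple of v -
    v0. After (v - v0)^(2 m) is cancelled, the identity extends to v = v0 and forces n1 to vanish
    there, against the choice of m.\<close>
  define F where "F = (\<lambda>v Y. (h v Y * poly n1 v) ^ 2 - (v - v0) ^ Suc j * (r v Y ^ k * (g v Y * f v (Y + c * (c * v))) ^ 2))"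
  have F': "F = (\<lambda>v Y. (h v Y * poly n1 v) ^ 2 + (-1) * ((v + (- v0)) ^ Suc j * (r v Y ^ k * (g v Y * f v (Y + c * (c * v))) ^ 2)))"
    by (simp add: F_def)
  have "reg F"
    unfolding F' by (intro reg_add reg_mult reg_power reg_const reg_v reg_poly reg_conj assms f)
  moreover have "F v Y = 0" if Y: "onE v Y" "v \<notin> {v0}" for v Y
  proof -
    have pn: "poly n v = (v - v0) ^ m * poly n1 v" unfolding n1 by simp
    have "(h v Y * poly n v) ^ 2 = (h v Y * f v Y) ^ 2 * f v (Y + c * (c * v)) ^ 2"
      unfolding n_def poly_norm_of[OF f Y(1)] by (simp add: power_mult_distrib mult_ac)
    also have "\<dots> = (t v Y ^ 2) ^ k * (g v Y * f v (Y + c * (c * v))) ^ 2"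
      unfolding eq[OF Y(1)] by (simp add: power_mult_distrib mult_ac flip: power_mult)
    also have "\<dots> = ((v - v0) * r v Y) ^ k * (g v Y * f v (Y + c * (c * v))) ^ 2"
      unfolding t[OF Y(1)] ..
    finally have "(v - v0) ^ (2 * m) * (h v Y * poly n1 v) ^ 2 =
       (v - v0) ^ (2 * m) * ((v - v0) ^ Suc j * (r v Y ^ k * (g v Y * f v (Y + c * (c * v))) ^ 2))"
      unfolding pn k by (simp add: power_mult_distrib power_add mult_ac power_mult power2_eq_square)
    then show ?thesis using Y(2) by (simp add: F_def)
  qed
  ultimately have "F v0 Y0 = 0" using h(1) reg_zero[of F "{v0}" v0 Y0] by blast
  then have "poly n1 v0 = 0" using h by (simp add: F_def)
  then show False using n1(2) by (simp add: poly_eq_0_iff_dvd)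
qed

section \<open>Orders of vanishing at the points of the curve\<close>

text \<open>Where X0 X2 vanishes, the second curve equation forces X1 = X3, and both are nonzero by
  \<open>C_opposite\<close>; so one of the two choices satisfies
  \<open>local_param_point\<close>.\<close>

definition tp :: "(4 \<Rightarrow> 'a) \<Rightarrow> (4, 'a) mpoly" where
  "tp p = (if p 0 \<noteq> 0 \<and> p 2 \<noteq> 0 then tpar 2 p else tpar 1 p)"

abbreviation ordp :: "(4 \<Rightarrow> 'a) \<Rightarrow> (4, 'a) mpoly \<Rightarrow> nat \<Rightarrow> bool" where
  "ordp p \<equiv> has_order C (proj_pt p) (tp p)"

lemma local_param_tp: assumes p: "p \<in> C" shows "local_param C (proj_pt p) (tp p)"
proof (cases "p 0 \<noteq> 0 \<and> p 2 \<noteq> 0")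
  case True
  then show ?thesis using local_param_point[OF p, of 2] by (simp add: tp_def)
next
  case False
  then have "(p 1 + p 3)^2 = 0" using p by (auto simp: mem_C)
  then have "p 1 = p 3" by (simp add: add_eq_0)
  then have "p 1 \<noteq> 0" "p (1 + 2) \<noteq> 0" using C_opposite[OF p, of 1] by auto
  then show ?thesis using local_param_point[OF p, of 1] False by (auto simp: tp_def)
qed

lemma ordp_order_along: "p \<in> C \<Longrightarrow> ordp p F k \<Longrightarrow> order_along C (cone {proj_pt p}) F = enat k"
  unfolding cone_singleton by (rule order_along_eq[OF local_param_tp])

lemma ordpI:
  assumes "eval_mpoly p H \<noteq> 0" "eval_mpoly p U \<noteq> 0"
    "\<And>x. x \<in> C \<Longrightarrow> eval_mpoly x H * eval_mpoly x F = eval_mpoly x (tp p) ^ k * eval_mpoly x U"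
  shows "ordp p F k"
  using assms by (intro has_orderI[of H _ U] not_vanishing_proj_pt) (auto simp: vanishing_ideal_def)

lemma eval_tp:
  "p 0 \<noteq> 0 \<Longrightarrow> p 2 \<noteq> 0 \<Longrightarrow> eval_mpoly x (tp p) = p 2 * (x 1 + x 3) + (p 1 + p 3) * x 2"
  "\<not> (p 0 \<noteq> 0 \<and> p 2 \<noteq> 0) \<Longrightarrow> eval_mpoly x (tp p) = p 1 * (x 0 + x 2) + (p 0 + p 2) * x 1"
  by (auto simp: tp_def tpar_def add.commute)

text \<open>The vertical line: on the chart it is a multiple of v + v1, and its divisor is P + P' +
  2 O for the conjugate points P, P' over v1.\<close>

definition vline :: "'a \<Rightarrow> (4, 'a) mpoly" where
  "vline v1 = Var 1 + Var 3 + Const (c * v1) * Var 2"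

text \<open>On the affine chart this is a multiple of \<open>Y + c l v + m\<close>.\<close>

definition sline :: "'a \<Rightarrow> 'a \<Rightarrow> (4, 'a) mpoly" where
  "sline l m = Var 0 + Const c * Var 1 + Const l * (Var 1 + Var 3) + Const m * Var 2"

lemma homogeneous_lines: "homogeneous 1 (Var i)" "homogeneous 1 (vline v1)" "homogeneous 1 (sline l m)"
proof -
  have *: "homogeneous 1 (Const k * Var i)" for k :: 'a and i :: 4
    using homogeneous_mult[OF homogeneous_Const homogeneous_Var, of k i] by simp
  then show "homogeneous 1 (Var i)" "homogeneous 1 (vline v1)"
    unfolding vline_def by (intro homogeneous_add homogeneous_Var *)+
  have "homogeneous 1 (Const l * (Var 1 + Var 3 :: (4, 'a) mpoly))"
    unfolding distrib_left by (intro homogeneous_add *)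
  then show "homogeneous 1 (sline l m)" unfolding sline_def
    by (intro homogeneous_add homogeneous_Var *)
qed

text \<open>If X2 = 0, the equations force X1 = X3 and X0 = c X1, so O is the only point outside the
  chart.\<close>

lemma C_cases:
  assumes "p \<in> C"
  obtains (infinite) u where "u \<noteq> 0" "p = (\<lambda>i. u * Opt 0 i)"
    | (affine) u v Y where "u \<noteq> 0" "onE v Y" "p = (\<lambda>i. u * apt v Y i)"
proof (cases "p 2 = 0")
  case True
  have "(p 1 + p 3)^2 = 0" using assms True by (auto simp: mem_C)
  then have 13: "p 3 = p 1" by (simp add: add_eq_0)
  then have "p 0 ^ 2 = (c * p 1)^2" using assms True by (auto simp: mem_C power2_eq_square mult_ac)
  then have 0: "p 0 = c * p 1" by (simp add: square_eq_iff2)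
  have "p 1 \<noteq> 0" using C_nonzero[OF assms] 0 13 True exhaust_4 by (metis mult_zero_right)
  moreover have "p = (\<lambda>i. p 1 * Opt 0 i)"
    using 0 13 True by (intro fun_4_eqI) (simp_all add: Opt_def mult.commute)
  ultimately show ?thesis by (rule infinite)
next
  case False
  from C_apt[OF assms this] obtain v Y where "onE v Y" "p = (\<lambda>i. p 2 / c * apt v Y i)" .
  moreover have "p 2 / c \<noteq> 0" using False c0 by simp
  ultimately show ?thesis using affine by blast
qed

lemma proj_apt_eq_iff: "proj_pt (apt v Y) = proj_pt (apt v' Y') \<longleftrightarrow> v = v' \<and> Y = Y'"
proof
  assume "proj_pt (apt v Y) = proj_pt (apt v' Y')"
  then obtain a where a: "a \<noteq> 0" "apt v' Y' = (\<lambda>i. a * apt v Y i)" by (auto simp: proj_pt_eq_iff)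
  from fun_cong[OF a(2), of 2] have "a = 1" using c0 by simp
  with a have eq: "apt v' Y' i = apt v Y i" for i by simp
  have "c * (c * (v' + v)) = (apt v' Y' 1 + apt v' Y' 3) + (apt v Y 1 + apt v Y 3)"
    unfolding apt_simps by (simp only: ring2)
  also have "\<dots> = 0" unfolding eq by (rule add_self)
  finally have "v' = v" using c0 by (simp add: add_eq_0)
  moreover from this have "Y' = Y" using eq[of 1] by simp
  ultimately show "v = v' \<and> Y = Y'" by simp
qed auto

lemma proj_apt_neq_O: "proj_pt (apt v Y) \<noteq> proj_pt (Opt 0)"
proof
  assume "proj_pt (apt v Y) = proj_pt (Opt 0)"
  then obtain a where a: "a \<noteq> 0" "Opt 0 = (\<lambda>i. a * apt v Y i)" by (auto simp: proj_pt_eq_iff)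
  from fun_cong[OF a(2), of 2] show False using c0 a(1) by (simp add: Opt_def)
qed

text \<open>The form on the left is the parameter at O and at the point over v = 0, up to a scalar.
  The identity gives X1 + X3 order 2 at both.\<close>

lemma tangent_square: "x \<in> C \<Longrightarrow> (x 0 + x 2 + c * x 1)^2 = c^2 * x 1 * (x 1 + x 3)"
proof -
  assume x: "x \<in> C"
  have "(x 0 + x 2 + c * x 1)^2 = (x 0 + x 2)^2 + c^2 * x 1^2" by (simp only: ring2)
  also have "(x 0 + x 2)^2 = c^2 * x 1 * x 3" using x by (simp add: mem_C)
  finally show ?thesis by (simp add: power2_eq_square algebra_simps)
qed

lemma curve_eq1: "x \<in> C \<Longrightarrow> (x 1 + x 3)^2 = c^2 * x 0 * x 2"
  by (simp add: mem_C)

lemma onE_zero: "onE 0 Y \<longleftrightarrow> Y = 1"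
  using square_eq_iff2[of Y 1] by (simp add: onE_def power2_eq_square)

lemma ordp_one: "p \<in> C \<Longrightarrow> ordp p 1 0"
  by (intro has_order_zero[OF local_param_tp] not_vanishing_proj_pt) auto

text \<open>At the two points with \<open>v = 0\<close> and \<open>v = \<infinity>\<close>, the coordinate \<open>v\<close> is ramified.\<close>

lemma eval_tp_ramified:
  assumes "u \<noteq> 0"
  shows "eval_mpoly x (tp (\<lambda>i. u * Opt 0 i)) = u * (x 0 + x 2 + c * x 1)"
    "eval_mpoly x (tp (\<lambda>i. u * apt 0 1 i)) = u * (x 0 + x 2 + c * x 1)"
  by (subst eval_tp(2); simp add: Opt_def algebra_simps)+

lemma eval_tp_unramified:
  assumes "u \<noteq> 0" "v \<noteq> 0"
  shows "eval_mpoly x (tp (\<lambda>i. u * apt v Y i)) = u * c * (x 1 + x 3 + c * v * x 2)"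
  using assms c0 by (subst eval_tp(1)) (simp_all, simp only: ring2)

lemma ordp_vline_O: "u \<noteq> 0 \<Longrightarrow> ordp (\<lambda>i. u * Opt 0 i) (vline v1) 2"
proof -
  assume u: "u \<noteq> 0"
  let ?t = "Var 0 + Var 2 + Const c * Var 1 :: (4, 'a) mpoly"
  show ?thesis
  \<comment> \<open>The multiplier clears the denominators of X1 + X3 = t^2 / (c^2 X1) and X2 = t^4
    / (c^6 X1^2 X0).\<close>
  proof (rule ordpI[of _ "Const (u^2 * c^6) * Var 1 ^ 2 * Var 0" "Const (c^4) * Var 0 * Var 1 + Const (c * v1) * ?t ^ 2"])
    show "eval_mpoly (\<lambda>i. u * Opt 0 i) (Const (u^2 * c^6) * Var 1 ^ 2 * Var 0) \<noteq> 0"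
      using u c0 by (simp add: Opt_def)
    show "eval_mpoly (\<lambda>i. u * Opt 0 i) (Const (c^4) * Var 0 * Var 1 + Const (c * v1) * ?t ^ 2) \<noteq> 0"
      using u c0 by (simp add: Opt_def mult.commute add_self)
    fix x assume x: "x \<in> C"
    define e where "e = x 1 + x 3"
    define t where "t = x 0 + x 2 + c * x 1"
    have e: "c^2 * x 0 * x 2 = e^2" using curve_eq1[OF x] by (simp add: e_def)
    have t: "t^2 = c^2 * x 1 * e" using tangent_square[OF x] by (simp add: e_def t_def)
    have "u^2 * c^6 * x 1^2 * x 0 * (e + c * v1 * x 2) =
        u^2 * ((c^2 * x 1 * e) * (c^4 * x 0 * x 1) + c * v1 * (c^2 * x 1)^2 * (c^2 * x 0 * x 2))"
      by (simp add: algebra_simps flip: power_add) (simp add: power2_eq_square numeral_eq_Suc mult_ac)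
    also have "\<dots> = u^2 * (t^2 * (c^4 * x 0 * x 1) + c * v1 * (c^2 * x 1 * e)^2)"
      unfolding e t by (simp add: power_mult_distrib mult_ac)
    also have "\<dots> = (u * t)^2 * (c^4 * x 0 * x 1 + c * v1 * t^2)"
      unfolding t[symmetric] by (simp add: power2_eq_square algebra_simps)
    finally show "eval_mpoly x (Const (u^2 * c^6) * Var 1 ^ 2 * Var 0) * eval_mpoly x (vline v1) =
       eval_mpoly x (tp (\<lambda>i. u * Opt 0 i)) ^ 2 * eval_mpoly x (Const (c^4) * Var 0 * Var 1 + Const (c * v1) * ?t ^ 2)"
      by (simp add: eval_tp_ramified[OF u] vline_def e_def t_def)
  qed
qed

text \<open>Over v = 0 lies the single point Y = 1, which is its own conjugate; hence the order 2
  there.\<close>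

lemma ordp_vline_apt:
  assumes u: "u \<noteq> 0" and Y: "onE v Y"
  shows "ordp (\<lambda>i. u * apt v Y i) (vline v1) (if v = v1 then if v = 0 then 2 else 1 else 0)" (is "ordp ?p _ _")
proof -
  have p: "?p \<in> C" using u Y by (intro C_scale apt_in_C)
  have ev: "eval_mpoly ?p (vline v1) = u * (c * (c * (v + v1)))"
    unfolding vline_def by simp (simp only: ring2)
  consider "v \<noteq> v1" | "v = v1" "v \<noteq> 0" | "v = 0" "v1 = 0" by blast
  then show ?thesis
  proof cases
    case 1
    then have "vline v1 \<notin> vanishing_ideal (proj_pt ?p)"
      using ev u c0 by (intro not_vanishing_proj_pt) (simp add: add_eq_0)
    then show ?thesis using has_order_zero[OF local_param_tp[OF p]] 1 by simp
  next
    case 2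
    have "ordp ?p (vline v1) 1"
      by (rule ordpI[of _ "Const (u * c)" 1]) (use 2 u c0 in \<open>simp_all add: eval_tp_unramified vline_def\<close>)
    then show ?thesis using 2 by simp
  next
    case 3
    then have Y1: "Y = 1" using Y by (simp add: onE_zero)
    have "ordp ?p (vline v1) 2"
    proof (rule ordpI[of _ "Const (u^2 * c^2) * Var 1" 1])
      fix x assume "x \<in> C"
      from tangent_square[OF this] show "eval_mpoly x (Const (u^2 * c^2) * Var 1) * eval_mpoly x (vline v1) =
          eval_mpoly x (tp ?p) ^ 2 * eval_mpoly x 1"
        unfolding 3 Y1 eval_tp_ramified[OF u] power_mult_distrib by (simp add: vline_def 3 mult_ac)
    qed (use u c0 Y1 3 in auto)
    then show ?thesis using 3 by simp
  qed
qed

lemma ordp_X2_O: "u \<noteq> 0 \<Longrightarrow> ordp (\<lambda>i. u * Opt 0 i) (Var 2) 4"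
proof -
  assume u: "u \<noteq> 0"
  show ?thesis
  proof (rule ordpI[of _ "Const (u^4 * c^6) * Var 1 ^ 2 * Var 0" 1])
    show "eval_mpoly (\<lambda>i. u * Opt 0 i) (Const (u^4 * c^6) * Var 1 ^ 2 * Var 0) \<noteq> 0"
      using u c0 by (simp add: Opt_def)
    fix x assume x: "x \<in> C"
    define e where "e = x 1 + x 3"
    define t where "t = x 0 + x 2 + c * x 1"
    have e: "c^2 * x 0 * x 2 = e^2" using curve_eq1[OF x] by (simp add: e_def)
    have t: "t^2 = c^2 * x 1 * e" using tangent_square[OF x] by (simp add: e_def t_def)
    have "u^4 * c^6 * x 1^2 * x 0 * x 2 = u^4 * ((c^2 * x 1)^2 * (c^2 * x 0 * x 2))"
      by (simp add: power2_eq_square numeral_eq_Suc mult_ac)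
    also have "\<dots> = u^4 * (t^2)^2" unfolding e t by (simp add: power_mult_distrib mult_ac)
    also have "\<dots> = (u * t)^4" by (simp add: power_mult_distrib flip: power_mult)
    finally show "eval_mpoly x (Const (u^4 * c^6) * Var 1 ^ 2 * Var 0) * eval_mpoly x (Var 2) =
       eval_mpoly x (tp (\<lambda>i. u * Opt 0 i)) ^ 4 * eval_mpoly x 1"
      by (simp add: eval_tp_ramified[OF u] t_def)
  qed simp
qed

lemma ordp_X2_apt: "u \<noteq> 0 \<Longrightarrow> onE v Y \<Longrightarrow> ordp (\<lambda>i. u * apt v Y i) (Var 2) 0"
  using c0 by (intro has_order_zero local_param_tp not_vanishing_proj_pt C_scale apt_in_C) auto

text \<open>In terms of the parameter t at O the line is t + l (X1 + X3) + (m + 1) X2, where the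
  factors t, X1 + X3 and X2 have orders 1, 2 and 4.\<close>

lemma ordp_sline_O: "u \<noteq> 0 \<Longrightarrow> ordp (\<lambda>i. u * Opt 0 i) (sline l m) 1"
proof -
  assume u: "u \<noteq> 0"
  let ?t = "Var 0 + Var 2 + Const c * Var 1 :: (4, 'a) mpoly"
  let ?U = "Const (c^6) * Var 0 * Var 1 ^ 2 + (Const (l * c^4) * Var 0 * Var 1) * ?t + Const (m + 1) * ?t ^ 3"
  show ?thesis
  proof (rule ordpI[of _ "Const (u * c^6) * Var 1 ^ 2 * Var 0" ?U])
    show "eval_mpoly (\<lambda>i. u * Opt 0 i) (Const (u * c^6) * Var 1 ^ 2 * Var 0) \<noteq> 0"
      using u c0 by (simp add: Opt_def)
    show "eval_mpoly (\<lambda>i. u * Opt 0 i) ?U \<noteq> 0"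
      using u c0 by (simp add: Opt_def mult.commute add_self)
    fix x assume x: "x \<in> C"
    define e where "e = x 1 + x 3"
    define t where "t = x 0 + x 2 + c * x 1"
    have e: "c^2 * x 0 * x 2 = e^2" using curve_eq1[OF x] by (simp add: e_def)
    have t: "t^2 = c^2 * x 1 * e" using tangent_square[OF x] by (simp add: e_def t_def)
    define m' where "m' = m + 1"
    have "x 0 + c * x 1 + l * e + m * x 2 = t + l * e + m' * x 2"
      unfolding t_def m'_def by (simp only: ring2)
    then have "u * c^6 * x 1^2 * x 0 * (x 0 + c * x 1 + l * e + m * x 2) = u * c^6 * x 1^2 * x 0 * (t + l * e + m' * x 2)"
      by (simp only:)
    also have "\<dots> =
      u * (t * (c^6 * x 0 * x 1^2) + l * c^4 * x 0 * x 1 * (c^2 * x 1 * e) + m' * ((c^2 * x 1)^2 * (c^2 * x 0 * x 2)))"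
      by (simp add: distrib_left) (simp add: power2_eq_square numeral_eq_Suc mult_ac)
    also have "\<dots> = u * (t * (c^6 * x 0 * x 1^2) + l * c^4 * x 0 * x 1 * t^2 + m' * (t^2)^2)"
      unfolding e t by (simp add: power_mult_distrib mult_ac)
    also have "\<dots> = (u * t) ^ 1 * (c^6 * x 0 * x 1^2 + (l * c^4 * x 0 * x 1) * t + m' * t^3)"
      by (simp add: distrib_left distrib_right power2_eq_square numeral_eq_Suc mult_ac)
    finally show "eval_mpoly x (Const (u * c^6) * Var 1 ^ 2 * Var 0) * eval_mpoly x (sline l m) =
       eval_mpoly x (tp (\<lambda>i. u * Opt 0 i)) ^ 1 * eval_mpoly x ?U"
      by (simp add: eval_tp_ramified[OF u] sline_def e_def t_def m'_def)
  qed
qed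

lemma ordp_mult: "p \<in> C \<Longrightarrow> ordp p F k \<Longrightarrow> ordp p G l \<Longrightarrow> ordp p (F * G) (k + l)"
  by (rule has_order_mult[OF local_param_tp])

text \<open>The norm of the line is the product of three vertical lines.\<close>

lemma ordp_sline_apt:
  assumes u: "u \<noteq> 0" and Y: "onE v Y"
    and s1: "v1 + v2 + v3 = l^2 + c * l" and s2: "v1 * v2 + v1 * v3 + v2 * v3 = m" and s3: "c^2 * (v1 * v2 * v3) = m^2 + 1"
  shows "ordp (\<lambda>i. u * apt v Y i) (sline l m)
    (if Y = c * l * v + m then of_bool (v = v1) + of_bool (v = v2) + of_bool (v = v3) else 0)" (is "ordp ?p _ _")
proof -
  have p: "?p \<in> C" using u Y by (intro C_scale apt_in_C)
  have ev: "eval_mpoly (\<lambda>i. u * apt v Y i) (sline l m) = u * (c * (Y + c * l * v + m))" for u v Y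
    unfolding sline_def by simp (simp only: ring2)
  consider "Y \<noteq> c * l * v + m" | "Y = c * l * v + m" "v \<noteq> 0" | "Y = c * l * v + m" "v = 0" by blast
  then show ?thesis
  proof cases
    case 1
    then have "sline l m \<notin> vanishing_ideal (proj_pt ?p)"
      using ev[of u v Y] u c0 by (intro not_vanishing_proj_pt) (simp add: add_eq_0 add.assoc)
    then show ?thesis using has_order_zero[OF local_param_tp[OF p]] 1 by simp
  next
    case 2
    \<comment> \<open>For v nonzero the conjugate line misses the point, so \<open>?A\<close> is a
      unit and the line has the order of the product of the three vertical lines.\<close>
    let ?conj = "Var 0 + Const c * Var 3 + Const l * (Var 1 + Var 3) + Const m * Var 2 :: (4, 'a) mpoly"
    let ?A = "Const c * Var 2 * ?conj"
    have evc: "eval_mpoly (\<lambda>i. u * apt v Y i) ?conj = u * (c * (Y + c * (c * v) + c * l * v + m))" for u v Y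
      by simp (simp only: ring2)
    have "Y + c * (c * v) + c * l * v + m = c * (c * v)" unfolding 2 by (simp only: ring2)
    then have A: "?A \<notin> vanishing_ideal (proj_pt ?p)"
      using u c0 2 evc[of u v Y] by (intro not_vanishing_proj_pt) (simp only: eval_mpoly_mult eval_mpoly_Const eval_mpoly_Var, simp)
    have w: "ordp ?p (vline w) (of_bool (v = w))" for w
      using ordp_vline_apt[OF u Y, of w] 2(2) by (cases "v = w") auto
    have "ordp ?p (vline v1 * vline v2 * vline v3) (of_bool (v = v1) + of_bool (v = v2) + of_bool (v = v3))"
      by (intro ordp_mult w p)
    moreover have "vline v1 * vline v2 * vline v3 - ?A * sline l m \<in> vanishing_ideal C"
    proof (rule vanishing_idealI)
      fix x assume "x \<in> C"
      then show "eval_mpoly x (vline v1 * vline v2 * vline v3 - ?A * sline l m) = 0"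
      proof (cases rule: C_cases)
        case (infinite u)
        then show ?thesis by (simp add: vline_def Opt_def add_self)
      next
        case (affine u v Y)
        have evv: "eval_mpoly x (vline w) = u * (c * (c * (v + w)))" for w
          unfolding vline_def affine by simp (simp only: ring2)
        have N: "(Y + c * (c * v) + c * l * v + m) * (Y + c * l * v + m) = c^2 * ((v + v1) * (v + v2) * (v + v3))"
        proof -
          have "c^2 * ((v + v1) * (v + v2) * (v + v3)) =
             c^2 * v^3 + c^2 * v^2 * (v1 + v2 + v3) + c^2 * v * (v1 * v2 + v1 * v3 + v2 * v3) + c^2 * (v1 * v2 * v3)"
            by (simp only: ring2)
          also have "\<dots> = c^2 * v^3 + c^2 * v^2 * (l^2 + c * l) + c^2 * v * m + (m^2 + 1)"
            unfolding s1 s2 s3 ..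
          also have "\<dots> = (Y + c * (c * v) + c * l * v + m) * (Y + c * l * v + m)"
            by (simp only: ring2 onE_square[OF affine(2)])
          finally show ?thesis by simp
        qed
        have "eval_mpoly x (?A * sline l m) = c * (u * c) * (u * (c * (Y + c * (c * v) + c * l * v + m))) * (u * (c * (Y + c * l * v + m)))"
          unfolding eval_mpoly_mult[of x _ "sline l m"] eval_mpoly_mult[of x _ ?conj] unfolding affine(3) ev evc by simp
        also have "\<dots> = c * u * c * u * c * u * c * ((Y + c * (c * v) + c * l * v + m) * (Y + c * l * v + m))"
          by (simp only: mult_ac)
        also have "\<dots> = eval_mpoly x (vline v1 * vline v2 * vline v3)"
          unfolding N eval_mpoly_mult evv by (simp only: mult_ac power2_eq_square)
        finally show ?thesis by simp
      qed
    qed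
    ultimately have "ordp ?p (?A * sline l m) (of_bool (v = v1) + of_bool (v = v2) + of_bool (v = v3))"
      by (rule has_order_cong)
    from has_order_cancel_unit[OF local_param_tp[OF p] A this] show ?thesis using 2 by simp
  next
    case 3
    then have Y1: "Y = 1" "m = 1" using Y by (auto simp: onE_zero)
    have "ordp ?p (sline l m) 1"
    proof (rule ordpI[of _ "Const (u * c^2) * Var 1" "Const (c^2) * Var 1 + Const l * (Var 0 + Var 2 + Const c * Var 1)"])
      fix x assume "x \<in> C"
      then have t: "(x 0 + x 2 + c * x 1)^2 = c^2 * x 1 * (x 1 + x 3)" by (rule tangent_square)
      have "u * c^2 * x 1 * (x 0 + c * x 1 + l * (x 1 + x 3) + x 2) =
         u * (c^2 * x 1 * (x 0 + x 2 + c * x 1) + l * (c^2 * x 1 * (x 1 + x 3)))"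
        by (simp only: distrib_left distrib_right mult_ac add_ac)
      also have "\<dots> = u * (x 0 + x 2 + c * x 1) * (c^2 * x 1 + l * (x 0 + x 2 + c * x 1))"
        unfolding t[symmetric] by (simp only: distrib_left distrib_right mult_ac add_ac power2_eq_square)
      finally show "eval_mpoly x (Const (u * c^2) * Var 1) * eval_mpoly x (sline l m) =
          eval_mpoly x (tp ?p) ^ 1 * eval_mpoly x (Const (c^2) * Var 1 + Const l * (Var 0 + Var 2 + Const c * Var 1))"
        unfolding 3(2) Y1 eval_tp_ramified[OF u] sline_def
        by (simp only: eval_mpoly_mult eval_mpoly_add eval_mpoly_Const eval_mpoly_Var power_one_right mult_1_left)
    qed (use u c0 Y1 3(2) in \<open>auto simp: add_self mult.commute\<close>)
    \<comment> \<open>Here m = 1, so the product of the three roots is 0 and their second symmetric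
      function is 1: exactly one of them is 0.\<close>
    moreover have "of_bool (v = v1) + of_bool (v = v2) + of_bool (v = v3) = (1::nat)"
    proof -
      have "v1 * v2 * v3 = 0" using s3 c0 Y1 by (simp add: add_self)
      moreover have "v1 * v2 + v1 * v3 + v2 * v3 = 1" using s2 Y1 by simp
      ultimately show ?thesis using 3(2) by auto
    qed
    ultimately show ?thesis using 3 by simp
  qed
qed

section \<open>The group law\<close>

lemma Var2_C: "Var 2 \<notin> vanishing_ideal C"
  using Opt_in_C[of 1] vanishing_idealD[of "Var 2" C "Opt 1"] by (auto simp: Opt_def)

lemma vanishing_chart:
  assumes "\<And>u v Y. u \<noteq> 0 \<Longrightarrow> onE v Y \<Longrightarrow> eval_mpoly (\<lambda>i. u * apt v Y i) F = 0"
  shows "F \<in> vanishing_ideal C"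
proof -
  have "Var 2 * F \<in> vanishing_ideal C"
  proof (rule vanishing_idealI)
    fix x assume "x \<in> C"
    then show "eval_mpoly x (Var 2 * F) = 0"
      by (cases rule: C_cases) (auto simp: assms, simp add: Opt_def)
  qed
  then show ?thesis using irred_setD[OF irred_C] Var2_C by blast
qed

lemma homogeneous_nonvanishing:
  assumes "homogeneous k F" "F \<notin> vanishing_ideal C"
  obtains v Y where "onE v Y" "eval_mpoly (apt v Y) F \<noteq> 0"
  using assms vanishing_chart[of F] eval_homogeneous_scale[OF assms(1)] by (metis mult_eq_0_iff)

lemma reg_scaled_apt: "reg (\<lambda>v Y. eval_mpoly (\<lambda>i. u * apt v Y i) F)"
  by (intro reg_eval reg_mult reg_const reg_apt)

text \<open>Supplies the ramification hypothesis of \<open>vanishing_bound\<close>. For v0 = 0 this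
  is \<open>tangent_square\<close>; otherwise t itself is a multiple of v + v0.\<close>

lemma tp_apt_square:
  assumes "s \<noteq> 0" "u \<noteq> 0" "onE v0 Y0"
  obtains r where "reg r"
    "\<And>v Y. onE v Y \<Longrightarrow> eval_mpoly (\<lambda>i. u * apt v Y i) (tp (\<lambda>i. s * apt v0 Y0 i)) ^ 2 = (v - v0) * r v Y"
proof (cases "v0 = 0")
  case True
  then have Y0: "Y0 = 1" using assms by (simp add: onE_zero)
  show ?thesis
  proof (rule that[of "\<lambda>v Y. (s * c * u * c * u * c * s * c) * (Y + v * v)"])
    have "reg (\<lambda>v Y. Y)" using regular_Y by (auto simp: reg_def)
    then show "reg (\<lambda>v Y. (s * c * u * c * u * c * s * c) * (Y + v * v))"
      by (intro reg_mult reg_add reg_const reg_v)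
    fix v Y assume Y: "onE v Y"
    have "(\<lambda>i. u * apt v Y i) \<in> C" using assms Y by (intro C_scale apt_in_C)
    note E = tangent_square[OF this]
    show "eval_mpoly (\<lambda>i. u * apt v Y i) (tp (\<lambda>i. s * apt v0 Y0 i)) ^ 2 = (v - v0) * ((s * c * u * c * u * c * s * c) * (Y + v * v))"
      unfolding True Y0 eval_tp_ramified[OF assms(1)] power_mult_distrib[of s] E
      unfolding apt_simps by (simp only: ring2)
  qed
next
  case False
  show ?thesis
  proof (rule that[of "\<lambda>v Y. (s * c * u * c * c) * ((s * c * u * c * c) * (v + v0))"])
    show "reg (\<lambda>v Y. (s * c * u * c * c) * ((s * c * u * c * c) * (v + v0)))"
      by (intro reg_mult reg_add reg_const reg_v)
    fix v Y assume Y: "onE v Y"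
    show "eval_mpoly (\<lambda>i. u * apt v Y i) (tp (\<lambda>i. s * apt v0 Y0 i)) ^ 2 = (v - v0) * ((s * c * u * c * c) * ((s * c * u * c * c) * (v + v0)))"
      unfolding eval_tp_unramified[OF assms(1) False] apt_simps by (simp only: ring2)
  qed
qed

text \<open>A form of degree k has a pole of order at most 4 k at O on the chart, so
  \<open>vanishing_bound\<close> limits the exponents of t.\<close>

lemma ordp_exists:
  assumes hom: "homogeneous k F" and F: "F \<notin> vanishing_ideal C" and Y0: "onE v0 Y0"
  obtains n where "ordp (apt v0 Y0) F n"
proof (rule has_order_exists[OF local_param_tp[OF apt_in_C[OF Y0]], of F "2 * (k * 4)"])
  fix n H G
  assume H: "H \<notin> vanishing_ideal (proj_pt (apt v0 Y0))" "H * F - tp (apt v0 Y0) ^ n * G \<in> vanishing_ideal C"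
  obtain x where "x \<in> proj_pt (apt v0 Y0)" "eval_mpoly x H \<noteq> 0" using H(1) by (rule not_vanishing_idealE)
  then obtain u where u: "u \<noteq> 0" "eval_mpoly (\<lambda>i. u * apt v0 Y0 i) H \<noteq> 0"
    by (auto simp: mem_proj_pt)
  obtain v1 Y1 where v1: "onE v1 Y1" "eval_mpoly (apt v1 Y1) F \<noteq> 0"
    using homogeneous_nonvanishing[OF hom F] .
  obtain r where r: "reg r" "\<And>v Y. onE v Y \<Longrightarrow>
      eval_mpoly (\<lambda>i. u * apt v Y i) (tp (\<lambda>i. 1 * apt v0 Y0 i)) ^ 2 = (v - v0) * r v Y"
    using tp_apt_square[of 1 u] u Y0 by (metis one_neq_zero)
  have reg4: "regular 4 (\<lambda>v Y. u * apt v Y i)" for i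
    using regular_mult[OF regular_const regular_apt, of 0 u i] by simp
  show "n \<le> 2 * (k * 4)"
  proof (rule vanishing_bound[OF reg_scaled_apt reg_scaled_apt r(1) regular_homogeneous[OF hom reg4] v1(1) _ _ r(2) Y0 u(2)])
    show "eval_mpoly (\<lambda>i. u * apt v1 Y1 i) F \<noteq> 0" using v1 u by (simp add: eval_homogeneous_scale[OF hom])
    fix v Y assume "onE v Y"
    then have "(\<lambda>i. u * apt v Y i) \<in> C" using u by (intro C_scale apt_in_C)
    from vanishing_idealD[OF H(2) this]
    show "eval_mpoly (\<lambda>i. u * apt v Y i) H * eval_mpoly (\<lambda>i. u * apt v Y i) F =
       eval_mpoly (\<lambda>i. u * apt v Y i) (tp (\<lambda>i. 1 * apt v0 Y0 i)) ^ n * eval_mpoly (\<lambda>i. u * apt v Y i) G"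
      by simp
  qed
qed (rule that)

section \<open>Functions with at most one simple pole\<close>

definition vval :: "'a \<Rightarrow> 'a \<Rightarrow> nat" where
  "vval v1 v = (if v = v1 then if v = 0 then 2 else 1 else 0)"

lemma ordp_vline: "onE v Y \<Longrightarrow> ordp (apt v Y) (vline v1) (vval v1 v)"
  using ordp_vline_apt[of 1 v Y v1] by (simp add: vval_def)

abbreviation A where "A v Y \<equiv> proj_pt (apt v Y)"
abbreviation Opoint where "Opoint \<equiv> proj_pt (Opt 0)"

lemma mu4_O_eq: "mu4_O c = Opoint"
  by (simp add: mu4_O_def Opt_def[abs_def])

lemma curve_cases:
  assumes "P \<in> mu4_curve c"
  obtains "P = Opoint" | v Y where "onE v Y" "P = A v Y"
proof -
  obtain p where "p \<in> C" "P = proj_pt p" using assms curve_iff by blast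
  then show ?thesis using that by (cases rule: C_cases) (auto simp: proj_pt_scale)
qed

lemma pt_div_of_bool: "pt_div P S = of_bool (S = P)"
  by (simp add: pt_div_def)

text \<open>On the affine chart the divisor of F / G is R - R'. A point R or R' equal to O
  contributes nothing to this condition.\<close>

definition quotient_orders :: "(4, 'a) mpoly \<Rightarrow> (4, 'a) mpoly \<Rightarrow> 'a point \<Rightarrow> 'a point \<Rightarrow> bool" where
  "quotient_orders F G R R' \<longleftrightarrow> (\<forall>v Y. onE v Y \<longrightarrow> (\<exists>a b. ordp (apt v Y) F a \<and> ordp (apt v Y) G b \<and>
     int a - int b = of_bool (A v Y = R) - of_bool (A v Y = R')))"

text \<open>The function w, its form W and the orders of W are chosen so that multiplying by w
  removes a simple pole at R. A pole at O is invisible on the chart, hence w = 1 in that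
  case.\<close>

definition pole_factor :: "'a point \<Rightarrow> ('a \<Rightarrow> 'a) \<Rightarrow> (4, 'a) mpoly \<Rightarrow> ('a \<Rightarrow> nat) \<Rightarrow> bool" where
  "pole_factor R w W k \<longleftrightarrow> (R = Opoint \<and> w = (\<lambda>v. 1) \<and> W = Const c * Var 2 \<and> k = (\<lambda>v. 0)) \<or>
     (\<exists>v' Y'. onE v' Y' \<and> R = A v' Y' \<and> w = (\<lambda>v. v + v') \<and> W = vline v' \<and> k = vval v')"

lemma pole_factor_exists: "R \<in> mu4_curve c \<Longrightarrow> \<exists>w W k. pole_factor R w W k"
  by (cases rule: curve_cases) (unfold pole_factor_def, blast+)

lemma pole_factor_eval: "pole_factor R w W k \<Longrightarrow> eval_mpoly (\<lambda>i. u * apt v Y i) W = c * (c * (u * w v))"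
proof -
  have "eval_mpoly (\<lambda>i. u * apt v Y i) (vline v') = c * (c * (u * (v + v')))" for v'
    unfolding vline_def by simp (simp only: ring2)
  then show "pole_factor R w W k \<Longrightarrow> eval_mpoly (\<lambda>i. u * apt v Y i) W = c * (c * (u * w v))"
    by (auto simp: pole_factor_def mult_ac)
qed

lemma pole_factor_ordp: "pole_factor R w W k \<Longrightarrow> onE v Y \<Longrightarrow> ordp (apt v Y) W (k v)"
proof -
  assume Y: "onE v Y"
  have "Const c * Var 2 \<notin> vanishing_ideal (A v Y)" using c0 by (intro not_vanishing_proj_pt) simp
  then have "ordp (apt v Y) (Const c * Var 2) 0" by (intro has_order_zero local_param_tp apt_in_C Y)
  then show "pole_factor R w W k \<Longrightarrow> ordp (apt v Y) W (k v)"
    using ordp_vline[OF Y] by (auto simp: pole_factor_def)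
qed

text \<open>A function of v alone has equal orders at conjugate points. If R' is O, the simple zero
  R lacks its conjugate; otherwise the zero of w at R' is cancelled by the pole while the one at the
  conjugate point remains.\<close>

lemma linear_quotient_impossible:
  assumes hom: "homogeneous k F" "homogeneous k G"
    and ord: "quotient_orders F G R R'" and RR': "R \<noteq> R'" "R \<in> mu4_curve c" "R' \<in> mu4_curve c"
    and W: "pole_factor R' w W wo"
    and eq: "\<And>v Y. onE v Y \<Longrightarrow> w v * eval_mpoly (apt v Y) F = eval_mpoly (apt v Y) G * (\<alpha> + \<beta> * v)"
  shows False
proof -
  define M :: "(4, 'a) mpoly" where "M = Const (c * \<alpha>) * Var 2 + Const \<beta> * (Var 1 + Var 3)"
  have evM: "eval_mpoly (\<lambda>i. u * apt v Y i) M = c * (c * (u * (\<alpha> + \<beta> * v)))" for u v Y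
    unfolding M_def by simp (simp only: ring2)
  have WM: "W * F - M * G \<in> vanishing_ideal C"
  proof (rule vanishing_chart)
    fix u v Y :: 'a assume "u \<noteq> 0" "onE v Y"
    have "c * (c * (u * w v)) * (u ^ k * eval_mpoly (apt v Y) F) = c * (c * u) * u ^ k * (w v * eval_mpoly (apt v Y) F)"
      by (simp only: mult_ac)
    also have "\<dots> = c * (c * (u * (\<alpha> + \<beta> * v))) * (u ^ k * eval_mpoly (apt v Y) G)"
      unfolding eq[OF \<open>onE v Y\<close>] by (simp only: mult_ac)
    finally show "eval_mpoly (\<lambda>i. u * apt v Y i) (W * F - M * G) = 0"
      by (simp add: pole_factor_eval[OF W] evM eval_homogeneous_scale[OF hom(1)] eval_homogeneous_scale[OF hom(2)])
  qed
  define mo where "mo = (\<lambda>v. if \<beta> \<noteq> 0 then vval (\<alpha> / \<beta>) v else 0)"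
  have n0: "\<alpha> \<noteq> 0 \<or> \<beta> \<noteq> 0"
  proof (rule ccontr)
    assume "\<not> ?thesis"
    then have "W * F \<in> vanishing_ideal C" using WM by (simp add: M_def Const_def)
    moreover obtain v Y where Y: "onE v Y" using onE_exists by blast
    ultimately show False
      using ord pole_factor_ordp[OF W Y] has_order_nonvanishing[OF local_param_tp[OF apt_in_C[OF Y]]] irred_setD[OF irred_C]
      unfolding quotient_orders_def by blast
  qed
  have Mo: "ordp (apt v Y) M (mo v)" if Y: "onE v Y" for v Y
  proof (cases "\<alpha> + \<beta> * v = 0")
    case False
    then have "M \<notin> vanishing_ideal (A v Y)" using c0 evM[of 1 v Y] by (intro not_vanishing_proj_pt) simp
    then have "ordp (apt v Y) M 0" by (intro has_order_zero local_param_tp apt_in_C Y)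
    moreover have "\<not> (\<beta> \<noteq> 0 \<and> v = \<alpha> / \<beta>)"
    proof
      assume "\<beta> \<noteq> 0 \<and> v = \<alpha> / \<beta>"
      then have "\<beta> * v = \<alpha>" by simp
      with False show False by (simp add: add_self)
    qed
    then have "mo v = 0" by (auto simp: mo_def vval_def)
    ultimately show ?thesis by simp
  next
    case True
    then have "\<alpha> = \<beta> * v" by (simp add: add_eq_0)
    then have b: "\<beta> \<noteq> 0" "v = \<alpha> / \<beta>" using n0 by auto
    have "Const \<beta> \<notin> vanishing_ideal (A v Y)" using b by (intro not_vanishing_proj_pt) simp
    then have "ordp (apt v Y) (Const \<beta>) 0" by (intro has_order_zero local_param_tp apt_in_C Y)
    from ordp_mult[OF apt_in_C[OF Y] this ordp_vline[OF Y]]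
    have "ordp (apt v Y) (Const \<beta> * vline (\<alpha> / \<beta>)) (0 + vval (\<alpha> / \<beta>) v)" .
    moreover have "Const \<beta> * vline (\<alpha> / \<beta>) - M \<in> vanishing_ideal C"
      by (rule vanishing_idealI) (use b in \<open>simp add: vline_def M_def field_simps\<close>)
    ultimately show ?thesis using b by (auto simp: mo_def intro: has_order_cong)
  qed
  have key: "int (wo v) + of_bool (A v Y = R) - of_bool (A v Y = R') = int (mo v)" if Y: "onE v Y" for v Y
  proof -
    obtain a b where ab: "ordp (apt v Y) F a" "ordp (apt v Y) G b"
      "int a - int b = of_bool (A v Y = R) - of_bool (A v Y = R')"
      using ord Y unfolding quotient_orders_def by blast
    have "ordp (apt v Y) (M * G) (wo v + a)"
      using ordp_mult[OF apt_in_C[OF Y] pole_factor_ordp[OF W Y] ab(1)] WM by (rule has_order_cong)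
    moreover have "ordp (apt v Y) (M * G) (mo v + b)"
      by (intro ordp_mult apt_in_C Y Mo ab)
    ultimately have "wo v + a = mo v + b" by (rule has_order_unique[OF local_param_tp[OF apt_in_C[OF Y]]])
    with ab show ?thesis by linarith
  qed
  from RR'(3) show False
  proof (cases rule: curve_cases)
    case 1
    then have wo: "wo = (\<lambda>v. 0)" using W proj_apt_neq_O by (auto simp: pole_factor_def)
    from RR'(2) obtain v Y where R: "onE v Y" "R = A v Y" using RR' 1 by (cases rule: curve_cases) auto
    have "mo v = 1" using key[OF R(1)] RR'(1) R(2) wo by simp
    \<comment> \<open>At v = 0 the values of \<open>vval\<close> are 0 and 2, never 1.\<close>
    then have "v \<noteq> 0" by (auto simp: mo_def vval_def split: if_splits)
    moreover have "A v (Y + c * (c * v)) = R" using key[OF onE_conj[OF R(1)]] \<open>mo v = 1\<close> wo RR'(1) 1 proj_apt_neq_O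
      by (auto split: if_splits simp: of_bool_def)
    ultimately show False using R c0 by (simp add: proj_apt_eq_iff)
  next
    case (2 v Y)
    have wo: "wo = vval v" using W 2 proj_apt_neq_O[of v Y] by (auto simp: pole_factor_def proj_apt_eq_iff)
    have 1: "int (vval v v) - 1 = int (mo v)" using key[OF 2(1)] 2 RR'(1) wo by auto
    then have "v \<noteq> 0" by (auto simp: mo_def vval_def split: if_splits)
    then have "mo v = 0" using 1 by (simp add: vval_def)
    moreover have "A v (Y + c * (c * v)) \<noteq> R'" using 2 \<open>v \<noteq> 0\<close> c0 by (simp add: proj_apt_eq_iff)
    ultimately have "1 + of_bool (A v (Y + c * (c * v)) = R) = (0 :: int)"
      using key[OF onE_conj[OF 2(1)]] \<open>v \<noteq> 0\<close> wo by (simp add: vval_def)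
    then show False by (simp add: of_bool_def split: if_splits)
  qed
qed

text \<open>The factor w absorbs the pole at R', so G divides w F in every local ring;
  \<open>reg_dvd_local\<close> makes this global.\<close>

lemma pole_division:
  assumes hom: "homogeneous k F" "homogeneous k G"
    and ord: "quotient_orders F G R R'" and W: "pole_factor R' w W wo"
  obtains m where "reg m" "\<And>v Y. onE v Y \<Longrightarrow> w v * eval_mpoly (apt v Y) F = eval_mpoly (apt v Y) G * m v Y"
proof (rule reg_dvd_local[of "\<lambda>v Y. w v * eval_mpoly (apt v Y) F" "\<lambda>v Y. eval_mpoly (apt v Y) G"])
  have "reg (\<lambda>v Y. w v)" using W by (auto simp: pole_factor_def intro: reg_const reg_add reg_v)
  then show "reg (\<lambda>v Y. w v * eval_mpoly (apt v Y) F)" by (intro reg_mult reg_eval reg_apt)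
  show "reg (\<lambda>v Y. eval_mpoly (apt v Y) G)" by (intro reg_eval reg_apt)
  fix v Y assume Y: "onE v Y"
  obtain a b where ab: "ordp (apt v Y) F a" "ordp (apt v Y) G b"
    "int a - int b = of_bool (A v Y = R) - of_bool (A v Y = R')"
    using ord Y unfolding quotient_orders_def by blast
  have wo: "wo v \<ge> 1" if R': "A v Y = R'"
    using W unfolding pole_factor_def
  proof (elim disjE exE conjE)
    assume "R' = Opoint" then show ?thesis using proj_apt_neq_O[of v Y] R' by blast
  next
    fix v' Y' assume "R' = A v' Y'" "wo = vval v'"
    moreover from this R' have "v = v'" using proj_apt_eq_iff[of v Y v' Y'] by blast
    ultimately show ?thesis by (simp add: vval_def)
  qed
  have "of_bool (A v Y = R) \<ge> (0::int)" by simp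
  moreover have "of_bool (A v Y = R') \<le> int (wo v)"
  proof (cases "A v Y = R'")
    case True
    then have "1 \<le> int (wo v)" using wo by linarith
    then show ?thesis by (simp add: True)
  qed simp
  ultimately have "b \<le> wo v + a" using ab(3) by linarith
  with ordp_mult[OF apt_in_C[OF Y] pole_factor_ordp[OF W Y] ab(1)] ab(2)
  obtain H M where HM: "H \<notin> vanishing_ideal (A v Y)" "H * (W * F) - G * M \<in> vanishing_ideal C"
    by (rule has_order_quotient[OF irred_point[of "apt v Y"]])
  obtain x where "x \<in> A v Y" "eval_mpoly x H \<noteq> 0" using HM(1) by (rule not_vanishing_idealE)
  then obtain u where u: "u \<noteq> 0" "eval_mpoly (\<lambda>i. u * apt v Y i) H \<noteq> 0"
    by (auto simp: mem_proj_pt)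
  show "\<exists>h m. reg h \<and> reg m \<and> h v Y \<noteq> 0 \<and>
    (\<forall>u Z. onE u Z \<longrightarrow> h u Z * (w u * eval_mpoly (apt u Z) F) = eval_mpoly (apt u Z) G * m u Z)"
  proof (intro exI conjI allI impI)
    let ?h = "\<lambda>v Y. eval_mpoly (\<lambda>i. u * apt v Y i) H"
    let ?m = "\<lambda>v Y. inverse (c * (c * u)) * eval_mpoly (\<lambda>i. u * apt v Y i) M"
    show "reg ?h" "reg ?m" by (intro reg_mult reg_const reg_scaled_apt)+
    show "?h v Y \<noteq> 0" by (rule u)
    fix v' Y' assume Y': "onE v' Y'"
    then have "(\<lambda>i. u * apt v' Y' i) \<in> C" using u by (intro C_scale apt_in_C)
    from vanishing_idealD[OF HM(2) this]
    have "u ^ k * (?h v' Y' * (c * (c * (u * w v')) * eval_mpoly (apt v' Y') F)) =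
        u ^ k * (eval_mpoly (apt v' Y') G * eval_mpoly (\<lambda>i. u * apt v' Y' i) M)"
      by (simp add: pole_factor_eval[OF W] eval_homogeneous_scale[OF hom(1)] eval_homogeneous_scale[OF hom(2)] mult_ac)
    then have "?h v' Y' * (c * (c * (u * w v')) * eval_mpoly (apt v' Y') F) = eval_mpoly (apt v' Y') G * eval_mpoly (\<lambda>i. u * apt v' Y' i) M"
      using u(1) by simp
    moreover have "?h v' Y' * (w v' * eval_mpoly (apt v' Y') F) =
        inverse (c * (c * u)) * (?h v' Y' * (c * (c * (u * w v')) * eval_mpoly (apt v' Y') F))"
    proof -
      have eq: "?h v' Y' * (c * (c * (u * w v')) * eval_mpoly (apt v' Y') F) = (c * (c * u)) * (?h v' Y' * (w v' * eval_mpoly (apt v' Y') F))"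
        by (simp only: mult_ac)
      have cancel: "inverse z * (z * r) = r" if "z \<noteq> 0" for z r :: 'a
        using that by (simp flip: mult.assoc)
      have "c * (c * u) \<noteq> 0" using u(1) c0 by simp
      then show ?thesis unfolding eq by (rule cancel[symmetric])
    qed
    ultimately show "?h v' Y' * (w v' * eval_mpoly (apt v' Y') F) = eval_mpoly (apt v' Y') G * ?m v' Y'"
      by (simp only: mult_ac)
  qed
qed (rule that)

text \<open>A function with a single simple pole does not exist: multiplying by the vertical line through
  the pole of \<open>F / G\<close>, respectively \<open>G / F\<close>, gives regular functions \<open>m\<close>, \<open>m'\<close> whose norms have
  degrees adding up to at most 4, so one of \<open>m\<close>, \<open>m'\<close> is linear in \<open>v\<close>.\<close>

lemma no_simple_pole:
  assumes hom: "homogeneous k F" "homogeneous k G" "F \<notin> vanishing_ideal C" "G \<notin> vanishing_ideal C"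
    and ord: "quotient_orders F G R R'" and R: "R \<in> mu4_curve c" "R' \<in> mu4_curve c"
  shows "R = R'"
proof (rule ccontr)
  assume neq: "R \<noteq> R'"
  obtain w W wo where W: "pole_factor R' w W wo" using pole_factor_exists R by blast
  obtain w' W' wo' where W': "pole_factor R w' W' wo'" using pole_factor_exists R by blast
  have ord': "quotient_orders G F R' R" unfolding quotient_orders_def
  proof (intro allI impI)
    fix v Y assume "onE v Y"
    then obtain a b where "ordp (apt v Y) F a" "ordp (apt v Y) G b"
      "int a - int b = of_bool (A v Y = R) - of_bool (A v Y = R')"
      using ord unfolding quotient_orders_def by blast
    then show "\<exists>a b. ordp (apt v Y) G a \<and> ordp (apt v Y) F b \<and> int a - int b = of_bool (A v Y = R') - of_bool (A v Y = R)"
      by (intro exI[of _ b] exI[of _ a]) auto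
  qed
  let ?f = "\<lambda>v Y. eval_mpoly (apt v Y) F" and ?g = "\<lambda>v Y. eval_mpoly (apt v Y) G"
  obtain m where m: "reg m" "\<And>v Y. onE v Y \<Longrightarrow> w v * ?f v Y = ?g v Y * m v Y"
    by (rule pole_division[OF hom(1,2) ord W]) blast
  obtain m' where m': "reg m'" "\<And>v Y. onE v Y \<Longrightarrow> w' v * ?g v Y = ?f v Y * m' v Y"
    by (rule pole_division[OF hom(2,1) ord' W']) blast
  have reg: "reg ?f" "reg ?g" by (intro reg_eval reg_apt)+
  have w: "regular 2 (\<lambda>v Y. w v) \<and> norm_of (\<lambda>v Y. w v) \<noteq> 0" if "pole_factor R w W wo" for R w W wo
  proof -
    have r: "regular 2 (\<lambda>v Y. w v)" using that by (auto simp: pole_factor_def intro: regular_const regular_add regular_v)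
    from that obtain v where "w v \<noteq> 0" unfolding pole_factor_def
    proof (elim disjE exE conjE)
      fix v' assume "w = (\<lambda>v. v + v')"
      then have "w (1 + v') \<noteq> 0" by (simp add: add.assoc add_self)
      then show thesis by (rule that)
    qed (simp add: that)
    then show ?thesis using r onE_exists[of v] norm_of_nonzero[of "\<lambda>v Y. w v" v] by (auto simp: reg_def)
  qed
  note rw = w[OF W] w[OF W']
  have n: "norm_of ?f \<noteq> 0" "norm_of ?g \<noteq> 0"
    using homogeneous_nonvanishing[OF hom(1,3)] homogeneous_nonvanishing[OF hom(2,4)] norm_of_nonzero reg by metis+
  have e1: "norm_of (\<lambda>v Y. w v) * norm_of ?f = norm_of ?g * norm_of m"
    using norm_of_cong[of "\<lambda>v Y. w v * ?f v Y" "\<lambda>v Y. ?g v Y * m v Y"] m(2) rw reg m(1)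
    by (subst (1 2) norm_of_mult[symmetric]) (auto simp: reg_def)
  have e2: "norm_of (\<lambda>v Y. w' v) * norm_of ?g = norm_of ?f * norm_of m'"
    using norm_of_cong[of "\<lambda>v Y. w' v * ?g v Y" "\<lambda>v Y. ?f v Y * m' v Y"] m'(2) rw reg m'(1)
    by (subst (1 2) norm_of_mult[symmetric]) (auto simp: reg_def)
  have "(norm_of ?f * norm_of ?g) * (norm_of m * norm_of m') = (norm_of ?g * norm_of m) * (norm_of ?f * norm_of m')"
    by (simp only: mult_ac)
  also have "\<dots> = (norm_of ?f * norm_of ?g) * (norm_of (\<lambda>v Y. w v) * norm_of (\<lambda>v Y. w' v))"
    unfolding e1[symmetric] e2[symmetric] by (simp only: mult_ac)
  finally have e: "norm_of m * norm_of m' = norm_of (\<lambda>v Y. w v) * norm_of (\<lambda>v Y. w' v)" using n by simp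
  have nm: "norm_of m \<noteq> 0" "norm_of m' \<noteq> 0" using e rw by auto
  have "degree (norm_of m) + degree (norm_of m') = degree (norm_of (\<lambda>v Y. w v)) + degree (norm_of (\<lambda>v Y. w' v))"
    using arg_cong[OF e, of degree] nm rw by (simp add: degree_mult_eq)
  also have "\<dots> \<le> 4" using degree_norm_of rw by (metis add_mono numeral_Bit0)
  finally consider "degree (norm_of m) \<le> 2" | "degree (norm_of m') \<le> 2" by linarith
  then show False
  proof cases
    case 1
    obtain \<alpha> \<beta> where "\<And>v Y. onE v Y \<Longrightarrow> m v Y = \<alpha> + \<beta> * v"
      by (rule norm_of_small_degree[OF m(1) nm(1) 1]) blast
    then show False using linear_quotient_impossible[OF hom(1,2) ord neq R W, of \<alpha> \<beta>] m(2) by simp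
  next
    case 2
    obtain \<alpha> \<beta> where "\<And>v Y. onE v Y \<Longrightarrow> m' v Y = \<alpha> + \<beta> * v"
      by (rule norm_of_small_degree[OF m'(1) nm(2) 2]) blast
    then show False using linear_quotient_impossible[OF hom(2,1) ord' neq[symmetric] R(2,1) W', of \<alpha> \<beta>] m'(2) by simp
  qed
qed

section \<open>Linear equivalence and sums of points\<close>

lemma lin_equivI:
  assumes "homogeneous k F" "homogeneous k G"
    and ord: "\<And>p. p \<in> C \<Longrightarrow> \<exists>a b. ordp p F a \<and> ordp p G b \<and> D1 (proj_pt p) - D2 (proj_pt p) = int a - int b"
  shows "lin_equiv c D1 D2"
  unfolding lin_equiv_def
proof (intro exI conjI ballI)
  show "homogeneous k F" "homogeneous k G" by fact+
  have "\<exists>a b. ordp (Opt 0) F a \<and> ordp (Opt 0) G b" using ord[OF Opt_in_C[of 0]] by blast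
  then show "F \<notin> vanishing_ideal C" "G \<notin> vanishing_ideal C"
    using has_order_nonvanishing[OF local_param_tp[OF Opt_in_C[of 0]]] by blast+
  fix S assume "S \<in> mu4_curve c"
  then obtain p where p: "p \<in> C" "S = proj_pt p" using curve_iff by blast
  obtain a b where "ordp p F a" "ordp p G b" "D1 (proj_pt p) - D2 (proj_pt p) = int a - int b"
    using ord[OF p(1)] by blast
  then show "D1 S - D2 S = int (the_enat (order_along C (cone {S}) F)) - int (the_enat (order_along C (cone {S}) G))"
    using p by (simp add: ordp_order_along)
qed

lemma lin_equivE:
  assumes "lin_equiv c D1 D2"
  obtains k F G where "homogeneous k F" "homogeneous k G" "F \<notin> vanishing_ideal C" "G \<notin> vanishing_ideal C"
    "\<And>v Y. onE v Y \<Longrightarrow> \<exists>a b. ordp (apt v Y) F a \<and> ordp (apt v Y) G b \<and> D1 (A v Y) - D2 (A v Y) = int a - int b"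
proof -
  obtain k F G where *: "homogeneous k F" "homogeneous k G" "F \<notin> vanishing_ideal C" "G \<notin> vanishing_ideal C"
    "\<And>S. S \<in> mu4_curve c \<Longrightarrow> D1 S - D2 S = int (the_enat (order_along C (cone {S}) F)) - int (the_enat (order_along C (cone {S}) G))"
    using assms unfolding lin_equiv_def by blast
  have "\<exists>a b. ordp (apt v Y) F a \<and> ordp (apt v Y) G b \<and> D1 (A v Y) - D2 (A v Y) = int a - int b" if Y: "onE v Y" for v Y
  proof -
    obtain a where a: "ordp (apt v Y) F a" using ordp_exists[OF *(1,3) Y] .
    obtain b where b: "ordp (apt v Y) G b" using ordp_exists[OF *(2,4) Y] .
    show ?thesis using *(5)[of "A v Y"] a b apt_in_C[OF Y] by (auto simp: ordp_order_along)
  qed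
  with * show ?thesis using that by blast
qed

text \<open>Two candidates R and R' come with two functions; their quotient has divisor R' - R on
  the chart, so \<open>no_simple_pole\<close> identifies them.\<close>

lemma ell_add_eqI:
  assumes R: "R \<in> mu4_curve c" and eq: "lin_equiv c (\<lambda>S. pt_div P S + pt_div Q S) (\<lambda>S. pt_div R S + pt_div Opoint S)"
  shows "ell_add c P Q = R"
  unfolding ell_add_def mu4_O_eq
proof (rule the_equality, intro conjI R eq)
  fix R' assume "R' \<in> mu4_curve c \<and> lin_equiv c (\<lambda>S. pt_div P S + pt_div Q S) (\<lambda>S. pt_div R' S + pt_div Opoint S)"
  then have R': "R' \<in> mu4_curve c" and eq': "lin_equiv c (\<lambda>S. pt_div P S + pt_div Q S) (\<lambda>S. pt_div R' S + pt_div Opoint S)" by auto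
  obtain k F G where 1: "homogeneous k F" "homogeneous k G" "F \<notin> vanishing_ideal C" "G \<notin> vanishing_ideal C"
    "\<And>v Y. onE v Y \<Longrightarrow> \<exists>a b. ordp (apt v Y) F a \<and> ordp (apt v Y) G b \<and>
      (pt_div P (A v Y) + pt_div Q (A v Y)) - (pt_div R (A v Y) + pt_div Opoint (A v Y)) = int a - int b"
    by (rule lin_equivE[OF eq]) blast
  obtain k' F' G' where 2: "homogeneous k' F'" "homogeneous k' G'" "F' \<notin> vanishing_ideal C" "G' \<notin> vanishing_ideal C"
    "\<And>v Y. onE v Y \<Longrightarrow> \<exists>a b. ordp (apt v Y) F' a \<and> ordp (apt v Y) G' b \<and>
      (pt_div P (A v Y) + pt_div Q (A v Y)) - (pt_div R' (A v Y) + pt_div Opoint (A v Y)) = int a - int b"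
    by (rule lin_equivE[OF eq']) blast
  have "quotient_orders (F * G') (G * F') R' R" unfolding quotient_orders_def
  proof (intro allI impI)
    fix v Y assume Y: "onE v Y"
    obtain a b where ab: "ordp (apt v Y) F a" "ordp (apt v Y) G b"
      "(pt_div P (A v Y) + pt_div Q (A v Y)) - (pt_div R (A v Y) + pt_div Opoint (A v Y)) = int a - int b"
      using 1(5)[OF Y] by blast
    obtain a' b' where ab': "ordp (apt v Y) F' a'" "ordp (apt v Y) G' b'"
      "(pt_div P (A v Y) + pt_div Q (A v Y)) - (pt_div R' (A v Y) + pt_div Opoint (A v Y)) = int a' - int b'"
      using 2(5)[OF Y] by blast
    show "\<exists>x y. ordp (apt v Y) (F * G') x \<and> ordp (apt v Y) (G * F') y \<and>
        int x - int y = of_bool (A v Y = R') - of_bool (A v Y = R)"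
      using ordp_mult[OF apt_in_C[OF Y] ab(1) ab'(2)] ordp_mult[OF apt_in_C[OF Y] ab(2) ab'(1)] ab(3) ab'(3)
      by (intro exI[of _ "a + b'"] exI[of _ "b + a'"]) (simp add: pt_div_of_bool)
  qed
  moreover have "homogeneous (k + k') (F * G')" "homogeneous (k + k') (G * F')"
    using 1 2 by (auto intro: homogeneous_mult)
  moreover have "F * G' \<notin> vanishing_ideal C" "G * F' \<notin> vanishing_ideal C"
    by (rule irred_set_mult[OF irred_C 1(3) 2(4)], rule irred_set_mult[OF irred_C 1(4) 2(3)])
  ultimately show "R' = R" using no_simple_pole R R' by blast
qed

lemma add_O_left: "Q \<in> mu4_curve c \<Longrightarrow> ell_add c Opoint Q = Q"
  by (rule ell_add_eqI, assumption, rule lin_equivI[of 0 1 1])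
     (use homogeneous_Const[of 1] ordp_one in \<open>auto simp: Const_def intro!: exI[of _ 0]\<close>)

lemma add_O_right: "P \<in> mu4_curve c \<Longrightarrow> ell_add c P Opoint = P"
  by (rule ell_add_eqI, assumption, rule lin_equivI[of 0 1 1])
     (use homogeneous_Const[of 1] ordp_one in \<open>auto simp: Const_def intro!: exI[of _ 0]\<close>)

text \<open>The vertical line contributes 2 O and X2 contributes 4 O, so their quotient has divisor
  P + P' - 2 O.\<close>

lemma add_conj:
  assumes Y: "onE v Y" shows "ell_add c (A v Y) (A v (Y + c * (c * v))) = Opoint"
proof (rule ell_add_eqI)
  show "Opoint \<in> mu4_curve c" using Opt_in_C by simp
  show "lin_equiv c (\<lambda>S. pt_div (A v Y) S + pt_div (A v (Y + c * (c * v))) S) (\<lambda>S. pt_div Opoint S + pt_div Opoint S)"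
  proof (rule lin_equivI[OF homogeneous_lines(2)[of v] homogeneous_lines(1)[of 2]])
    fix p assume "p \<in> C"
    then show "\<exists>a b. ordp p (vline v) a \<and> ordp p (Var 2) b \<and>
        (pt_div (A v Y) (proj_pt p) + pt_div (A v (Y + c * (c * v))) (proj_pt p)) -
        (pt_div Opoint (proj_pt p) + pt_div Opoint (proj_pt p)) = int a - int b"
    proof (cases rule: C_cases)
      case (infinite u)
      have "pt_div (A v Y) Opoint + pt_div (A v (Y + c * (c * v))) Opoint - (pt_div Opoint Opoint + pt_div Opoint Opoint) = int 2 - int 4"
        by (simp add: pt_div_of_bool proj_apt_neq_O[symmetric])
      then show ?thesis
        using ordp_vline_O[OF infinite(1), of v] ordp_X2_O[OF infinite(1)]
        unfolding infinite(2) proj_pt_scale[OF infinite(1)] by blast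
    next
      case (affine u v' Y')
      have "of_bool (v' = v \<and> Y' = Y) + of_bool (v' = v \<and> Y' = Y + c * (c * v)) =
          int (if v' = v then if v' = 0 then 2 else 1 else 0)"
        using onE_two[OF Y, of Y'] affine(2) c0 by auto
      then have "pt_div (A v Y) (A v' Y') + pt_div (A v (Y + c * (c * v))) (A v' Y') -
          (pt_div Opoint (A v' Y') + pt_div Opoint (A v' Y')) = int (if v' = v then if v' = 0 then 2 else 1 else 0) - int 0"
        by (simp add: pt_div_of_bool proj_apt_eq_iff proj_apt_neq_O)
      then show ?thesis
        using ordp_vline_apt[OF affine(1,2), of v] ordp_X2_apt[OF affine(1,2)]
        unfolding affine(3) proj_pt_scale[OF affine(1)] by blast
    qed
  qed
qed

text \<open>The line has divisor P1 + P2 + P3 + O, the vertical line through P3 has P3 + P3' + 2 O;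
  the quotient exhibits the conjugate P3' as the sum.\<close>

lemma add_line:
  assumes s: "v1 + v2 + v3 = l^2 + c * l" "v1 * v2 + v1 * v3 + v2 * v3 = m" "c^2 * (v1 * v2 * v3) = m^2 + 1"
    and Y1: "onE v1 (c * l * v1 + m)" and Y2: "onE v2 (c * l * v2 + m)" and Y3: "onE v3 (c * l * v3 + m)"
  shows "ell_add c (A v1 (c * l * v1 + m)) (A v2 (c * l * v2 + m)) = A v3 (c * l * v3 + m + c * (c * v3))" (is "ell_add c ?P ?Q = ?R")
proof (rule ell_add_eqI)
  show "?R \<in> mu4_curve c" using apt_in_C[OF onE_conj[OF Y3]] by simp
  show "lin_equiv c (\<lambda>S. pt_div ?P S + pt_div ?Q S) (\<lambda>S. pt_div ?R S + pt_div Opoint S)"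
  proof (rule lin_equivI[OF homogeneous_lines(3)[of l m] homogeneous_lines(2)[of v3]])
    fix p assume "p \<in> C"
    then show "\<exists>a b. ordp p (sline l m) a \<and> ordp p (vline v3) b \<and>
        (pt_div ?P (proj_pt p) + pt_div ?Q (proj_pt p)) - (pt_div ?R (proj_pt p) + pt_div Opoint (proj_pt p)) = int a - int b"
    proof (cases rule: C_cases)
      case (infinite u)
      have "pt_div ?P Opoint + pt_div ?Q Opoint - (pt_div ?R Opoint + pt_div Opoint Opoint) = int 1 - int 2"
        by (simp add: pt_div_of_bool proj_apt_neq_O[symmetric])
      then show ?thesis
        using ordp_vline_O[OF infinite(1), of v3] ordp_sline_O[OF infinite(1), of l m]
        unfolding infinite(2) proj_pt_scale[OF infinite(1)] by blast
    next
      case (affine u v Y)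
      let ?a = "if Y = c * l * v + m then of_bool (v = v1) + of_bool (v = v2) + of_bool (v = v3) else 0 :: nat"
      let ?b = "if v = v3 then if v = 0 then 2 else 1 else 0 :: nat"
      have 1: "of_bool (v = v1 \<and> Y = c * l * v1 + m) = (if Y = c * l * v + m then of_bool (v = v1) else 0 :: int)"
        "of_bool (v = v2 \<and> Y = c * l * v2 + m) = (if Y = c * l * v + m then of_bool (v = v2) else 0 :: int)" by auto
      have 3: "(if Y = c * l * v + m then of_bool (v = v3) else 0) - int ?b = - of_bool (v = v3 \<and> Y = c * l * v3 + m + c * (c * v3))"
        using onE_two[OF Y3, of Y] affine(2) c0 by auto
      have "(pt_div ?P (A v Y) + pt_div ?Q (A v Y)) - (pt_div ?R (A v Y) + pt_div Opoint (A v Y)) =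
          of_bool (v = v1 \<and> Y = c * l * v1 + m) + of_bool (v = v2 \<and> Y = c * l * v2 + m)
          - of_bool (v = v3 \<and> Y = c * l * v3 + m + c * (c * v3))"
        using proj_apt_neq_O[of v Y] by (simp add: pt_div_of_bool proj_apt_eq_iff)
      also have "\<dots> = int ?a - int ?b"
      proof -
        have "int ?a = (if Y = c * l * v + m then of_bool (v = v1) else 0) + (if Y = c * l * v + m then of_bool (v = v2) else 0)
            + (if Y = c * l * v + m then of_bool (v = v3) else 0)" by simp
        then show ?thesis unfolding 1 using 3 by linarith
      qed
      finally show ?thesis
        using ordp_vline_apt[OF affine(1,2), of v3] ordp_sline_apt[OF affine(1,2) s]
        unfolding affine(3) proj_pt_scale[OF affine(1)] by blast
    qed
  qed
qed

section \<open>The values of the addition laws\<close>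

definition lv :: "4 \<Rightarrow> (4 \<Rightarrow> 'a) \<Rightarrow> (4 \<Rightarrow> 'a) \<Rightarrow> 4 \<Rightarrow> 'a" where
  "lv j x y i = eval_mpoly (case_sum x y) (mu4_laws c j i)"

lemma lv_simps:
  "lv 0 x y 0 = (x 0 * y 0 + x 2 * y 2)^2"
  "lv 0 x y 1 = c * (x 0 * x 1 * y 0 * y 1 + x 2 * x 3 * y 2 * y 3)"
  "lv 0 x y 2 = (x 1 * y 1 + x 3 * y 3)^2"
  "lv 0 x y 3 = c * (x 0 * x 3 * y 0 * y 3 + x 1 * x 2 * y 1 * y 2)"
  "lv 1 x y 0 = c * (x 0 * x 1 * y 0 * y 3 + x 2 * x 3 * y 1 * y 2)"
  "lv 1 x y 1 = (x 1 * y 0 + x 3 * y 2)^2"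
  "lv 1 x y 2 = c * (x 0 * x 3 * y 2 * y 3 + x 1 * x 2 * y 0 * y 1)"
  "lv 1 x y 3 = (x 0 * y 3 + x 2 * y 1)^2"
  "lv 2 x y 0 = (x 3 * y 1 + x 1 * y 3)^2"
  "lv 2 x y 1 = c * (x 0 * x 3 * y 1 * y 2 + x 1 * x 2 * y 0 * y 3)"
  "lv 2 x y 2 = (x 0 * y 2 + x 2 * y 0)^2"
  "lv 2 x y 3 = c * (x 0 * x 1 * y 2 * y 3 + x 2 * x 3 * y 0 * y 1)"
  "lv 3 x y 0 = c * (x 0 * x 3 * y 0 * y 1 + x 1 * x 2 * y 2 * y 3)"
  "lv 3 x y 1 = (x 0 * y 1 + x 2 * y 3)^2"
  "lv 3 x y 2 = c * (x 0 * x 1 * y 1 * y 2 + x 2 * x 3 * y 0 * y 3)"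
  "lv 3 x y 3 = (x 1 * y 2 + x 3 * y 0)^2"
  by (simp_all add: lv_def mu4_laws_def mu4_law0_def mu4_law1_def mu4_law2_def mu4_law3_def)

text \<open>Reflects (P + T) + Q = (P + Q) + T, with T acting by a shift. Identities for all four
  laws reduce to law 2.\<close>

lemma lv_normal: "lv j x y i = lv 2 (\<lambda>k. x (k + (j - 2))) y (i - (j - 2))"
  using exhaust_4[of j] exhaust_4[of i]
  by (elim disjE; simp add: lv_simps; simp add: ac_simps)

lemma lv_shift: "lv j (\<lambda>k. x (k - n)) y i = lv (j - n) x y (i - n)"
proof -
  have "lv j (\<lambda>k. x (k - n)) y i = lv 2 (\<lambda>k. x (k + (j - 2) - n)) y (i - (j - 2))"
    by (rule lv_normal)
  also have "\<dots> = lv 2 (\<lambda>k. x (k + (j - n - 2))) y (i - n - (j - n - 2))"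
    by (simp add: algebra_simps)
  also have "\<dots> = lv (j - n) x y (i - n)" by (rule lv_normal[symmetric])
  finally show ?thesis .
qed

lemma lv_scale: "lv j (\<lambda>k. a * x k) (\<lambda>k. b * y k) i = a^2 * b^2 * lv j x y i"
  using exhaust_4[of j] exhaust_4[of i]
  by (elim disjE; simp only: lv_simps; simp only: ring2)

text \<open>The coprime leading monomials X2^2 and X3^2 make the two equations a Groebner basis, so
  with \<open>ring2\<close> this rewriting gives normal forms modulo them. The last two rules treat
  nested products.\<close>

lemma C_squares:
  assumes "x \<in> C"
  shows "x 2 * x 2 = x 0 * x 0 + c * (c * (x 1 * x 3))" "x 3 * x 3 = x 1 * x 1 + c * (c * (x 0 * x 2))"
    "x 2 * (x 2 * z) = (x 0 * x 0 + c * (c * (x 1 * x 3))) * z" "x 3 * (x 3 * z) = (x 1 * x 1 + c * (c * (x 0 * x 2))) * z"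
proof -
  have e: "(x 0 + x 2)^2 = c^2 * x 1 * x 3" "(x 1 + x 3)^2 = c^2 * x 0 * x 2" using assms by (auto simp: mem_C)
  have "x 2 * x 2 = x 0 * x 0 + (x 0 + x 2)^2" "x 3 * x 3 = x 1 * x 1 + (x 1 + x 3)^2" by (simp_all only: ring2)
  then show 2: "x 2 * x 2 = x 0 * x 0 + c * (c * (x 1 * x 3))" and 3: "x 3 * x 3 = x 1 * x 1 + c * (c * (x 0 * x 2))"
    unfolding e by (simp_all add: power2_eq_square mult.assoc)
  show "x 2 * (x 2 * z) = (x 0 * x 0 + c * (c * (x 1 * x 3))) * z" "x 3 * (x 3 * z) = (x 1 * x 1 + c * (c * (x 0 * x 2))) * z"
    using 2 3 by (simp_all flip: mult.assoc)
qed

lemma lv_minor_aux: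
  assumes "x \<in> C" "y \<in> C"
  shows "lv 2 x y 0 * lv k x y 1 = lv 2 x y 1 * lv k x y 0"
    "lv 2 x y 0 * lv k x y 2 = lv 2 x y 2 * lv k x y 0"
    "lv 2 x y 0 * lv k x y 3 = lv 2 x y 3 * lv k x y 0"
    "lv 2 x y 1 * lv k x y 2 = lv 2 x y 2 * lv k x y 1"
    "lv 2 x y 1 * lv k x y 3 = lv 2 x y 3 * lv k x y 1"
    "lv 2 x y 2 * lv k x y 3 = lv 2 x y 3 * lv k x y 2"
  using exhaust_4[of k]
  by (elim disjE; simp only: lv_simps; simp only: ring2 C_squares[OF assms(1)] C_squares[OF assms(2)])+

lemma lv_minor:
  assumes "x \<in> C" "y \<in> C"
  shows "lv j x y a * lv k x y b = lv j x y b * lv k x y a"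
proof -
  have *: "lv 2 x y a * lv k x y b = lv 2 x y b * lv k x y a" if "x \<in> C" for x k a b
    using exhaust_4[of a] exhaust_4[of b] lv_minor_aux[OF that assms(2), of k]
    by (elim disjE) (simp_all only: mult.commute)
  define n where "n = j - 2"
  define x' where "x' = (\<lambda>k. x (k + n))"
  have x': "x' \<in> C" unfolding x'_def using C_shift[OF assms(1), of "- n"] by simp
  have "lv j' x y i = lv (j' - n) x' y (i - n)" for j' i
    using lv_shift[of j' x' n y i] by (simp add: x'_def)
  then show ?thesis using *[OF x', of "a - n" "k - n" "b - n"] by (simp add: n_def)
qed

text \<open>Some coordinate of y is nonzero, so some law is nonzero at (O, y), with value
  proportional to y.\<close>

lemma lv_O_left: "y \<in> C \<Longrightarrow> lv j (Opt 0) y i = c^2 * y (- j) * y i"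
  using exhaust_4[of j] exhaust_4[of i] curve_eq[of y 0] curve_eq[of y 1]
  by (elim disjE) (simp_all add: lv_simps Opt_def power_mult_distrib power2_eq_square mult_ac add.commute)

lemma lv_O_right: "x \<in> C \<Longrightarrow> lv j x (Opt 0) i = c^2 * x j * x i"
  using exhaust_4[of j] exhaust_4[of i] curve_eq[of x 0] curve_eq[of x 1]
  by (elim disjE) (simp_all add: lv_simps Opt_def power_mult_distrib power2_eq_square mult_ac add.commute)

section \<open>Chords, tangents and opposite points\<close>

lemma line_third_point:
  assumes s: "v1 + v2 + v3 = l^2 + c * l" "v1 * v2 + v1 * v3 + v2 * v3 = m" "c^2 * (v1 * v2 * v3) = m^2 + 1"
  shows "onE v3 (c * l * v3 + m)"
proof -
  have "(c * l * v3 + m) * (c * l * v3 + m) + (c * (c * (v3 * (c * l * v3 + m))) + c * (c * (v3 * (v3 * v3))) + 1)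
     = c^2 * v3^3 + c^2 * v3^2 * (l^2 + c * l) + c^2 * v3 * m + (m^2 + 1)" by (simp only: ring2)
  \<comment> \<open>The right-hand side is c^2 (v3 + v1) (v3 + v2) (v3 + v3).\<close>
  also have "\<dots> = c^2 * v3^3 + c^2 * v3^2 * (v1 + v2 + v3) + c^2 * v3 * (v1 * v2 + v1 * v3 + v2 * v3) + c^2 * (v1 * v2 * v3)"
    by (simp only: s)
  also have "\<dots> = 0" by (simp only: ring2)
  finally show ?thesis unfolding onE_def by (simp only: add_eq_0)
qed

text \<open>The chord through the two points. Its third intersection is conjugate to the sum, and
  law 2 is nonzero because the v-coordinates differ.\<close>

lemma add_distinct:
  assumes Y1: "onE v1 Y1" and Y2: "onE v2 Y2" and neq: "v1 \<noteq> v2"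
  shows "\<exists>z\<in>C. \<exists>k. k \<noteq> 0 \<and> ell_add c (A v1 Y1) (A v2 Y2) = proj_pt z \<and> (\<forall>i. lv 2 (apt v1 Y1) (apt v2 Y2) i = k * z i)"
proof -
  define D where "D = v1 + v2"
  define l where "l = (Y1 + Y2) / (c * D)"
  have D: "D \<noteq> 0" using neq by (simp add: D_def add_eq_0)
  have v2: "v2 = v1 + D" by (simp add: D_def add_self_left)
  have "Y1 + Y2 = c * l * D" using D c0 by (simp add: l_def)
  then have "Y1 + (Y1 + Y2) = Y1 + c * l * D" by simp
  then have Y2': "Y2 = Y1 + c * l * D" by (simp only: add_self_left)
  \<comment> \<open>The sum of the two curve equations is divisible by c^2 D and can be solved for
    Y1; all quantities become polynomials in v1, D and l.\<close>
  have "(c * c * D) * (Y1 + (l^2 * D + c * l * v1 + c * l * D + v1^2 + v1 * D + D^2)) =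
      (Y1 * Y1 + (c * (c * (v1 * Y1)) + c * (c * (v1 * (v1 * v1))) + 1)) +
      (Y2 * Y2 + (c * (c * (v2 * Y2)) + c * (c * (v2 * (v2 * v2))) + 1))"
    unfolding v2 Y2' by (simp only: ring2)
  also have "\<dots> = 0" using Y1 Y2 unfolding onE_def by (simp only: add_self)
  finally have lin: "Y1 = l^2 * D + c * l * v1 + c * l * D + v1^2 + v1 * D + D^2"
    using D c0 by (simp only: mult_eq_0_iff add_eq_0) simp
  define v3 where "v3 = l^2 + c * l + D"
  define m where "m = Y1 + c * l * v1"
  have s1: "v1 + v2 + v3 = l^2 + c * l" unfolding v3_def v2 by (simp only: ring2)
  have s2: "v1 * v2 + v1 * v3 + v2 * v3 = m" unfolding v3_def v2 m_def lin by (simp only: ring2)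
  have "c^2 * (v1 * v2 * v3) + (m^2 + 1) = Y1 * Y1 + (c * (c * (v1 * Y1)) + c * (c * (v1 * (v1 * v1))) + 1)
      + c * c * v1 * (Y1 + (l^2 * D + c * l * v1 + c * l * D + v1^2 + v1 * D + D^2))"
    unfolding v3_def v2 m_def by (simp only: ring2)
  also have "\<dots> = 0" using Y1 unfolding onE_def lin[symmetric] by (simp only: add_self mult_zero_right add_0_right)
  finally have s3: "c^2 * (v1 * v2 * v3) = m^2 + 1" by (simp only: add_eq_0)
  have L: "Y1 = c * l * v1 + m" "Y2 = c * l * v2 + m" unfolding m_def Y2' v2 by (simp_all only: ring2)
  have Y3: "onE v3 (c * l * v3 + m)" by (rule line_third_point[OF s1 s2 s3])
  let ?z = "apt v3 (c * l * v3 + m + c * (c * v3))"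
  have "ell_add c (A v1 Y1) (A v2 Y2) = proj_pt ?z"
    using add_line[OF s1 s2 s3 _ _ Y3] Y1 Y2 L by simp
  \<comment> \<open>The factor is read off from entry 2, where the law gives (c^2 D^2)^2 and z has
    coordinate c.\<close>
  moreover have "lv 2 (apt v1 Y1) (apt v2 Y2) i = (c * c * c * D * D * D * D) * ?z i" for i
    using exhaust_4[of i]
  proof (elim disjE)
    assume "i = 0" then show ?thesis unfolding Y2' v2 m_def v3_def by (simp only: lv_simps apt_simps) (unfold lin, simp only: ring2)
  next
    assume "i = 1" then show ?thesis unfolding Y2' v2 m_def v3_def by (simp only: lv_simps apt_simps) (unfold lin, simp only: ring2)
  next
    assume "i = 2" then show ?thesis unfolding Y2' v2 m_def v3_def by (simp only: lv_simps apt_simps) (simp only: ring2)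
  next
    assume "i = 3" then show ?thesis unfolding Y2' v2 m_def v3_def by (simp only: lv_simps apt_simps) (unfold lin, simp only: ring2)
  qed
  moreover have "?z \<in> C" by (intro apt_in_C onE_conj Y3)
  moreover have "c * c * c * D * D * D * D \<noteq> 0" using D c0 by simp
  ultimately show ?thesis by blast
qed

text \<open>The tangent. Law 2 vanishes on the diagonal, so law 0 is used; its entry 2 is (c^2 v)^4.
  The point over v = 0 is its own conjugate and falls under \<open>add_conj\<close>.\<close>

lemma add_double:
  assumes Y: "onE v Y" and v: "v \<noteq> 0"
  shows "\<exists>z\<in>C. \<exists>k. k \<noteq> 0 \<and> ell_add c (A v Y) (A v Y) = proj_pt z \<and> (\<forall>i. lv 0 (apt v Y) (apt v Y) i = k * z i)"
proof -
  \<comment> \<open>With v1 = v2 = v the second symmetric function is v^2, which forces m; incidence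
    with the point then gives l.\<close>
  define l where "l = (Y + v * v) / (c * v)"
  define v3 where "v3 = l^2 + c * l"
  define m where "m = v * v"
  have Yl: "Y = c * l * v + m"
  proof -
    have "c * l * v = Y + v * v" using v c0 by (simp add: l_def)
    then show ?thesis unfolding m_def by (simp add: add.assoc add_self)
  qed
  have s1: "v + v + v3 = l^2 + c * l" unfolding v3_def by (simp only: ring2)
  have s2: "v * v + v * v3 + v * v3 = m" unfolding m_def by (simp only: ring2)
  have "c^2 * (v * v * v3) + (m^2 + 1) = Y * Y + (c * (c * (v * Y)) + c * (c * (v * (v * v))) + 1)"
    unfolding v3_def m_def Yl by (simp only: ring2)
  also have "\<dots> = 0" using Y unfolding onE_def by (simp only: add_self)
  finally have s3: "c^2 * (v * v * v3) = m^2 + 1" by (simp only: add_eq_0)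
  have Y3: "onE v3 (c * l * v3 + m)" by (rule line_third_point[OF s1 s2 s3])
  let ?z = "apt v3 (c * l * v3 + m + c * (c * v3))"
  let ?k = "c * c * c * c * c * c * c * (v * v * v * v)"
  have "ell_add c (A v Y) (A v Y) = proj_pt ?z"
    using add_line[OF s1 s2 s3 _ _ Y3] Y Yl by simp
  moreover have "lv 0 (apt v Y) (apt v Y) i = ?k * ?z i" for i
  proof -
    \<comment> \<open>The curve equation in v and l, read as a rule for replacing v^4.\<close>
    have "v * (v * (v * v)) = c^2 * (v * v * v3) + 1"
      unfolding s3 m_def by (simp only: ring2)
    then have S: "v * (v * (v * v)) = c * (c * (v * (v * (l * l)))) + c * (c * (c * (l * (v * v)))) + 1"
      unfolding v3_def by (simp only: ring2)
    have S': "v * (v * (v * (v * z))) = (c * (c * (v * (v * (l * l)))) + c * (c * (c * (l * (v * v)))) + 1) * z" for z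
      using S by (simp flip: mult.assoc)
    show ?thesis
      using exhaust_4[of i]
      by (elim disjE; simp only: lv_simps apt_simps Yl v3_def m_def; simp only: ring2 S S')
  qed
  moreover have "?z \<in> C" by (intro apt_in_C onE_conj Y3)
  moreover have "?k \<noteq> 0" using v c0 by simp
  ultimately show ?thesis by blast
qed

text \<open>Negating the index exchanges X1 and X3 and gives the opposite point. The two scalars
  have no common zero on the curve.\<close>

lemma lv_conj:
  assumes "x \<in> C"
  shows "c * lv 0 x (\<lambda>k. x (- k)) i = (x 0 + x 2)^4 * Opt 0 i"
    "lv 1 x (\<lambda>k. x (- k)) i = (x 0 * x 1 + x 2 * x 3)^2 * Opt 0 i"
  using exhaust_4[of i]
  by (elim disjE; simp add: lv_simps Opt_def; simp only: ring2 C_squares[OF assms])+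

lemma apt_conj: "(\<lambda>k. apt v Y (- k)) = apt v (Y + c * (c * v))"
proof (rule fun_4_eqI)
  show "apt v Y (- 1) = apt v (Y + c * (c * v)) 1" "apt v Y (- 3) = apt v (Y + c * (c * v)) 3"
    unfolding index_4_simps apt_simps by (simp_all only: ring2)
qed simp_all

lemma add_affine_conj:
  assumes Y: "onE v Y"
  shows "\<exists>z\<in>C. \<exists>j k. k \<noteq> 0 \<and> ell_add c (A v Y) (A v (Y + c * (c * v))) = proj_pt z \<and>
    (\<forall>i. lv j (apt v Y) (apt v (Y + c * (c * v))) i = k * z i)"
proof -
  let ?x = "apt v Y"
  have x: "?x \<in> C" using Y by (rule apt_in_C)
  have "\<exists>j k. k \<noteq> 0 \<and> (\<forall>i. lv j ?x (apt v (Y + c * (c * v))) i = k * Opt 0 i)"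
  proof (cases "?x 0 + ?x 2 = 0")
    case False
    have "lv 0 ?x (apt v (Y + c * (c * v))) i = ((?x 0 + ?x 2)^4 / c) * Opt 0 i" for i
      using lv_conj(1)[OF x, of i] c0 unfolding apt_conj by (simp add: field_simps)
    moreover have "(?x 0 + ?x 2)^4 / c \<noteq> 0" using False c0 by simp
    ultimately show ?thesis by blast
  next
    case True
    have "(?x 0 * ?x 1 + ?x 2 * ?x 3)^2 \<noteq> 0"
    proof -
      have 2: "?x 0 = ?x 2" using True by (simp only: add_eq_0)
      have "?x 0 * ?x 1 + ?x 2 * ?x 3 = ?x 2 * (?x 1 + ?x 3)" unfolding 2 by (simp only: distrib_left)
      moreover have "(?x 1 + ?x 3)^2 = c^2 * ?x 2 * ?x 2" using curve_eq1[OF x] unfolding 2 .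
      ultimately show ?thesis using c0 by (auto simp del: apt_simps) (simp_all add: apt_simps)
    qed
    then show ?thesis using lv_conj(2)[OF x] unfolding apt_conj by blast
  qed
  then show ?thesis using add_conj[OF Y] Opt_in_C by blast
qed

lemma add_affine:
  assumes Y: "onE v Y" and Y': "onE v' Y'"
  shows "\<exists>z\<in>C. \<exists>j k. k \<noteq> 0 \<and> ell_add c (A v Y) (A v' Y') = proj_pt z \<and>
    (\<forall>i. lv j (apt v Y) (apt v' Y') i = k * z i)"
proof (cases "v = v'")
  case False
  then show ?thesis using add_distinct[OF Y Y' False] by blast
next
  case True
  show ?thesis
  proof (cases "Y' = Y + c * (c * v)")
    case conj: True
    then show ?thesis using add_affine_conj[OF Y] True by blast
  next
    case False
    then have "Y' = Y" using onE_two[OF Y] Y' True by blast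
    moreover from this False have "v \<noteq> 0" by auto
    ultimately show ?thesis using add_double[OF Y] True by blast
  qed
qed

lemma some_law:
  assumes x: "x \<in> C" and y: "y \<in> C"
  shows "\<exists>z\<in>C. \<exists>j k. k \<noteq> 0 \<and> ell_add c (proj_pt x) (proj_pt y) = proj_pt z \<and> (\<forall>i. lv j x y i = k * z i)"
  using x
proof (cases rule: C_cases)
  case (infinite u)
  obtain i where i: "y i \<noteq> 0" using C_nonzero[OF y] by blast
  have "lv (- i) x y k = (u^2 * c^2 * y i) * y k" for k
    using lv_scale[of "- i" u "Opt 0" 1 y k] lv_O_left[OF y, of "- i" k] unfolding infinite(2) by (simp add: mult.assoc)
  moreover have "u^2 * c^2 * y i \<noteq> 0" using infinite i c0 by simp
  moreover have "ell_add c (proj_pt x) (proj_pt y) = proj_pt y"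
    unfolding infinite(2) proj_pt_scale[OF infinite(1)] using y by (intro add_O_left) simp
  ultimately show ?thesis using y by blast
next
  case X: (affine u v Y)
  from y show ?thesis
  proof (cases rule: C_cases)
    case (infinite w)
    obtain i where i: "x i \<noteq> 0" using C_nonzero[OF x] by blast
    have "lv i x y k = (w^2 * c^2 * x i) * x k" for k
      using lv_scale[of i 1 x w "Opt 0" k] lv_O_right[OF x, of i k] unfolding infinite(2) by (simp add: mult.assoc)
    moreover have "w^2 * c^2 * x i \<noteq> 0" using infinite i c0 by simp
    moreover have "ell_add c (proj_pt x) (proj_pt y) = proj_pt x"
      unfolding infinite(2) proj_pt_scale[OF infinite(1)] using x by (intro add_O_right) simp
    ultimately show ?thesis using x by blast
  next
    case Z: (affine w v' Y')
    obtain z j k where z: "z \<in> C" "k \<noteq> 0" "ell_add c (A v Y) (A v' Y') = proj_pt z"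
      "\<And>i. lv j (apt v Y) (apt v' Y') i = k * z i"
      using add_affine[OF X(2) Z(2)] by blast
    have "lv j x y i = (u^2 * w^2 * k) * z i" for i
      unfolding X(3) Z(3) lv_scale z(4) by (simp only: mult.assoc)
    moreover have "u^2 * w^2 * k \<noteq> 0" using X(1) Z(1) z(2) by simp
    ultimately show ?thesis using z(1,3) unfolding X(3) Z(3) proj_pt_scale[OF X(1)] proj_pt_scale[OF Z(1)] by blast
  qed
qed

text \<open>\<open>lv_minor\<close> makes every law proportional to the one that is nonzero at this
  pair; the factors are collected in \<open>\<mu>\<close>, and some of them may be 0.\<close>

lemma all_laws:
  assumes x: "x \<in> C" and y: "y \<in> C"
  obtains z \<mu> where "z \<in> C" "ell_add c (proj_pt x) (proj_pt y) = proj_pt z" "\<And>j i. lv j x y i = \<mu> j * z i" "\<exists>j. \<mu> j \<noteq> 0"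
proof -
  obtain z j k where z: "z \<in> C" "k \<noteq> 0" "ell_add c (proj_pt x) (proj_pt y) = proj_pt z"
      "\<And>i. lv j x y i = k * z i"
    using some_law[OF x y] by blast
  obtain b where b: "z b \<noteq> 0" using C_nonzero[OF z(1)] by blast
  have "lv j' x y a = (lv j' x y b / z b) * z a" for j' a
    using lv_minor[OF x y, of j' a j b] z(2) b unfolding z(4) by (simp add: field_simps)
  moreover have "lv j x y b / z b \<noteq> 0" using z(2,4) b by simp
  ultimately show ?thesis using that[of z "\<lambda>j'. lv j' x y b / z b"] z(1,3) by blast
qed

lemma Opt_shift: "Opt n = (\<lambda>k. Opt 0 (k - n))"
  by (rule ext) (simp add: Opt_def)

lemma lv_Opt: "y \<in> C \<Longrightarrow> lv j (Opt n) y i = c^2 * y (n - j) * y (i - n)"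
  using lv_O_left[of y "j - n" "i - n"] unfolding Opt_shift[of n] lv_shift by simp

text \<open>Law n - j at (n T, y) is the shifted y scaled by c^2 y_j; j is chosen with y_j
  nonzero.\<close>

lemma add_Opt:
  assumes y: "y \<in> C" shows "ell_add c (proj_pt (Opt n)) (proj_pt y) = proj_pt (\<lambda>i. y (i - n))"
proof -
  obtain z \<mu> where z: "z \<in> C" "ell_add c (proj_pt (Opt n)) (proj_pt y) = proj_pt z"
    "\<And>j i. lv j (Opt n) y i = \<mu> j * z i" by (rule all_laws[OF Opt_in_C y]) blast
  obtain j where j: "y j \<noteq> 0" using C_nonzero[OF y] by blast
  have eq: "c^2 * y j * y (i - n) = \<mu> (n - j) * z i" for i
    using z(3)[of "n - j" i] lv_Opt[OF y, of "n - j" n i] by simp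
  have "\<mu> (n - j) \<noteq> 0" using eq[of "j + n"] j c0 by auto
  then have "\<mu> (n - j) / (c^2 * y j) \<noteq> 0" using j c0 by simp
  moreover have "(\<lambda>i. y (i - n)) = (\<lambda>i. (\<mu> (n - j) / (c^2 * y j)) * z i)"
    using eq j c0 by (auto simp: field_simps)
  ultimately show ?thesis using z(2) proj_pt_scale by metis
qed

lemma mu4_T_eq: "mu4_T c = proj_pt (Opt 1)"
proof -
  have "tuple4 1 c 1 0 = Opt 1" by (rule fun_4_eqI) (simp_all add: Opt_def)
  then show ?thesis by (simp add: mu4_T_def)
qed

lemma ell_mult_T: "ell_mult c (int n) (mu4_T c) = proj_pt (Opt (of_nat n))"
proof -
  have "(ell_add c (mu4_T c) ^^ n) (mu4_O c) = proj_pt (Opt (of_nat n))"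
  proof (induction n)
    case 0 then show ?case by (simp add: mu4_O_eq)
  next
    case (Suc n)
    have "(\<lambda>i. Opt (of_nat n) (i - 1)) = Opt (of_nat (Suc n))"
      by (rule ext) (simp add: Opt_def algebra_simps)
    then show ?case using Suc add_Opt[OF Opt_in_C, of 1 "of_nat n"] by (simp add: mu4_T_eq)
  qed
  then show ?thesis by (simp add: ell_mult_def)
qed

end

lemma sum_lessThan_8:
  fixes f :: "nat \<Rightarrow> 'b::comm_monoid_add"
  shows "(\<Sum>a<8. f a) = f 0 + f 1 + f 2 + f 3 + f 4 + f 5 + f 6 + f 7"
  by (simp add: eval_nat_numeral)

context mu4
begin

section \<open>Normal forms of quadratic forms on the curve\<close>

text \<open>The quadratic forms modulo the ideal of the curve have dimension \<open>10 - 2 = 8\<close>; \<open>X\<^sub>0 X\<^sub>2\<close> and \<open>X\<^sub>1 X\<^sub>3\<close>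
  are expressed by squares.\<close>

definition B :: "nat \<Rightarrow> (4 \<Rightarrow> 'a) \<Rightarrow> 'a" where
  "B a x = (if a = 0 then x 0 * x 0 else if a = 1 then x 2 * x 2 else if a = 2 then x 1 * x 1 else
    if a = 3 then x 3 * x 3 else if a = 4 then x 0 * x 1 else if a = 5 then x 2 * x 3 else
    if a = 6 then x 0 * x 3 else x 1 * x 2)"

lemma B_simps: "B (Suc 0) x = x 2 * x 2" "B 0 x = x 0 * x 0" "B 1 x = x 2 * x 2" "B 2 x = x 1 * x 1" "B 3 x = x 3 * x 3"
  "B 4 x = x 0 * x 1" "B 5 x = x 2 * x 3" "B 6 x = x 0 * x 3" "B 7 x = x 1 * x 2"
  by (simp_all add: B_def)

lemma degree_2_monomial:
  assumes "(\<Sum>i\<in>UNIV. m (i::4)) = 2"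
  obtains i j where "\<And>x::4 \<Rightarrow> 'a. (\<Prod>i\<in>UNIV. x i ^ m i) = x i * x j"
proof -
  have p: "(\<Prod>i\<in>UNIV. x i ^ m i) = x 0 ^ m 0 * (x 1 ^ m 1 * (x 2 ^ m 2 * x 3 ^ m 3))" for x :: "4 \<Rightarrow> 'a"
    unfolding UNIV_4 by simp
  obtain i where i: "m i > 0"
    using assms by (metis gr0I sum.neutral zero_neq_numeral)
  have "(\<Sum>j\<in>UNIV. (if j = i then m i - 1 else m j)) = 1"
  proof -
    have "(\<Sum>j\<in>UNIV. m j) = m i + (\<Sum>j\<in>UNIV - {i}. m j)" by (simp add: sum.remove)
    moreover have "(\<Sum>j\<in>UNIV. (if j = i then m i - 1 else m j)) = (m i - 1) + (\<Sum>j\<in>UNIV - {i}. m j)"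
      by (simp add: sum.remove[of _ i] cong: if_cong)
    ultimately show ?thesis using assms i by linarith
  qed
  then obtain j where j: "(if j = i then m i - 1 else m j) = 1" "\<And>k. k \<noteq> j \<Longrightarrow> (if k = i then m i - 1 else m k) = 0"
    unfolding sum_eq_1_iff[OF finite] by fastforce
  have "(\<Prod>k\<in>UNIV. x k ^ m k) = x i * x j" for x :: "4 \<Rightarrow> 'a"
  proof -
    have "x k ^ m k = (if k = i then x i else 1) * (if k = j then x j else 1)" for k
      using j(1) j(2)[of k] i by (cases "k = i"; cases "k = j"; cases "m k"; cases "m k - 1") (auto split: if_splits)
    then show ?thesis by (simp add: prod.distrib)
  qed
  then show ?thesis by (rule that)
qed

text \<open>Restricting the coefficients to three constants from the ground field is what makes
  \<open>bidegree_2_normal_form\<close> descend.\<close>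

lemma degree_2_normal_form:
  assumes "(\<Sum>i\<in>UNIV. m (i::4)) = 2"
  shows "\<exists>\<psi>. (\<forall>a. \<psi> a \<in> {0, 1, 1 / c^2}) \<and>
      (\<forall>x\<in>C. (\<Prod>i\<in>UNIV. x i ^ m i) = (\<Sum>a<8. \<psi> a * B a x))"
proof -
  obtain i j where ij: "\<And>x::4 \<Rightarrow> 'a. (\<Prod>i\<in>UNIV. x i ^ m i) = x i * x j"
    using degree_2_monomial[OF assms] by blast
  have one: "\<exists>\<psi>. (\<forall>a. \<psi> a \<in> {0, 1, 1 / c^2}) \<and>
      (\<forall>x\<in>C. B n x = (\<Sum>a<8. \<psi> a * B a x))" if "n < 8" for n
  proof (rule exI[of _ "\<lambda>a. if a = n then 1 else 0"], intro conjI ballI allI)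
    fix x
    have "(\<Sum>a<8. (if a = n then 1 else 0) * B a x) = (\<Sum>a<8. if a = n then B n x else 0)"
      by (rule sum.cong) auto
    then show "B n x = (\<Sum>a<8. (if a = n then 1 else 0) * B a x)" using that by simp
  qed simp
  have two: "\<exists>\<psi>. (\<forall>a. \<psi> a \<in> {0, 1, 1 / c^2}) \<and> (\<forall>x\<in>C. x i * x (i + 2) = (\<Sum>a<8. \<psi> a * B a x))"
    if "i = 0 \<or> i = 1" for i
  proof (rule exI[of _ "\<lambda>a. if i = 0 then (if a = 2 \<or> a = 3 then 1 / c^2 else 0) else (if a = 0 \<or> a = 1 then 1 / c^2 else 0)"],
      intro conjI ballI)
    fix x assume x: "x \<in> C"
    have "x i * x (i + 2) = (1 / c^2) * (x (i - 1) + x (i + 1))^2"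
      using curve_eq[OF x, of "i - 1"] c0 by (simp add: mult.assoc add.commute)
    also have "\<dots> = (1 / c^2) * (x (i - 1))^2 + (1 / c^2) * (x (i + 1))^2"
      by (simp only: ring2)
    finally show "x i * x (i + 2) = (\<Sum>a<8. (if i = 0 then (if a = 2 \<or> a = 3 then 1 / c^2 else 0) else (if a = 0 \<or> a = 1 then 1 / c^2 else 0)) * B a x)"
      using that by (auto simp: sum_lessThan_8 B_simps power2_eq_square add.commute)
  qed (use that in auto)
  define P where "P i j \<longleftrightarrow> (\<exists>\<psi>. (\<forall>a. \<psi> a \<in> {0, 1, 1 / c^2}) \<and>
      (\<forall>x\<in>C. x i * x j = (\<Sum>a<8. \<psi> a * B a x)))" for i j
  have sym: "P i j \<Longrightarrow> P j i" for i j
    unfolding P_def by (subst mult.commute)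
  have "P 0 0" "P 2 2" "P 1 1" "P 3 3" "P 0 1" "P 2 3" "P 0 3" "P 1 2"
    using one[of 0] one[of 1] one[of 2] one[of 3] one[of 4] one[of 5] one[of 6] one[of 7]
    unfolding P_def B_simps by simp_all
  moreover have "P 0 2" "P 1 3" using two[of 0] two[of 1] unfolding P_def by simp_all
  ultimately have "P i j" using exhaust_4[of i] exhaust_4[of j] sym by metis
  then show ?thesis unfolding ij P_def .
qed

text \<open>The sixteen monomials are a basis of the quartic forms on the curve, a space of dimension
  \<open>deg C \<cdot> 4 = 16\<close>.\<close>

lemma quartic_independent:
  assumes eq: "\<And>v Y. onE v Y \<Longrightarrow> v \<notin> {0, 1} \<Longrightarrow> (let x = apt v Y in
    n1 * (x 0 * x 0 * x 0 * x 0) + n2 * (x 0 * x 0 * x 2 * x 2) + n3 * (x 2 * x 2 * x 2 * x 2) + n4 * (x 1 * x 1 * x 1 * x 1)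
    + e1 * (x 0 * x 0 * x 1 * x 1) + e2 * (x 0 * x 0 * x 3 * x 3) + e3 * (x 2 * x 2 * x 1 * x 1) + e4 * (x 2 * x 2 * x 3 * x 3)
    + o1 * (x 0 * x 0 * x 0 * x 1) + o2 * (x 0 * x 1 * x 2 * x 2) + o3 * (x 0 * x 0 * x 2 * x 3) + o4 * (x 2 * x 2 * x 2 * x 3)
    + q1 * (x 0 * x 0 * x 0 * x 3) + q2 * (x 0 * x 3 * x 2 * x 2) + q3 * (x 0 * x 0 * x 1 * x 2) + q4 * (x 2 * x 2 * x 2 * x 1)) = 0"
  shows "n1 = 0 \<and> n2 = 0 \<and> n3 = 0 \<and> n4 = 0 \<and> e1 = 0 \<and> e2 = 0 \<and> e3 = 0 \<and> e4 = 0 \<and>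
    o1 = 0 \<and> o2 = 0 \<and> o3 = 0 \<and> o4 = 0 \<and> q1 = 0 \<and> q2 = 0 \<and> q3 = 0 \<and> q4 = 0"
proof -
  \<comment> \<open>With w = X1 the chart gives w^2 = c^2 v w + v^4 + 1 and X3 = w + c^2 v; reducing
    the form leaves a(v) + b(v) w.\<close>
  define b where "b = [:c^3 * (o4 + q4), c^4 * (e3 + e4), c^3 * (o2 + q2), c^6 * n4, c^3 * (o3 + q3), c^4 * (e1 + e2), c^3 * (o1 + q1):]"
  define a where "a = [:c^4 * n3 + n4 + c^2 * (e3 + e4), c^5 * o4, c^4 * n4 + c^6 * e4, c^5 * q2,
    c^4 * n2 + c^2 * (e1 + e2) + c^2 * (e3 + e4), c^5 * o3, c^4 * n4 + c^6 * e2, c^5 * q1, c^4 * n1 + n4 + c^2 * (e1 + e2):]"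
  let ?f = "\<lambda>v Y. poly a v + poly b v * (Y + v * v)"
  have c2: "c ^ 5 = c * (c * (c * (c * c)))" "c ^ 6 = c * (c * (c * (c * (c * c))))" by (simp_all add: eval_nat_numeral)
  have "?f v Y = 0" if "onE v Y" "v \<notin> {0, 1}" for v Y
  proof -
    define w where "w = Y + v * v"
    have w: "w * w = c * (c * (v * w)) + v * (v * (v * v)) + 1"
      using that(1) unfolding w_def by (simp only: ring2 onE_square)
    have w': "w * (w * z) = (c * (c * (v * w)) + v * (v * (v * v)) + 1) * z" for z
      using w by (simp flip: mult.assoc)
    show ?thesis
      using eq[OF that] unfolding a_def b_def Let_def apt_simps w_def[symmetric] poly_pCons poly_0 c2
      by (simp only: ring2 w w')
  qed
  moreover have "reg ?f"
  proof -
    have "reg (\<lambda>v Y. Y)" using regular_Y by (auto simp: reg_def)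
    then show ?thesis by (intro reg_add reg_mult reg_poly reg_v)
  qed
  \<comment> \<open>The excluded values are those over which some coordinate vanishes. Leaving them
    out allows division by coordinates in \<open>law_coefficients\<close>, and
    \<open>reg_zero\<close> fills them in here.\<close>
  ultimately have f0: "?f v Y = 0" if "onE v Y" for v Y
    using reg_zero[of ?f "{0, 1}" v Y] that by blast
  have "represents (a + b * [:0, 0, 1:]) b (\<lambda>v Y. 0)" unfolding represents_def
  proof (intro allI impI)
    fix v Y assume "onE v Y"
    then show "0 = poly (a + b * [:0, 0, 1:]) v + poly b v * Y"
      using f0[of v Y] by (simp add: algebra_simps)
  qed
  moreover have "represents 0 0 (\<lambda>v Y. 0)" by (simp add: represents_def)
  ultimately have "a + b * [:0, 0, 1:] = 0" "b = 0" using represents_unique by blast+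
  then have "a = 0" "b = 0" by auto
  then have coeffs: "c^3 * (o4 + q4) = 0" "c^4 * (e3 + e4) = 0" "c^3 * (o2 + q2) = 0" "c^6 * n4 = 0" "c^3 * (o3 + q3) = 0"
    "c^4 * (e1 + e2) = 0" "c^3 * (o1 + q1) = 0"
    "c^4 * n3 + n4 + c^2 * (e3 + e4) = 0" "c^5 * o4 = 0" "c^4 * n4 + c^6 * e4 = 0" "c^5 * q2 = 0"
    "c^4 * n2 + c^2 * (e1 + e2) + c^2 * (e3 + e4) = 0" "c^5 * o3 = 0" "c^4 * n4 + c^6 * e2 = 0" "c^5 * q1 = 0"
    "c^4 * n1 + n4 + c^2 * (e1 + e2) = 0"
    unfolding a_def b_def by (simp_all only: pCons_eq_0_iff)
  have "n4 = 0" "o4 = 0" "q2 = 0" "o3 = 0" "q1 = 0" "e3 + e4 = 0" "e1 + e2 = 0" using coeffs c0 by auto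
  with coeffs c0 show ?thesis by auto
qed

text \<open>The hypothesis says that two forms stand in the same ratio as the entries 0 and 2 of an addition
  law. Comparing the coefficients of the quartic monomials first in \<open>x\<close> and then in \<open>y\<close> leaves
  a four-dimensional space.\<close>

lemma law_coefficients:
  fixes \<phi> \<gamma> :: "nat \<Rightarrow> nat \<Rightarrow> 'a"
  assumes key: "\<And>x y. x \<in> C \<Longrightarrow> y \<in> C \<Longrightarrow>
    (\<Sum>a<8. B a x * (\<Sum>b<8. \<phi> a b * B b y)) * lv 2 x y 2 = (\<Sum>a<8. B a x * (\<Sum>b<8. \<gamma> a b * B b y)) * lv 2 x y 0"
  shows "(\<Sum>a<8. B a x * (\<Sum>b<8. \<phi> a b * B b y)) =
    \<phi> 0 0 * lv 0 x y 0 + \<phi> 4 6 / c * lv 1 x y 0 + \<phi> 2 3 * lv 2 x y 0 + \<phi> 6 4 / c * lv 3 x y 0"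
proof -
  define f where "f a y = (\<Sum>b<8. \<phi> a b * B b y)" for a y
  define g where "g a y = (\<Sum>b<8. \<gamma> a b * B b y)" for a y
  \<comment> \<open>For fixed y, the sixteen coefficients of the basis quartics in x. The factor c^4
    clears denominators that arise when X0 X2 and X1 X3 are expressed by squares.\<close>
  have S: "c^4 * (f 0 y * (y 2 * y 2)) + (g 2 y * (y 1 * y 1) + g 3 y * (y 3 * y 3)) = 0 \<and>
      c^4 * (f 0 y * (y 0 * y 0)) + c^4 * (f 1 y * (y 2 * y 2)) + c^4 * c^4 * (g 3 y * (y 1 * y 1)) = 0 \<and>
      c^4 * (f 1 y * (y 0 * y 0)) + (g 2 y * (y 1 * y 1) + g 3 y * (y 3 * y 3)) = 0 \<and>
      c^4 * (g 2 y * (y 3 * y 3) + g 3 y * (y 1 * y 1)) = 0 \<and> c^4 * (f 2 y * (y 2 * y 2) + g 0 y * (y 3 * y 3)) = 0 \<and>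
      c^4 * (f 3 y * (y 2 * y 2) + g 0 y * (y 1 * y 1)) = 0 \<and> c^4 * (f 2 y * (y 0 * y 0) + g 1 y * (y 3 * y 3)) = 0 \<and>
      c^4 * (f 3 y * (y 0 * y 0) + g 1 y * (y 1 * y 1)) = 0 \<and>
      c^4 * (f 4 y * (y 2 * y 2)) + c^2 * (g 6 y * ((y 1 * y 1) + (y 3 * y 3))) = 0 \<and>
      c^4 * (f 4 y * (y 0 * y 0)) + c^2 * (g 6 y * ((y 1 * y 1) + (y 3 * y 3))) + c^4 * c^2 * (g 7 y * (y 3 * y 3)) = 0 \<and>
      c^4 * (f 5 y * (y 2 * y 2)) + c^4 * c^2 * (g 6 y * (y 1 * y 1)) + c^2 * (g 7 y * ((y 1 * y 1) + (y 3 * y 3))) = 0 \<and>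
      c^4 * (f 5 y * (y 0 * y 0)) + c^2 * (g 7 y * ((y 1 * y 1) + (y 3 * y 3))) = 0 \<and>
      c^4 * (f 6 y * (y 2 * y 2)) + c^2 * (g 4 y * ((y 1 * y 1) + (y 3 * y 3))) = 0 \<and>
      c^4 * (f 6 y * (y 0 * y 0)) + c^2 * (g 4 y * ((y 1 * y 1) + (y 3 * y 3))) + c^4 * c^2 * (g 5 y * (y 1 * y 1)) = 0 \<and>
      c^4 * (f 7 y * (y 2 * y 2)) + c^4 * c^2 * (g 4 y * (y 3 * y 3)) + c^2 * (g 5 y * ((y 1 * y 1) + (y 3 * y 3))) = 0 \<and>
      c^4 * (f 7 y * (y 0 * y 0)) + c^2 * (g 5 y * ((y 1 * y 1) + (y 3 * y 3))) = 0"
    if y: "y \<in> C" for y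
  proof (rule quartic_independent, goal_cases)
    case Y: (1 v Y)
    let ?y = "apt v Y"
    have "c^4 * ((\<Sum>a<8. B a ?y * f a y) * lv 2 ?y y 2 + (\<Sum>a<8. B a ?y * g a y) * lv 2 ?y y 0) = 0"
      using key[OF apt_in_C[OF Y(1)] y] unfolding f_def g_def by (simp add: add_self)
    then show ?case
      unfolding Let_def sum_lessThan_8 B_simps lv_simps by (simp only: ring2 C_squares[OF apt_in_C[OF Y(1)]])
  qed
  have nz: "apt v Y i \<noteq> 0" if "onE v Y" "v \<notin> {0, 1}" for v Y i
  proof -
    have y: "apt v Y \<in> C" using that by (intro apt_in_C)
    have "(apt v Y 0 + apt v Y 2)^2 = c^2 * (v + 1)^4" by simp (simp only: ring2)
    moreover have "v + 1 \<noteq> 0" using that(2) by (auto simp: add_eq_0)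
    moreover have "(apt v Y 0 + apt v Y 2)^2 = c^2 * apt v Y 1 * apt v Y 3" using y unfolding mem_C by blast
    moreover have "c^2 * (v + 1)^4 \<noteq> 0" if "v + 1 \<noteq> 0" using c0 that by simp
    ultimately have "c^2 * apt v Y 1 * apt v Y 3 \<noteq> 0" by argo
    then have "apt v Y 1 \<noteq> 0" "apt v Y 3 \<noteq> 0" by auto
    moreover have "apt v Y 0 \<noteq> 0" "apt v Y 2 \<noteq> 0" using that c0 by auto
    ultimately show ?thesis using exhaust_4[of i] by metis
  qed
  have sq: "y 1 * y 1 + y 3 * y 3 = c^2 * y 0 * y 2" "y 0 * y 0 + y 2 * y 2 = c^2 * y 1 * y 3" if "y \<in> C" for y
  proof -
    have "y 1 * y 1 + y 3 * y 3 = (y 1 + y 3)^2" "y 0 * y 0 + y 2 * y 2 = (y 0 + y 2)^2" by (simp_all only: ring2)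
    then show "y 1 * y 1 + y 3 * y 3 = c^2 * y 0 * y 2" "y 0 * y 0 + y 2 * y 2 = c^2 * y 1 * y 3"
      using that by (simp_all add: mem_C)
  qed
  \<comment> \<open>Here and in E2, E1, E3 the forms g are eliminated, leaving one relation between
    two of the forms f that is again quartic in y.\<close>
  have E0: "f 0 (apt v Y) * (apt v Y 2 * apt v Y 2) + f 1 (apt v Y) * (apt v Y 0 * apt v Y 0) = 0" if "onE v Y" "v \<notin> {0, 1}" for v Y
  proof -
    let ?y = "apt v Y"
    have "c^4 * (f 0 ?y * (?y 2 * ?y 2)) = c^4 * (f 1 ?y * (?y 0 * ?y 0))"
      using S[OF apt_in_C[OF that(1)]] unfolding add_eq_0 by (elim conjE) (simp only:)
    then have "f 0 ?y * (?y 2 * ?y 2) = f 1 ?y * (?y 0 * ?y 0)" using c0 by (simp del: apt_simps)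
    then show ?thesis by (simp only: add_eq_0)
  qed
  have E2: "f 2 (apt v Y) * (apt v Y 1 * apt v Y 1) + f 3 (apt v Y) * (apt v Y 3 * apt v Y 3) = 0" if "onE v Y" "v \<notin> {0, 1}" for v Y
  proof -
    let ?y = "apt v Y"
    have fg: "f 2 ?y * (?y 2 * ?y 2) = g 0 ?y * (?y 3 * ?y 3)" "f 3 ?y * (?y 2 * ?y 2) = g 0 ?y * (?y 1 * ?y 1)"
      using S[OF apt_in_C[OF that(1)]] c0 unfolding add_eq_0 mult_eq_0_iff by (elim conjE, simp del: apt_simps)+
    have "(?y 2 * ?y 2) * (f 2 ?y * (?y 1 * ?y 1)) = (f 2 ?y * (?y 2 * ?y 2)) * (?y 1 * ?y 1)" by (simp only: mult_ac)
    also have "\<dots> = (f 3 ?y * (?y 2 * ?y 2)) * (?y 3 * ?y 3)" unfolding fg by (simp only: mult_ac)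
    finally have "(?y 2 * ?y 2) * (f 2 ?y * (?y 1 * ?y 1)) = (?y 2 * ?y 2) * (f 3 ?y * (?y 3 * ?y 3))"
      by (simp only: mult_ac)
    then have "f 2 ?y * (?y 1 * ?y 1) = f 3 ?y * (?y 3 * ?y 3)" using nz[OF that, of 2] by (simp del: apt_simps)
    then show ?thesis by (simp only: add_eq_0)
  qed
  \<comment> \<open>The pairs f 4, f 5 and f 6, f 7 satisfy the same system up to exchanging Y1 and
    Y3, so one elimination serves both.\<close>
  have odd: "F * (a * yb) + G * (ya * b) = 0"
    if "ya \<noteq> 0" "yb \<noteq> 0" "b \<noteq> 0" and ab: "a * a + b * b = c^2 * ya * yb" "ya * ya + yb * yb = c^2 * a * b"
      and 1: "c^4 * (F * (yb * yb)) = c^2 * (ga * (a * a + b * b))"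
      and 2: "c^4 * (F * (ya * ya)) + c^2 * (ga * (a * a + b * b)) = c^4 * c^2 * (gb * (b * b))"
      and 3: "c^4 * (G * (ya * ya)) = c^2 * (gb * (a * a + b * b))" for F G ga gb a b ya yb :: 'a
  proof -
    have "(c^4 * yb) * (F * yb) = (c^4 * yb) * (ga * ya)" using 1 unfolding ab(1) by (simp add: mult_ac power4_eq_xxxx power2_eq_square)
    then have Fy: "F * yb = ga * ya" using c0 \<open>yb \<noteq> 0\<close> by simp
    have "(c^4 * ya) * (G * ya) = (c^4 * ya) * (gb * yb)" using 3 unfolding ab(1) by (simp add: mult_ac power4_eq_xxxx power2_eq_square)
    then have Gy: "G * ya = gb * yb" using c0 \<open>ya \<noteq> 0\<close> by simp
    have four: "c^4 * (F * (ya * ya) + F * (yb * yb)) = c^4 * c^2 * (gb * (b * b))"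
      using 2 unfolding 1[symmetric] by (simp add: distrib_left)
    then have "c^4 * (F * (ya * ya + yb * yb)) = c^4 * (c^2 * (gb * (b * b)))" by (simp add: distrib_left mult.assoc)
    then have "F * (c^2 * a * b) = c^2 * (gb * (b * b))"
      unfolding ab(2) by (rule mult_left_cancel[THEN iffD1, rotated]) (use c0 in simp)
    then have "(c^2 * b) * (F * a) = (c^2 * b) * (gb * b)" by (simp add: mult_ac)
    then have "F * a = gb * b" using c0 \<open>b \<noteq> 0\<close> by simp
    then have "F * a * yb = G * ya * b" unfolding Gy by (simp add: mult_ac)
    then show ?thesis by (simp only: add_eq_0 mult_ac)
  qed
  have E1: "f 4 (apt v Y) * (apt v Y 1 * apt v Y 2) + f 5 (apt v Y) * (apt v Y 0 * apt v Y 3) = 0" if "onE v Y" "v \<notin> {0, 1}" for v Y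
  proof (rule odd[where ga = "g 6 (apt v Y)" and gb = "g 7 (apt v Y)"])
    show "apt v Y 0 \<noteq> 0" "apt v Y 2 \<noteq> 0" "apt v Y 3 \<noteq> 0" by (rule nz[OF that])+
  qed (use S[OF apt_in_C[OF that(1)]] sq[OF apt_in_C[OF that(1)]] in \<open>(elim conjE, simp only: add_eq_0)+\<close>)
  have E3: "f 6 (apt v Y) * (apt v Y 3 * apt v Y 2) + f 7 (apt v Y) * (apt v Y 0 * apt v Y 1) = 0" if "onE v Y" "v \<notin> {0, 1}" for v Y
  proof (rule odd[where ga = "g 4 (apt v Y)" and gb = "g 5 (apt v Y)"])
    show "apt v Y 0 \<noteq> 0" "apt v Y 2 \<noteq> 0" "apt v Y 1 \<noteq> 0" by (rule nz[OF that])+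
    show "apt v Y 3 * apt v Y 3 + apt v Y 1 * apt v Y 1 = c\<^sup>2 * apt v Y 0 * apt v Y 2"
      "apt v Y 0 * apt v Y 0 + apt v Y 2 * apt v Y 2 = c\<^sup>2 * apt v Y 3 * apt v Y 1"
      using sq[OF apt_in_C[OF that(1)]] by (simp_all only: ac_simps)
  qed (use S[OF apt_in_C[OF that(1)]] in \<open>(elim conjE, simp only: add_eq_0 add.commute[of "apt v Y 3 * apt v Y 3"])+\<close>)
  have E0': "\<phi> 0 1 = 0 \<and> \<phi> 0 2 = 0 \<and> \<phi> 0 3 = 0 \<and> \<phi> 0 4 = 0 \<and> \<phi> 0 5 = 0 \<and> \<phi> 0 6 = 0 \<and>
      \<phi> 0 7 = 0 \<and> \<phi> 1 0 = 0 \<and> \<phi> 1 2 = 0 \<and> \<phi> 1 3 = 0 \<and> \<phi> 1 4 = 0 \<and> \<phi> 1 5 = 0 \<and>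
      \<phi> 1 6 = 0 \<and> \<phi> 1 7 = 0 \<and> \<phi> 1 1 = \<phi> 0 0"
  proof -
    \<comment> \<open>The second comparison, in y: the coefficients of the quartic in E0. The fourth
      is 0 because X1^4 does not occur.\<close>
    have "\<phi> 1 0 = 0 \<and> \<phi> 0 0 + \<phi> 1 1 = 0 \<and> \<phi> 0 1 = 0 \<and> (0::'a) = 0 \<and> \<phi> 1 2 = 0 \<and>
        \<phi> 1 3 = 0 \<and> \<phi> 0 2 = 0 \<and> \<phi> 0 3 = 0 \<and> \<phi> 1 4 = 0 \<and> \<phi> 0 4 = 0 \<and> \<phi> 1 5 = 0 \<and>
        \<phi> 0 5 = 0 \<and> \<phi> 1 6 = 0 \<and> \<phi> 0 6 = 0 \<and> \<phi> 1 7 = 0 \<and> \<phi> 0 7 = 0"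
    proof (rule quartic_independent, goal_cases)
      case Y: (1 v Y)
      let ?y = "apt v Y"
      have "1 * (f 0 ?y * (?y 2 * ?y 2) + f 1 ?y * (?y 0 * ?y 0)) = 0" using E0[OF Y] by simp
      then show ?case
        unfolding Let_def f_def sum_lessThan_8 B_simps by (simp only: ring2 C_squares[OF apt_in_C[OF Y(1)]])
    qed
    then show ?thesis using c0 by (auto simp: add_eq_0 two)
  qed
  have E2': "\<phi> 2 0 = 0 \<and> \<phi> 2 1 = 0 \<and> \<phi> 2 2 = 0 \<and> \<phi> 2 4 = 0 \<and> \<phi> 2 5 = 0 \<and> \<phi> 2 6 = 0 \<and>
      \<phi> 2 7 = 0 \<and> \<phi> 3 0 = 0 \<and> \<phi> 3 1 = 0 \<and> \<phi> 3 3 = 0 \<and> \<phi> 3 4 = 0 \<and> \<phi> 3 5 = 0 \<and>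
      \<phi> 3 6 = 0 \<and> \<phi> 3 7 = 0 \<and> \<phi> 3 2 = \<phi> 2 3"
  proof -
    have "\<phi> 2 3 + \<phi> 3 2 = 0 \<and> c^4 * c^4 * \<phi> 3 3 = 0 \<and> \<phi> 2 3 + \<phi> 3 2 = 0 \<and>
        c^4 * \<phi> 2 2 + c^4 * \<phi> 3 3 = 0 \<and> c^4 * \<phi> 2 0 = 0 \<and> c^4 * \<phi> 3 0 = 0 \<and> c^4 * \<phi> 2 1 = 0 \<and>
        c^4 * \<phi> 3 1 = 0 \<and> c^2 * \<phi> 2 6 + c^2 * \<phi> 3 6 = 0 \<and>
        c^2 * \<phi> 2 6 + c^2 * \<phi> 3 6 + c^4 * c^2 * \<phi> 2 7 = 0 \<and>
        c^2 * \<phi> 2 7 + c^4 * c^2 * \<phi> 3 6 + c^2 * \<phi> 3 7 = 0 \<and> c^2 * \<phi> 2 7 + c^2 * \<phi> 3 7 = 0 \<and>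
        c^2 * \<phi> 2 4 + c^2 * \<phi> 3 4 = 0 \<and> c^2 * \<phi> 2 4 + c^2 * \<phi> 3 4 + c^4 * c^2 * \<phi> 3 5 = 0 \<and>
        c^4 * c^2 * \<phi> 2 4 + c^2 * \<phi> 2 5 + c^2 * \<phi> 3 5 = 0 \<and> c^2 * \<phi> 2 5 + c^2 * \<phi> 3 5 = 0"
    proof (rule quartic_independent, goal_cases)
      case Y: (1 v Y)
      let ?y = "apt v Y"
      have "c^4 * (f 2 ?y * (?y 1 * ?y 1) + f 3 ?y * (?y 3 * ?y 3)) = 0" using E2[OF Y] by simp
      then show ?case
        unfolding Let_def f_def sum_lessThan_8 B_simps by (simp only: ring2 C_squares[OF apt_in_C[OF Y(1)]])
    qed
    then show ?thesis using c0 by (auto simp: add_eq_0 two)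
  qed
  have E1': "\<phi> 4 0 = 0 \<and> \<phi> 4 1 = 0 \<and> \<phi> 4 2 = 0 \<and> \<phi> 4 3 = 0 \<and> \<phi> 4 4 = 0 \<and> \<phi> 4 5 = 0 \<and>
      \<phi> 4 7 = 0 \<and> \<phi> 5 0 = 0 \<and> \<phi> 5 1 = 0 \<and> \<phi> 5 2 = 0 \<and> \<phi> 5 3 = 0 \<and> \<phi> 5 4 = 0 \<and>
      \<phi> 5 5 = 0 \<and> \<phi> 5 6 = 0 \<and> \<phi> 5 7 = \<phi> 4 6"
  proof -
    have "\<phi> 4 4 + c^4 * \<phi> 5 4 + \<phi> 5 5 = 0 \<and> c^4 * \<phi> 4 5 + c^4 * \<phi> 5 4 + c^4 * c^4 * \<phi> 5 5 = 0 \<and>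
        \<phi> 4 4 + \<phi> 5 5 + c^4 * \<phi> 4 5 = 0 \<and> c^4 * \<phi> 4 4 + c^4 * \<phi> 5 5 = 0 \<and>
        c^2 * \<phi> 4 6 + c^2 * \<phi> 5 7 = 0 \<and> c^2 * \<phi> 4 6 + c^2 * \<phi> 5 7 + c^4 * c^2 * \<phi> 5 6 = 0 \<and>
        c^2 * \<phi> 4 6 + c^2 * \<phi> 5 7 + c^4 * c^2 * \<phi> 4 7 = 0 \<and> c^2 * \<phi> 4 6 + c^2 * \<phi> 5 7 = 0 \<and>
        c^4 * \<phi> 5 2 + c^4 * \<phi> 5 3 = 0 \<and> c^4 * c^4 * \<phi> 4 2 + c^4 * \<phi> 5 2 + c^4 * \<phi> 5 3 = 0 \<and>
        c^4 * \<phi> 4 2 + c^4 * \<phi> 4 3 + c^4 * c^4 * \<phi> 5 3 = 0 \<and> c^4 * \<phi> 4 2 + c^4 * \<phi> 4 3 = 0 \<and>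
        c^4 * c^2 * \<phi> 5 0 = 0 \<and> c^4 * c^2 * \<phi> 5 1 = 0 \<and> c^4 * c^2 * \<phi> 4 0 = 0 \<and> c^4 * c^2 * \<phi> 4 1 = 0"
    proof (rule quartic_independent, goal_cases)
      case Y: (1 v Y)
      let ?y = "apt v Y"
      have "c^4 * c^2 * (f 4 ?y * (?y 1 * ?y 2) + f 5 ?y * (?y 0 * ?y 3)) = 0" using E1[OF Y] by simp
      then show ?case
        unfolding Let_def f_def sum_lessThan_8 B_simps by (simp only: ring2 C_squares[OF apt_in_C[OF Y(1)]])
    qed
    then show ?thesis using c0 by (auto simp: add_eq_0 two)
  qed
  have E3': "\<phi> 6 0 = 0 \<and> \<phi> 6 1 = 0 \<and> \<phi> 6 2 = 0 \<and> \<phi> 6 3 = 0 \<and> \<phi> 6 5 = 0 \<and> \<phi> 6 6 = 0 \<and>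
      \<phi> 6 7 = 0 \<and> \<phi> 7 0 = 0 \<and> \<phi> 7 1 = 0 \<and> \<phi> 7 2 = 0 \<and> \<phi> 7 3 = 0 \<and> \<phi> 7 4 = 0 \<and>
      \<phi> 7 6 = 0 \<and> \<phi> 7 7 = 0 \<and> \<phi> 7 5 = \<phi> 6 4"
  proof -
    have "\<phi> 6 6 + \<phi> 7 7 + c^4 * \<phi> 7 6 = 0 \<and>
        c^4 * c^4 * \<phi> 6 6 + c^4 * c^4 * \<phi> 7 7 + c^4 * \<phi> 6 7 + c^4 * \<phi> 7 6 + c^4 * c^4 * \<phi> 7 7 = 0 \<and>
        \<phi> 6 6 + \<phi> 7 7 + c^4 * \<phi> 6 7 = 0 \<and> c^4 * \<phi> 6 6 + c^4 * \<phi> 7 7 = 0 \<and>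
        c^2 * \<phi> 6 4 + c^2 * \<phi> 7 5 + c^4 * c^2 * \<phi> 7 4 = 0 \<and> c^2 * \<phi> 6 4 + c^2 * \<phi> 7 5 = 0 \<and>
        c^2 * \<phi> 6 4 + c^2 * \<phi> 7 5 = 0 \<and> c^2 * \<phi> 6 4 + c^2 * \<phi> 7 5 + c^4 * c^2 * \<phi> 6 5 = 0 \<and>
        c^4 * c^2 * \<phi> 7 0 = 0 \<and> c^4 * c^2 * \<phi> 7 1 = 0 \<and> c^4 * c^2 * \<phi> 6 0 = 0 \<and> c^4 * c^2 * \<phi> 6 1 = 0 \<and>
        c^4 * \<phi> 7 3 + c^4 * \<phi> 7 2 = 0 \<and> c^4 * c^4 * \<phi> 6 3 + c^4 * \<phi> 7 3 + c^4 * \<phi> 7 2 = 0 \<and>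
        c^4 * \<phi> 6 3 + c^4 * \<phi> 6 2 + c^4 * c^4 * \<phi> 7 2 = 0 \<and> c^4 * \<phi> 6 3 + c^4 * \<phi> 6 2 = 0"
    proof (rule quartic_independent, goal_cases)
      case Y: (1 v Y)
      let ?y = "apt v Y"
      have "c^4 * c^2 * (f 6 ?y * (?y 3 * ?y 2) + f 7 ?y * (?y 0 * ?y 1)) = 0" using E3[OF Y] by simp
      then show ?case
        unfolding Let_def f_def sum_lessThan_8 B_simps by (simp only: ring2 C_squares[OF apt_in_C[OF Y(1)]])
    qed
    then show ?thesis using c0 by (auto simp: add_eq_0 two)
  qed
  note \<phi> = E0' E1' E2' E3'
  have "(\<Sum>a<8. B a x * (\<Sum>b<8. \<phi> a b * B b y)) =
      \<phi> 0 0 * (x 0 * y 0 + x 2 * y 2)^2 + \<phi> 4 6 * (x 0 * x 1 * y 0 * y 3 + x 2 * x 3 * y 1 * y 2)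
      + \<phi> 2 3 * (x 3 * y 1 + x 1 * y 3)^2 + \<phi> 6 4 * (x 0 * x 3 * y 0 * y 1 + x 1 * x 2 * y 2 * y 3)"
    unfolding sum_lessThan_8 B_simps by (simp only: \<phi> mult_zero_left mult_zero_right add_0_left add_0_right) (simp only: ring2)
  then show ?thesis unfolding lv_simps using c0 by simp
qed

section \<open>The surface and its diagonals\<close>

abbreviation V where "V \<equiv> bicone (mu4_surface c)"

lemma bicone_iff:
  assumes "Z \<subseteq> mu4_surface c"
  shows "z \<in> bicone Z \<longleftrightarrow> (\<exists>x\<in>C. \<exists>y\<in>C. z = case_sum x y \<and> (proj_pt x, proj_pt y) \<in> Z)"
proof
  assume "z \<in> bicone Z"
  then obtain x y P Q where *: "z = case_sum x y" "(P, Q) \<in> Z" "x \<in> P" "y \<in> Q" by (auto simp: bicone_def)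
  then have "P \<in> mu4_curve c" "Q \<in> mu4_curve c" using assms by (auto simp: mu4_surface_def)
  with * mem_curve_point show "\<exists>x\<in>C. \<exists>y\<in>C. z = case_sum x y \<and> (proj_pt x, proj_pt y) \<in> Z" by metis
next
  assume "\<exists>x\<in>C. \<exists>y\<in>C. z = case_sum x y \<and> (proj_pt x, proj_pt y) \<in> Z"
  then show "z \<in> bicone Z" unfolding bicone_def using self_mem_proj_pt by blast
qed

lemma mem_V: "z \<in> V \<longleftrightarrow> (\<exists>x\<in>C. \<exists>y\<in>C. z = case_sum x y)"
  by (subst bicone_iff) (auto simp: mu4_surface_def)

lemma case_sum_in_V: "x \<in> C \<Longrightarrow> y \<in> C \<Longrightarrow> case_sum x y \<in> V"
  using mem_V by blast

lemma vanishing_V_iff: "F \<in> vanishing_ideal V \<longleftrightarrow> (\<forall>x\<in>C. \<forall>y\<in>C. eval_mpoly (case_sum x y) F = 0)"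
  by (fastforce simp: vanishing_ideal_def Ball_def mem_V)

lemma irred_V: "irred_set V"
proof -
  have "V = {case_sum x y | x y. x \<in> C \<and> y \<in> C}" using mem_V by blast
  then show ?thesis using irred_set_Times[OF irred_C irred_C] by simp
qed

lemma bicone_mono: "Z \<subseteq> W \<Longrightarrow> bicone Z \<subseteq> bicone W"
  unfolding bicone_def by blast

lemma bicone_point: "bicone {(proj_pt x, proj_pt y)} = {case_sum (\<lambda>i. a * x i) (\<lambda>i. b * y i) | a b. a \<noteq> 0 \<and> b \<noteq> 0}"
  unfolding bicone_def by (auto simp: mem_proj_pt)

lemma irred_bicone_point: "irred_set (bicone {(proj_pt x, proj_pt (y :: 4 \<Rightarrow> 'a))})"
proof -
  define S1 where "S1 = {\<lambda>v. if v \<in> range Inl then a * q v else q v | a q. a \<noteq> 0 \<and> q \<in> {case_sum x y}}"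
  define S2 where "S2 = {\<lambda>v. if v \<in> range Inr then a * q v else q v | a q. a \<noteq> 0 \<and> q \<in> S1}"
  have "irred_set S2" unfolding S1_def S2_def by (intro irred_set_scale irred_set_singleton)
  moreover have "S2 = bicone {(proj_pt x, proj_pt y)}"
  proof -
    have *: "(\<lambda>v. if v \<in> range Inr then b * (if v \<in> range Inl then a * case_sum x y v else case_sum x y v)
        else (if v \<in> range Inl then a * case_sum x y v else case_sum x y v)) = case_sum (\<lambda>i. a * x i) (\<lambda>i. b * y i)" for a b
      by (rule ext) (auto split: sum.split)
    show ?thesis
    proof (intro Set.set_eqI iffI)
      fix z assume "z \<in> S2"
      then obtain b q where b: "b \<noteq> 0" "q \<in> S1" "z = (\<lambda>v. if v \<in> range Inr then b * q v else q v)"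
        unfolding S2_def by blast
      obtain a where a: "a \<noteq> 0" "q = (\<lambda>v. if v \<in> range Inl then a * case_sum x y v else case_sum x y v)"
        using b(2) unfolding S1_def by blast
      have "z = case_sum (\<lambda>i. a * x i) (\<lambda>i. b * y i)" unfolding b(3) a(2) by (rule *)
      then show "z \<in> bicone {(proj_pt x, proj_pt y)}" unfolding bicone_point using a(1) b(1) by blast
    next
      fix z assume "z \<in> bicone {(proj_pt x, proj_pt y)}"
      then obtain a b where z: "a \<noteq> 0" "b \<noteq> 0" "z = case_sum (\<lambda>i. a * x i) (\<lambda>i. b * y i)"
        unfolding bicone_point by blast
      define q where "q = (\<lambda>v. if v \<in> range Inl then a * case_sum x y v else case_sum x y v)"
      have "q \<in> S1" unfolding S1_def q_def using z(1) by blast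
      moreover have "z = (\<lambda>v. if v \<in> range Inr then b * q v else q v)" unfolding z(3) q_def *[of b a] ..
      ultimately show "z \<in> S2" unfolding S2_def using z(2) by blast
    qed
  qed
  ultimately show ?thesis by simp
qed

lemma surface_point: "z \<in> mu4_surface c \<Longrightarrow> \<exists>x\<in>C. \<exists>y\<in>C. z = (proj_pt x, proj_pt y)"
  by (auto simp: mu4_surface_def curve_iff)

lemma zclosed_subset: "zclosed c Z \<Longrightarrow> Z \<subseteq> mu4_surface c"
  by (auto simp: zclosed_def)

lemma vanishing_bicone_iff: "F \<in> vanishing_ideal (bicone Z) \<longleftrightarrow> (\<forall>z\<in>Z. F \<in> vanishing_ideal (bicone {z}))"
  unfolding vanishing_ideal_def bicone_def by blast

text \<open>Two proper closed subsets covering Z would give two forms, each nonzero somewhere on Z,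
  whose product vanishes on Z.\<close>

lemma zirreducible_if_irred:
  assumes Z: "zclosed c Z" and irr: "irred_set (bicone Z)"
  shows "zirreducible c Z"
  unfolding zirreducible_def
proof (intro conjI allI impI Z)
  show "Z \<noteq> {}" using irr by (auto simp: irred_set_def bicone_def)
  fix Z1 Z2 assume *: "zclosed c Z1 \<and> zclosed c Z2 \<and> Z = Z1 \<union> Z2"
  obtain A1 where A1: "Z1 = {z \<in> mu4_surface c. \<forall>F\<in>A1. F \<in> vanishing_ideal (bicone {z})}"
    using * unfolding zclosed_def by blast
  obtain A2 where A2: "Z2 = {z \<in> mu4_surface c. \<forall>F\<in>A2. F \<in> vanishing_ideal (bicone {z})}"
    using * unfolding zclosed_def by blast
  note sub = zclosed_subset[OF Z]
  show "Z = Z1 \<or> Z = Z2"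
  proof (rule ccontr)
    assume "\<not> (Z = Z1 \<or> Z = Z2)"
    then obtain z1 z2 where z: "z1 \<in> Z" "z1 \<notin> Z1" "z2 \<in> Z" "z2 \<notin> Z2" using * by blast
    then obtain F1 F2 where F: "F1 \<in> A1" "F1 \<notin> vanishing_ideal (bicone {z1})" "F2 \<in> A2" "F2 \<notin> vanishing_ideal (bicone {z2})"
      using A1 A2 sub by blast
    then have "F1 \<notin> vanishing_ideal (bicone Z)" "F2 \<notin> vanishing_ideal (bicone Z)"
      using z vanishing_bicone_iff by blast+
    then have "F1 * F2 \<notin> vanishing_ideal (bicone Z)" by (rule irred_set_mult[OF irr])
    then obtain z3 where z3: "z3 \<in> Z" "F1 * F2 \<notin> vanishing_ideal (bicone {z3})" using vanishing_bicone_iff by blast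
    then have "F1 \<in> vanishing_ideal (bicone {z3}) \<or> F2 \<in> vanishing_ideal (bicone {z3})"
      using * A1 A2 F by blast
    then have "F1 * F2 \<in> vanishing_ideal (bicone {z3})" by (auto simp: vanishing_ideal_def)
    with z3 show False by blast
  qed
qed

lemma power_sum_zero:
  fixes f :: "nat \<Rightarrow> 'a"
  assumes "\<And>a. a \<noteq> 0 \<Longrightarrow> (\<Sum>k<N. a ^ k * f k) = 0" and "k < N"
  shows "f k = 0"
proof -
  define p where "p = (\<Sum>k<N. monom (f k) k)"
  have "poly p a = 0" if "a \<notin> {0}" for a
    using assms(1)[of a] that by (simp add: p_def poly_sum poly_monom mult.commute)
  then have "p = 0" using poly_zero_cofinite[of "{0}" p] by simp
  moreover have "coeff p k = f k" using assms(2) by (simp add: p_def coeff_sum)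
  ultimately show ?thesis by simp
qed

text \<open>Scaling the two factors separately gives a polynomial in two parameters that vanishes
  for all nonzero values, so every coefficient vanishes.\<close>

lemma vanishing_point_iff_bicomponents:
  assumes F: "F = (\<Sum>d<N. \<Sum>e<N. bicomponent d e F)"
  shows "F \<in> vanishing_ideal (bicone {(proj_pt x, proj_pt (y :: 4 \<Rightarrow> 'a))}) \<longleftrightarrow>
    (\<forall>d<N. \<forall>e<N. bicomponent d e F \<in> vanishing_ideal (bicone {(proj_pt x, proj_pt y)}))"
    (is "F \<in> ?I \<longleftrightarrow> _")
proof
  assume "\<forall>d<N. \<forall>e<N. bicomponent d e F \<in> ?I"
  then have "(\<Sum>d<N. \<Sum>e<N. bicomponent d e F) \<in> ?I" by (auto simp: vanishing_ideal_def)
  then show "F \<in> ?I" using F by simp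
next
  define ev where "ev d e = eval_mpoly (case_sum x y) (bicomponent d e F)" for d e
  assume I: "F \<in> ?I"
  have z: "(\<Sum>d<N. a ^ d * (\<Sum>e<N. b ^ e * ev d e)) = 0" if "a \<noteq> 0" "b \<noteq> 0" for a b
  proof -
    have "eval_mpoly (case_sum (\<lambda>i. a * x i) (\<lambda>i. b * y i)) F = (\<Sum>d<N. a ^ d * (\<Sum>e<N. b ^ e * ev d e))"
      by (subst F) (simp add: eval_bihomogeneous_scale[OF bihomogeneous_bicomponent] sum_distrib_left mult.assoc ev_def)
    moreover have "case_sum (\<lambda>i. a * x i) (\<lambda>i. b * y i) \<in> bicone {(proj_pt x, proj_pt y)}"
      unfolding bicone_point using that by blast
    ultimately show ?thesis using vanishing_idealD[OF I] by simp
  qed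
  have "ev d e = 0" if de: "d < N" "e < N" for d e
  proof (rule power_sum_zero[where f = "ev d" and N = N])
    fix b :: 'a assume b: "b \<noteq> 0"
    show "(\<Sum>e<N. b ^ e * ev d e) = 0"
      by (rule power_sum_zero[where f = "\<lambda>d. \<Sum>e<N. b ^ e * ev d e" and N = N]) (use z b de in auto)
  qed (use de in auto)
  then show "\<forall>d<N. \<forall>e<N. bicomponent d e F \<in> ?I"
    unfolding bicone_point ev_def vanishing_ideal_def
    by (auto simp: eval_bihomogeneous_scale[OF bihomogeneous_bicomponent])
qed

text \<open>Converse of \<open>zirreducible_if_irred\<close>. The zero locus in Z of an arbitrary
  polynomial is closed, being cut out by the bihomogeneous components.\<close>

lemma irred_if_zirreducible:
  assumes irr: "zirreducible c Z"
  shows "irred_set (bicone Z)"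
proof -
  have Z: "zclosed c Z" "Z \<noteq> {}" using irr by (auto simp: zirreducible_def)
  note sub = zclosed_subset[OF Z(1)]
  have closed: "zclosed c {z \<in> Z. F \<in> vanishing_ideal (bicone {z})}" for F
  proof -
    obtain A0 where A0: "\<forall>F\<in>A0. \<exists>d e. bihomogeneous d e F" "Z = {z \<in> mu4_surface c. \<forall>F\<in>A0. F \<in> vanishing_ideal (bicone {z})}"
      using Z unfolding zclosed_def by blast
    obtain N where N: "F = (\<Sum>d<N. \<Sum>e<N. bicomponent d e F)" using sum_bicomponent by blast
    define A1 where "A1 = {bicomponent d e F | d e. d < N \<and> e < N}"
    have "F \<in> vanishing_ideal (bicone {z}) \<longleftrightarrow> (\<forall>G\<in>A1. G \<in> vanishing_ideal (bicone {z}))" if z: "z \<in> mu4_surface c" for z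
    proof -
      obtain x y where "z = (proj_pt x, proj_pt y)" using surface_point[OF z] by blast
      then show ?thesis using vanishing_point_iff_bicomponents[OF N, of x y] unfolding A1_def by blast
    qed
    then have "{z \<in> Z. F \<in> vanishing_ideal (bicone {z})} = {z \<in> mu4_surface c. \<forall>F\<in>A0 \<union> A1. F \<in> vanishing_ideal (bicone {z})}"
      using A0(2) by blast
    moreover have "\<forall>F\<in>A0 \<union> A1. \<exists>d e. bihomogeneous d e F"
      using A0(1) bihomogeneous_bicomponent unfolding A1_def by blast
    ultimately show ?thesis unfolding zclosed_def by blast
  qed
  have "F \<in> vanishing_ideal (bicone Z) \<or> G \<in> vanishing_ideal (bicone Z)" if FG: "F * G \<in> vanishing_ideal (bicone Z)" for F G
  proof -
    let ?Z1 = "{z \<in> Z. F \<in> vanishing_ideal (bicone {z})}" and ?Z2 = "{z \<in> Z. G \<in> vanishing_ideal (bicone {z})}"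
    have "F \<in> vanishing_ideal (bicone {z}) \<or> G \<in> vanishing_ideal (bicone {z})" if z: "z \<in> Z" for z
    proof -
      obtain x y where xy: "z = (proj_pt x, proj_pt y)" using surface_point z sub by blast
      have "F * G \<in> vanishing_ideal (bicone {z})" using FG z vanishing_bicone_iff by blast
      then show ?thesis using irred_setD[OF irred_bicone_point] unfolding xy by blast
    qed
    then have "Z = ?Z1 \<union> ?Z2" by blast
    then have "Z = ?Z1 \<or> Z = ?Z2" using irr closed unfolding zirreducible_def by blast
    then show ?thesis unfolding vanishing_bicone_iff[of _ Z] by blast
  qed
  moreover have "bicone Z \<noteq> {}"
  proof -
    obtain z where "z \<in> Z" using Z by blast
    moreover from this obtain x y where "z = (proj_pt x, proj_pt y)" using surface_point sub by blast
    ultimately show ?thesis using self_mem_proj_pt unfolding bicone_def by blast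
  qed
  ultimately show ?thesis unfolding irred_set_def by blast
qed

definition Diag :: "4 \<Rightarrow> ('a point \<times> 'a point) set" where
  "Diag n = Delta c (proj_pt (Opt n))"

lemma Diag_eq: "Diag n = {(proj_pt (\<lambda>i. y (i - n)), proj_pt y) | y. y \<in> C}"
proof -
  have "Diag n = {(ell_add c (proj_pt (Opt n)) (proj_pt y), proj_pt y) | y. y \<in> C}"
    unfolding Diag_def Delta_def using curve_iff by auto
  also have "\<dots> = {(proj_pt (\<lambda>i. y (i - n)), proj_pt y) | y. y \<in> C}"
    using add_Opt by (metis (no_types, lifting))
  finally show ?thesis .
qed

lemma Diag_subset: "Diag n \<subseteq> mu4_surface c"
  unfolding Diag_eq mu4_surface_def using C_shift by auto

lemma mem_Diag:
  assumes "x \<in> C" "y \<in> C"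
  shows "(proj_pt x, proj_pt y) \<in> Diag n \<longleftrightarrow> (\<exists>a. a \<noteq> 0 \<and> x = (\<lambda>i. a * y (i - n)))"
proof
  assume "(proj_pt x, proj_pt y) \<in> Diag n"
  then obtain w where w: "w \<in> C" "proj_pt x = proj_pt (\<lambda>i. w (i - n))" "proj_pt y = proj_pt w"
    unfolding Diag_eq by blast
  obtain a where a: "a \<noteq> 0" "w = (\<lambda>i. a * y i)" using w(3) unfolding proj_pt_eq_iff by blast
  have "x \<in> proj_pt (\<lambda>i. w (i - n))" using w(2) self_mem_proj_pt[of x] by simp
  then obtain b where b: "b \<noteq> 0" "x = (\<lambda>i. b * w (i - n))" unfolding mem_proj_pt by blast
  show "\<exists>a. a \<noteq> 0 \<and> x = (\<lambda>i. a * y (i - n))"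
    by (rule exI[of _ "b * a"]) (simp add: a b mult.assoc)
next
  assume "\<exists>a. a \<noteq> 0 \<and> x = (\<lambda>i. a * y (i - n))"
  then obtain a where "a \<noteq> 0" "x = (\<lambda>i. a * y (i - n))" by blast
  then have "proj_pt x = proj_pt (\<lambda>i. y (i - n))" using proj_pt_scale[of a "\<lambda>i. y (i - n)"] by simp
  then show "(proj_pt x, proj_pt y) \<in> Diag n" unfolding Diag_eq using assms by blast
qed

lemma bicone_Diag: "bicone (Diag n) = {case_sum (\<lambda>i. a * y (i - n)) y | a y. a \<noteq> 0 \<and> y \<in> C}"
proof (intro Set.set_eqI iffI)
  fix z assume "z \<in> bicone (Diag n)"
  then obtain x y where *: "x \<in> C" "y \<in> C" "z = case_sum x y" "(proj_pt x, proj_pt y) \<in> Diag n"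
    unfolding bicone_iff[OF Diag_subset] by blast
  obtain a where "a \<noteq> 0" "x = (\<lambda>i. a * y (i - n))" using *(4) unfolding mem_Diag[OF *(1,2)] by blast
  with *(2,3) show "z \<in> {case_sum (\<lambda>i. a * y (i - n)) y | a y. a \<noteq> 0 \<and> y \<in> C}" by blast
next
  fix z assume "z \<in> {case_sum (\<lambda>i. a * y (i - n)) y | a y. a \<noteq> 0 \<and> y \<in> C}"
  then obtain a y where *: "z = case_sum (\<lambda>i. a * y (i - n)) y" "a \<noteq> 0" "y \<in> C" by blast
  have x: "(\<lambda>i. a * y (i - n)) \<in> C" using C_scale[OF C_shift[OF *(3)] *(2)] .
  show "z \<in> bicone (Diag n)"
    unfolding bicone_iff[OF Diag_subset] using x * mem_Diag[OF x *(3)] by blast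
qed

lemma irred_Diag: "irred_set (bicone (Diag n))"
proof -
  define Q where "Q = (\<lambda>q v. eval_mpoly q (case_sum (\<lambda>i. Var (i - n)) Var v)) ` C"
  have "irred_set Q" unfolding Q_def by (rule irred_set_image[OF irred_C])
  then have "irred_set {\<lambda>v. if v \<in> range Inl then a * q v else q v | a q. a \<noteq> 0 \<and> q \<in> Q}" by (rule irred_set_scale)
  moreover have "{\<lambda>v. if v \<in> range Inl then a * q v else q v | a q. a \<noteq> 0 \<and> q \<in> Q} = bicone (Diag n)"
  proof -
    define q where "q = (\<lambda>y v. eval_mpoly y (case_sum (\<lambda>i. Var (i - n)) Var v) :: 'a)"
    have q: "(\<lambda>v. if v \<in> range Inl then a * q y v else q y v) = case_sum (\<lambda>i. a * y (i - n)) y" for a :: 'a and y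
      by (rule ext) (auto simp: q_def split: sum.split)
    have Q: "Q = q ` C" unfolding Q_def q_def ..
    show ?thesis unfolding bicone_Diag Q q[symmetric] by blast
  qed
  ultimately show ?thesis by simp
qed

text \<open>Translation by \<open>n T\<close> is the cyclic shift of the coordinates by \<open>n\<close>, so that its graph is cut out by
  the minors of \<open>Y\<close> and the shifted \<open>X\<close>.\<close>

definition diag_eqs :: "4 \<Rightarrow> (4 + 4, 'a) mpoly set" where
  "diag_eqs n = {VX (i + n) * VY j - VX (j + n) * VY i | i j. True}"

lemma Diag_closed: "Diag n = {z \<in> mu4_surface c. \<forall>F\<in>diag_eqs n. F \<in> vanishing_ideal (bicone {z})}"
proof (intro Set.set_eqI iffI)
  fix z assume z: "z \<in> Diag n"
  then have "bicone {z} \<subseteq> bicone (Diag n)" by (intro bicone_mono) simp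
  moreover have "F \<in> vanishing_ideal (bicone (Diag n))" if "F \<in> diag_eqs n" for F
    using that unfolding diag_eqs_def bicone_Diag by (auto simp: vanishing_ideal_def)
  ultimately show "z \<in> {z \<in> mu4_surface c. \<forall>F\<in>diag_eqs n. F \<in> vanishing_ideal (bicone {z})}"
    using z Diag_subset vanishing_ideal_mono by blast
next
  fix z assume "z \<in> {z \<in> mu4_surface c. \<forall>F\<in>diag_eqs n. F \<in> vanishing_ideal (bicone {z})}"
  then have z: "z \<in> mu4_surface c" "\<And>F. F \<in> diag_eqs n \<Longrightarrow> F \<in> vanishing_ideal (bicone {z})" by auto
  obtain x y where xy: "x \<in> C" "y \<in> C" "z = (proj_pt x, proj_pt y)" using surface_point z by blast
  have in_z: "case_sum x y \<in> bicone {z}" unfolding xy bicone_def using self_mem_proj_pt by blast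
  have eq: "x (i + n) * y j = x (j + n) * y i" for i j
  proof -
    have "VX (i + n) * VY j - VX (j + n) * VY i \<in> vanishing_ideal (bicone {z})"
      by (rule z(2)) (auto simp: diag_eqs_def)
    from vanishing_idealD[OF this in_z] show ?thesis by simp
  qed
  obtain j where j: "y j \<noteq> 0" using C_nonzero[OF xy(2)] by blast
  have x: "x i = (x (j + n) / y j) * y (i - n)" for i
    using eq[of "i - n" j] j by (simp add: field_simps)
  obtain i where "x i \<noteq> 0" using C_nonzero[OF xy(1)] by blast
  then have "x (j + n) / y j \<noteq> 0" using x[of i] by auto
  then show "z \<in> Diag n" unfolding xy(3) mem_Diag[OF xy(1,2)] using x by blast
qed

lemma diag_eqs_bihomogeneous: "F \<in> diag_eqs n \<Longrightarrow> bihomogeneous 1 1 F"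
  unfolding diag_eqs_def
  using bihomogeneous_mult[OF bihomogeneous_Inl bihomogeneous_Inr] by (auto intro!: bihomogeneous_diff)

lemma zirreducible_Diag: "zirreducible c (Diag n)"
proof (rule zirreducible_if_irred[OF _ irred_Diag])
  show "zclosed c (Diag n)" unfolding zclosed_def
    by (rule exI[of _ "diag_eqs n"]) (use Diag_closed diag_eqs_bihomogeneous in blast)
qed

section \<open>The local parameter along a diagonal\<close>

text \<open>\<open>tpar\<close> 2 with the point p replaced by the second factor and X shifted by
  n.\<close>

definition tdiag :: "4 \<Rightarrow> (4 + 4, 'a) mpoly" where
  "tdiag n = VY 2 * (VX (1 + n) + VX (3 + n)) + (VY 1 + VY 3) * VX (2 + n)"

text \<open>Tests at ((n + 1) T, T); at T the coordinates X0, X1, X2 and the sum X1 + X3 are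
  nonzero, which keeps the denominators below nonzero.\<close>

lemma Diag_nonvanishing:
  assumes "eval_mpoly (case_sum (\<lambda>i. Opt 1 (i - n)) (Opt 1)) F \<noteq> 0"
  shows "F \<notin> vanishing_ideal (bicone (Diag n))"
proof
  assume F: "F \<in> vanishing_ideal (bicone (Diag n))"
  have "case_sum (\<lambda>i. 1 * Opt 1 (i - n)) (Opt 1) \<in> bicone (Diag n)"
    unfolding bicone_Diag using Opt_in_C one_neq_zero by blast
  from vanishing_idealD[OF F this] show False using assms by simp
qed

lemma tdiag_square:
  assumes x: "x \<in> C" and y: "y \<in> C"
  shows "(y 2 * (x 1 + x 3) + (y 1 + y 3) * x 2)^2 = c^2 * x 2 * y 2 * (y 2 * x 0 + x 2 * y 0)"
  by (simp only: ring2 C_squares[OF x] C_squares[OF y])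

lemma C_shift_inv: "x \<in> C \<Longrightarrow> (\<lambda>k. x (k + n)) \<in> C"
  using C_shift[of x "- n"] by simp

text \<open>The argument of \<open>local_param_point\<close> with p replaced by the varying y. The
  retraction replaces x by the shift of y, scaled to agree with x in the coordinate 2 + n.\<close>

lemma local_param_Diag: "local_param V (bicone (Diag n)) (tdiag n)"
proof -
  let ?Z = "bicone (Diag n)" and ?t = "tdiag n"
  let ?L = "local_ideal V ?Z ?t"
  note Z = irred_Diag[of n]
  have tL: "?t * G \<in> ?L" for G
    by (rule local_idealI[of 1 _ _ _ G]) (simp_all add: irred_set_one[OF Z])
  have cong: "F \<in> ?L" if "G \<in> ?L" "\<And>x y. x \<in> C \<Longrightarrow> y \<in> C \<Longrightarrow> eval_mpoly (case_sum (\<lambda>i. x (i - n)) y) F = eval_mpoly (case_sum (\<lambda>i. x (i - n)) y) G" for F G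
  proof (rule local_ideal_cong[OF Z that(1)])
    fix z assume "z \<in> V"
    then obtain x y where xy: "x \<in> C" "y \<in> C" "z = case_sum x y" unfolding mem_V by blast
    then show "eval_mpoly z F = eval_mpoly z G" using that(2)[OF C_shift_inv[OF xy(1), of n] xy(2)] by simp
  qed
  have 0: "VY 2 * VX (0 + n) - VX (2 + n) * VY 0 \<in> ?L" (is "?A0 \<in> _")
  proof (rule local_ideal_cancel[OF Z, of "Const (c^2) * VX (2 + n) * VY 2"])
    show "Const (c^2) * VX (2 + n) * VY 2 \<notin> vanishing_ideal ?Z"
      by (rule Diag_nonvanishing) (simp add: Opt_def c0)
    show "Const (c^2) * VX (2 + n) * VY 2 * ?A0 \<in> ?L"
    proof (rule cong[OF tL[of ?t]])
      fix x y assume "x \<in> C" "y \<in> C"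
      from tdiag_square[OF this] show "eval_mpoly (case_sum (\<lambda>i. x (i - n)) y) (Const (c^2) * VX (2 + n) * VY 2 * ?A0) =
          eval_mpoly (case_sum (\<lambda>i. x (i - n)) y) (?t * ?t)"
        by (simp add: tdiag_def minus_eq power2_eq_square)
    qed
  qed
  have 3: "VY 2 * VX (3 + n) - VX (2 + n) * VY 3 \<in> ?L" (is "?A3 \<in> _")
  proof (rule local_ideal_cancel[OF Z, of "Const (c^2) * (VY 2 * VX (3 + n) + VY 1 * VX (2 + n))"])
    show "Const (c^2) * (VY 2 * VX (3 + n) + VY 1 * VX (2 + n)) \<notin> vanishing_ideal ?Z"
      by (rule Diag_nonvanishing) (simp add: Opt_def c0)
    show "Const (c^2) * (VY 2 * VX (3 + n) + VY 1 * VX (2 + n)) * ?A3 \<in> ?L"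
    proof (rule cong)
      show "?t * (Const (c^2) * VY 2 * VX (3 + n)) + ?A0 * ?A0 \<in> ?L"
        by (intro local_ideal_add[OF Z] tL local_ideal_mult 0)
      fix x y assume x: "x \<in> C" and y: "y \<in> C"
      have "c^2 * (y 2 * x 3 + y 1 * x 2) * (y 2 * x 3 + x 2 * y 3) =
         (y 2 * (x 1 + x 3) + (y 1 + y 3) * x 2) * (c^2 * y 2 * x 3) + (y 2 * x 0 + x 2 * y 0) * (y 2 * x 0 + x 2 * y 0)"
        by (simp only: ring2 C_squares[OF x] C_squares[OF y])
      then show "eval_mpoly (case_sum (\<lambda>i. x (i - n)) y) (Const (c^2) * (VY 2 * VX (3 + n) + VY 1 * VX (2 + n)) * ?A3) =
          eval_mpoly (case_sum (\<lambda>i. x (i - n)) y) (?t * (Const (c^2) * VY 2 * VX (3 + n)) + ?A0 * ?A0)"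
        by (simp add: tdiag_def minus_eq)
    qed
  qed
  have 1: "VY 2 * VX (1 + n) - VX (2 + n) * VY 1 \<in> ?L"
  proof (rule cong)
    show "?t * 1 + (- 1) * ?A3 \<in> ?L"
      by (intro local_ideal_add[OF Z] tL local_ideal_mult 3)
    fix x y :: "4 \<Rightarrow> 'a"
    have "y 2 * x 1 + x 2 * y 1 = (y 2 * (x 1 + x 3) + (y 1 + y 3) * x 2) + (y 2 * x 3 + x 2 * y 3)" by (simp only: ring2)
    then show "eval_mpoly (case_sum (\<lambda>i. x (i - n)) y) (VY 2 * VX (1 + n) - VX (2 + n) * VY 1) =
       eval_mpoly (case_sum (\<lambda>i. x (i - n)) y) (?t * 1 + (- 1) * ?A3)"
      by (simp add: tdiag_def minus_eq)
  qed
  have 2: "VY 2 * VX (2 + n) - VX (2 + n) * VY 2 \<in> ?L"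
    by (rule local_ideal_vanishing[OF Z]) (simp add: mult.commute)
  have "vanishing_ideal ?Z \<subseteq> ?L"
  proof (rule vanishing_ideal_subset_local_ideal[OF Z, of "VX (2 + n) * VY 2" "VY 2" "case_sum (\<lambda>j. VX (2 + n) * VY (j - n)) (\<lambda>j. VY 2 * VY j)"])
    show "VX (2 + n) * VY 2 \<notin> vanishing_ideal ?Z" "VY 2 \<notin> vanishing_ideal ?Z"
      by (rule Diag_nonvanishing, simp add: Opt_def)+
    fix v :: "4 + 4"
    have k: "VY 2 * VX (k + n) - VX (2 + n) * VY k \<in> ?L" for k
      using exhaust_4[of k] 0 1 2 3 by (elim disjE) (simp_all only:)
    show "VY 2 * Var v - case_sum (\<lambda>j. VX (2 + n) * VY (j - n)) (\<lambda>j. VY 2 * VY j) v \<in> ?L"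
    proof (cases v)
      case (Inl j) then show ?thesis using k[of "j - n"] by simp
    next
      case (Inr j) then show ?thesis using local_ideal_vanishing[OF Z, of 0] by simp
    qed
  next
    fix z assume z: "z \<in> V" "eval_mpoly z (VX (2 + n) * VY 2) \<noteq> 0"
    then obtain x y where xy: "x \<in> C" "y \<in> C" "z = case_sum x y" unfolding mem_V by blast
    have nz: "x (2 + n) \<noteq> 0" "y 2 \<noteq> 0" using z(2) xy(3) by auto
    have "(\<lambda>v. eval_mpoly z (case_sum (\<lambda>j. VX (2 + n) * VY (j - n)) (\<lambda>j. VY 2 * VY j) v) / eval_mpoly z (VY 2)) =
        case_sum (\<lambda>i. (x (2 + n) / y 2) * y (i - n)) y"
      by (rule ext) (use nz in \<open>auto simp: xy(3) split: sum.split\<close>)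
    moreover have "case_sum (\<lambda>i. (x (2 + n) / y 2) * y (i - n)) y \<in> ?Z"
    proof -
      have "x (2 + n) / y 2 \<noteq> 0" using nz by simp
      then show ?thesis unfolding bicone_Diag using xy(2) by blast
    qed
    ultimately show "eval_mpoly z (VY 2) \<noteq> 0 \<and> (\<lambda>v. eval_mpoly z (case_sum (\<lambda>j. VX (2 + n) * VY (j - n)) (\<lambda>j. VY 2 * VY j) v) / eval_mpoly z (VY 2)) \<in> ?Z"
      using nz by (simp add: xy(3))
  qed
  moreover have "?t \<in> vanishing_ideal ?Z"
  proof (rule vanishing_idealI)
    fix z assume "z \<in> ?Z"
    then obtain a y where "z = case_sum (\<lambda>i. a * y (i - n)) y" unfolding bicone_Diag by blast
    then have "eval_mpoly z ?t = y 2 * (a * y 1 + a * y 3) + (y 1 + y 3) * (a * y 2)" by (simp add: tdiag_def)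
    also have "\<dots> = 0" by (simp only: ring2)
    finally show "eval_mpoly z ?t = 0" .
  qed
  moreover have "?t \<notin> vanishing_ideal V"
  proof
    assume "?t \<in> vanishing_ideal V"
    moreover have "case_sum (Opt (2 + n)) (Opt 1) \<in> V" by (intro case_sum_in_V Opt_in_C)
    ultimately have "eval_mpoly (case_sum (Opt (2 + n)) (Opt 1)) ?t = 0" by (rule vanishing_idealD)
    then show False using c0 by (simp add: tdiag_def Opt_def add_self)
  qed
  moreover have "?Z \<subseteq> V" by (rule bicone_mono[OF Diag_subset])
  ultimately show ?thesis unfolding local_param_def using irred_V Z by blast
qed

section \<open>Orders of vanishing along the diagonals\<close>

text \<open>Fixing y0 in the second factor reduces the bound to the curve: there
  \<open>tdiag\<close> becomes a constant times v + v0, and F has a pole of order at most 4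
  d.\<close>

lemma order_Diag_exists:
  assumes hom: "bihomogeneous d e F" and F: "F \<notin> vanishing_ideal V"
  obtains k where "has_order V (bicone (Diag n)) (tdiag n) F k"
proof (rule has_order_exists[OF local_param_Diag, of n F "2 * (d * 4)"])
  fix k H G
  assume H: "H \<notin> vanishing_ideal (bicone (Diag n))" "H * F - tdiag n ^ k * G \<in> vanishing_ideal V"
  obtain z where z: "z \<in> bicone (Diag n)" "eval_mpoly z H \<noteq> 0" using H(1) by (rule not_vanishing_idealE)
  obtain a y2 where a: "a \<noteq> 0" "y2 \<in> C" "z = case_sum (\<lambda>i. a * y2 (i - n)) y2" using z(1) unfolding bicone_Diag by blast
  obtain x1 y1 where 1: "x1 \<in> C" "y1 \<in> C" "eval_mpoly (case_sum x1 y1) F \<noteq> 0" using F unfolding vanishing_V_iff by blast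
  define Fy where "Fy = subst_mpoly (case_sum (\<lambda>i. Const (x1 i)) Var) F"
  define Hy where "Hy = subst_mpoly (case_sum (\<lambda>i. Const a * Var (i - n)) Var) H"
  have Fy: "eval_mpoly y Fy = eval_mpoly (case_sum x1 y) F" for y
  proof -
    have "(\<lambda>v. eval_mpoly y (case_sum (\<lambda>i. Const (x1 i)) Var v)) = case_sum x1 y" by (rule ext) (simp split: sum.split)
    then show ?thesis by (simp add: Fy_def)
  qed
  have Hy: "eval_mpoly y Hy = eval_mpoly (case_sum (\<lambda>i. a * y (i - n)) y) H" for y
  proof -
    have "(\<lambda>v. eval_mpoly y (case_sum (\<lambda>i. Const a * Var (i - n)) Var v)) = case_sum (\<lambda>i. a * y (i - n)) y"
      by (rule ext) (simp split: sum.split)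
    then show ?thesis by (simp add: Hy_def)
  qed
  have "Fy \<notin> vanishing_ideal C"
  proof
    assume "Fy \<in> vanishing_ideal C"
    from vanishing_idealD[OF this 1(2)] 1(3) show False unfolding Fy by blast
  qed
  moreover have "Hy \<notin> vanishing_ideal C"
  proof
    assume "Hy \<in> vanishing_ideal C"
    from vanishing_idealD[OF this a(2)] z(2) show False unfolding Hy a(3) by blast
  qed
  \<comment> \<open>The point y0 must keep F nonzero somewhere on its fibre, keep H nonzero where
    the fibre meets the diagonal, and lie in the chart. These are nonempty open conditions on an
    irreducible curve.\<close>
  ultimately have "Fy * Hy * Var 2 \<notin> vanishing_ideal C" by (intro irred_set_mult[OF irred_C] Var2_C)
  then obtain y0 where y0: "y0 \<in> C" "eval_mpoly y0 (Fy * Hy * Var 2) \<noteq> 0" by (rule not_vanishing_idealE)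
  then have nz: "eval_mpoly (case_sum x1 y0) F \<noteq> 0" "eval_mpoly (case_sum (\<lambda>i. a * y0 (i - n)) y0) H \<noteq> 0" "y0 2 \<noteq> 0"
    by (auto simp: Fy Hy)
  define s where "s = y0 2 / c"
  have s: "s \<noteq> 0" using nz(3) c0 by (simp add: s_def)
  obtain v0 Y0 where v0: "onE v0 Y0" "y0 = (\<lambda>i. s * apt v0 Y0 i)" using C_apt[OF y0(1) nz(3)] unfolding s_def by blast
  define w where "w = a * s"
  have w: "w \<noteq> 0" using a(1) s by (simp add: w_def)
  define x where "x = (\<lambda>v Y i. w * apt v Y (i - n))"
  have xC: "x v Y \<in> C" if "onE v Y" for v Y
    unfolding x_def using C_scale[OF C_shift[OF apt_in_C[OF that]] w] .
  have reg_x: "regular 4 (\<lambda>v Y. x v Y i)" for i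
    unfolding x_def using regular_mult[OF regular_const regular_apt, of 0 w] by simp
  have reg_xy: "reg (\<lambda>v Y. case_sum (x v Y) y0 i)" for i
    using reg_x reg_const by (cases i) (auto simp: reg_def)
  obtain v1 Y1 where v1: "onE v1 Y1" "eval_mpoly (case_sum (x v1 Y1) y0) F \<noteq> 0"
  proof (rule ccontr)
    assume no: "\<not> thesis"
    have z: "eval_mpoly (case_sum (x v Y) y0) F = 0" if "onE v Y" for v Y
      using that no \<open>\<And>v1 Y1. \<lbrakk>onE v1 Y1; eval_mpoly (case_sum (x v1 Y1) y0) F \<noteq> 0\<rbrakk> \<Longrightarrow> thesis\<close> by blast
    define Q where "Q = subst_mpoly (case_sum (\<lambda>i. Var (i - n)) (\<lambda>i. Const (y0 i))) F"
    have Q: "eval_mpoly q Q = eval_mpoly (case_sum (\<lambda>i. q (i - n)) y0) F" for q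
    proof -
      have "(\<lambda>v. eval_mpoly q (case_sum (\<lambda>i. Var (i - n)) (\<lambda>i. Const (y0 i)) v)) = case_sum (\<lambda>i. q (i - n)) y0"
        by (rule ext) (simp split: sum.split)
      then show ?thesis by (simp add: Q_def)
    qed
    have "Q \<in> vanishing_ideal C"
    proof (rule vanishing_chart)
      fix u v Y :: 'a assume Y: "onE v Y"
      have "eval_mpoly (case_sum (\<lambda>i. (u / w) * x v Y i) (\<lambda>i. 1 * y0 i)) F = (u / w) ^ d * 1 ^ e * eval_mpoly (case_sum (x v Y) y0) F"
        by (rule eval_bihomogeneous_scale[OF hom])
      moreover have "(\<lambda>i. (u / w) * x v Y i) = (\<lambda>i. u * apt v Y (i - n))" unfolding x_def using w by simp
      ultimately show "eval_mpoly (\<lambda>i. u * apt v Y i) Q = 0" unfolding Q using z[OF Y] by simp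
    qed
    from vanishing_idealD[OF this C_shift_inv[OF 1(1), of n]] nz(1) show False unfolding Q by simp
  qed
  define m where "m = s * w * c * c * c"
  have t: "eval_mpoly (case_sum (x v Y) y0) (tdiag n) = m * (v + v0)" for v Y
  proof -
    have "eval_mpoly (case_sum (x v Y) y0) (tdiag n) = s * apt v0 Y0 2 * (w * apt v Y 1 + w * apt v Y 3) + (s * apt v0 Y0 1 + s * apt v0 Y0 3) * (w * apt v Y 2)"
      by (simp add: tdiag_def x_def v0(2) del: apt_simps)
    also have "\<dots> = m * (v + v0)" unfolding apt_simps m_def by (simp only: ring2)
    finally show ?thesis .
  qed
  show "k \<le> 2 * (d * 4)"
  proof (rule vanishing_bound[OF reg_eval[where F = H, OF reg_xy] reg_eval[where F = G, OF reg_xy] _ regular_bihomogeneous[OF hom reg_x] v1])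
    show "reg (\<lambda>v Y. m * m * (v + v0))" by (intro reg_mult reg_add reg_const reg_v)
    show "onE v0 Y0" by (rule v0)
    have "x v0 Y0 = (\<lambda>i. a * y0 (i - n))" by (simp add: x_def v0(2) w_def mult.assoc del: apt_simps)
    then show "eval_mpoly (case_sum (x v0 Y0) y0) H \<noteq> 0" using nz(2) by simp
    fix v Y assume Y: "onE v Y"
    show "eval_mpoly (case_sum (x v Y) y0) (tdiag n) ^ 2 = (v - v0) * (m * m * (v + v0))"
      unfolding t by (simp only: ring2)
    show "eval_mpoly (case_sum (x v Y) y0) H * eval_mpoly (case_sum (x v Y) y0) F =
       eval_mpoly (case_sum (x v Y) y0) (tdiag n) ^ k * eval_mpoly (case_sum (x v Y) y0) G"
      using vanishing_idealD[OF H(2) case_sum_in_V[OF xC[OF Y] y0(1)]] by simp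
  qed
qed (rule that)

text \<open>Let W be irreducible, strictly larger than the diagonal and not the surface. A form
  vanishing on W but not on the surface is a power of t times a unit along the diagonal; so t
  vanishes on W, and with it the whole ideal of the diagonal.\<close>

lemma prime_divisor_Diag: "prime_divisor c (Diag n)"
proof -
  let ?Z = "bicone (Diag n)" and ?t = "tdiag n"
  have lp: "?t \<in> vanishing_ideal ?Z" "?t \<notin> vanishing_ideal V" "vanishing_ideal ?Z \<subseteq> local_ideal V ?Z ?t"
    using local_param_Diag[of n] by (auto simp: local_param_def)
  have "W = mu4_surface c" if W: "zirreducible c W" "Diag n \<subset> W" for W
  proof (rule ccontr)
    assume ne: "W \<noteq> mu4_surface c"
    have closed: "zclosed c W" using W(1) by (simp add: zirreducible_def)
    then obtain A where A: "\<forall>F\<in>A. \<exists>d e. bihomogeneous d e F" "W = {z \<in> mu4_surface c. \<forall>F\<in>A. F \<in> vanishing_ideal (bicone {z})}"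
      unfolding zclosed_def by blast
    obtain F z where F: "F \<in> A" "z \<in> mu4_surface c" "F \<notin> vanishing_ideal (bicone {z})" using A(2) ne by blast
    have FW: "F \<in> vanishing_ideal (bicone W)" using A(2) F(1) vanishing_bicone_iff[of F W] by blast
    have FV: "F \<notin> vanishing_ideal V" using F(2,3) vanishing_bicone_iff[of F "mu4_surface c"] by blast
    have VW: "vanishing_ideal V \<subseteq> vanishing_ideal (bicone W)" and WZ: "vanishing_ideal (bicone W) \<subseteq> vanishing_ideal ?Z"
      using zclosed_subset[OF closed] W(2) by (intro vanishing_ideal_mono bicone_mono; blast)+
    note irr = irred_if_zirreducible[OF W(1)]
    obtain d e where "bihomogeneous d e F" using A(1) F(1) by blast
    from order_Diag_exists[OF this FV] obtain k where "has_order V ?Z ?t F k" .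
    then obtain H U where H: "U \<notin> vanishing_ideal ?Z" "H * F - ?t ^ k * U \<in> vanishing_ideal V" by (auto simp: has_order_def)
    have "H * F - (H * F - ?t ^ k * U) \<in> vanishing_ideal (bicone W)"
      by (rule vanishing_ideal_diff[OF vanishing_ideal_mult[OF FW] subsetD[OF VW H(2)]])
    then have "?t ^ k * U \<in> vanishing_ideal (bicone W)" by simp
    then have t: "?t \<in> vanishing_ideal (bicone W)" using irred_setD[OF irr] irred_set_power[OF irr] H(1) WZ by blast
    have "G \<in> vanishing_ideal (bicone W)" if G: "G \<in> vanishing_ideal ?Z" for G
    proof -
      obtain H' G' where H': "H' \<notin> vanishing_ideal ?Z" "H' * G - ?t * G' \<in> vanishing_ideal V"
        using lp(3) G unfolding local_ideal_def by blast
      have "(H' * G - ?t * G') + G' * ?t \<in> vanishing_ideal (bicone W)"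
        by (rule vanishing_ideal_add[OF subsetD[OF VW H'(2)] vanishing_ideal_mult[OF t]])
      then have "H' * G \<in> vanishing_ideal (bicone W)" by (simp add: mult.commute)
      then show ?thesis using irred_setD[OF irr] H'(1) WZ by blast
    qed
    moreover have "F \<in> vanishing_ideal ?Z" if "F \<in> diag_eqs n" for F
      unfolding vanishing_bicone_iff[of F "Diag n"] using Diag_closed[of n] that by blast
    ultimately have "W \<subseteq> Diag n"
      unfolding Diag_closed using zclosed_subset[OF closed] vanishing_bicone_iff[of _ W] by blast
    then show False using W(2) by blast
  qed
  moreover have "Diag n \<noteq> mu4_surface c" using lp(1,2) by auto
  ultimately show ?thesis unfolding prime_divisor_def using zirreducible_Diag by blast
qed

section \<open>Exceptional divisors\<close>

lemma tdiag_fourth_power: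
  assumes "x \<in> C" "y \<in> C"
  shows "(c^2 * x (2 + n) * y 2)^2 * lv (n + 2) x y (n + 2) = eval_mpoly (case_sum x y) (tdiag n) ^ 4"
proof -
  have "eval_mpoly (case_sum x y) (tdiag n) ^ 4 = ((y 2 * (x (1 + n) + x (3 + n)) + (y 1 + y 3) * x (2 + n))^2)^2"
    by (simp add: tdiag_def flip: power_mult)
  also have "\<dots> = (c^2 * x (2 + n) * y 2 * (y 2 * x (0 + n) + x (2 + n) * y 0))^2"
    using tdiag_square[OF C_shift_inv[OF assms(1), of n] assms(2)] by simp
  also have "\<dots> = (c^2 * x (2 + n) * y 2)^2 * (x (0 + n) * y 2 + x (2 + n) * y 0)^2"
    by (simp add: power_mult_distrib mult.commute)
  also have "(x (0 + n) * y 2 + x (2 + n) * y 0)^2 = lv (n + 2) x y (n + 2)"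
    by (subst lv_normal) (simp add: lv_simps)
  finally show ?thesis ..
qed

text \<open>Law \<open>n\<close> does not vanish identically on the diagonal, and the two laws are proportional; hence the
  order of the entry \<open>n + 2\<close> bounds the orders of the other entries of law \<open>n + 2\<close> from below.\<close>

lemma order_law_Diag:
  "(INF i. order_along V (bicone (Diag n)) (mu4_laws c (n + 2) i)) = 4"
proof (rule antisym)
  let ?Z = "bicone (Diag n)" and ?t = "tdiag n"
  define H where "H = (Const (c^2) * VX (2 + n) * VY 2)^2"
  have H: "H \<notin> vanishing_ideal ?Z" unfolding H_def by (rule Diag_nonvanishing) (simp add: Opt_def c0)
  have evH: "eval_mpoly (case_sum x y) H = (c^2 * x (2 + n) * y 2)^2" for x y by (simp add: H_def)
  have "H * mu4_laws c (n + 2) (n + 2) - ?t ^ 4 * 1 \<in> vanishing_ideal V"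
    unfolding vanishing_V_iff using tdiag_fourth_power[of _ _ n] by (simp add: evH flip: lv_def)
  then have "has_order V ?Z ?t (mu4_laws c (n + 2) (n + 2)) 4"
    using H irred_set_one[OF irred_Diag] by (intro has_orderI[of H])
  from order_along_eq[OF local_param_Diag this]
  have "order_along V ?Z (mu4_laws c (n + 2) (n + 2)) = 4" by (simp add: numeral_eq_enat)
  then show "(INF i. order_along V ?Z (mu4_laws c (n + 2) i)) \<le> 4" by (metis INF_lower UNIV_I)
  have "mu4_laws c n (n + 2) \<notin> vanishing_ideal ?Z"
    by (rule Diag_nonvanishing, fold lv_def, subst lv_shift) (simp add: lv_simps Opt_def c0)
  then have HL: "H * mu4_laws c n (n + 2) \<notin> vanishing_ideal ?Z" by (rule irred_set_mult[OF irred_Diag H])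
  show "4 \<le> (INF i. order_along V ?Z (mu4_laws c (n + 2) i))"
  proof (rule INF_greatest)
    fix i
    have "H * mu4_laws c n (n + 2) * mu4_laws c (n + 2) i - ?t ^ 4 * mu4_laws c n i \<in> vanishing_ideal V"
      unfolding vanishing_V_iff
    proof (intro ballI)
      fix x y assume xy: "x \<in> C" "y \<in> C"
      show "eval_mpoly (case_sum x y) (H * mu4_laws c n (n + 2) * mu4_laws c (n + 2) i - ?t ^ 4 * mu4_laws c n i) = 0"
        using lv_minor[OF xy, of "n + 2" i n "n + 2"]
        by (simp add: evH mult_ac flip: lv_def tdiag_fourth_power[OF xy])
    qed
    from order_along_ge[OF _ HL this] local_param_Diag[of n]
    show "4 \<le> order_along V ?Z (mu4_laws c (n + 2) i)" by (simp add: local_param_def numeral_eq_enat)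
  qed
qed

text \<open>On the chart, entry 2 vanishes only if the v-coordinates agree, and at conjugate points
  entry 0 is (c^2 v)^4. Pairs involving O are settled by entry 2.\<close>

lemma law_zeros_diagonal:
  assumes x: "x \<in> C" and y: "y \<in> C" and z: "\<And>i. lv 2 x y i = 0"
  obtains a where "a \<noteq> 0" "x = (\<lambda>i. a * y i)"
  using x
proof (cases rule: C_cases)
  case (infinite u)
  have "u^2 * 1^2 * lv 2 (Opt 0) y 2 = 0"
    using z[of 2] lv_scale[of 2 u "Opt 0" 1 y 2] unfolding infinite(2) by simp
  then have y2: "y 2 = 0" using infinite(1) c0 by (simp add: lv_O_left[OF y])
  show ?thesis using y
  proof (cases rule: C_cases)
    case (infinite u')
    show ?thesis by (rule that[of "u / u'"]) (use infinite \<open>u \<noteq> 0\<close> \<open>x = _\<close> in auto)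
  next
    case (affine u' v Y) then show ?thesis using y2 c0 by simp
  qed
next
  case (affine u v Y)
  note xa = affine
  show ?thesis using y
  proof (cases rule: C_cases)
    case (infinite u')
    have "1^2 * u'^2 * lv 2 x (Opt 0) 2 = 0"
      using z[of 2] lv_scale[of 2 1 x u' "Opt 0" 2] unfolding infinite(2) by simp
    then have "x 2 = 0" using infinite(1) c0 by (simp add: lv_O_right[OF x])
    then show ?thesis using xa c0 by simp
  next
    case (affine u' w Z)
    have z': "lv 2 (apt v Y) (apt w Z) i = 0" for i
      using z[of i] lv_scale[of 2 u "apt v Y" u' "apt w Z" i] xa(1) affine(1) unfolding xa(3) affine(3) by simp
    have "(c * (v * v)) * c + c * (c * (w * w)) = 0" using z'[of 2] by (simp add: lv_simps)
    then have "(c * v)^2 = (c * w)^2" unfolding add_eq_0 by (simp add: power2_eq_square mult_ac)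
    then have vw: "w = v" using c0 by (simp add: square_eq_iff2)
    have "Z = Y"
    proof (rule ccontr)
      assume "Z \<noteq> Y"
      then have Z: "Z = Y + c * (c * v)" using onE_two xa(2) affine(2) vw by blast
      have "0 = lv 2 (apt v Y) (apt v (Y + c * (c * v))) 0" using z'[of 0] unfolding vw Z by simp
      also have "\<dots> = (c * (c * v))^4" unfolding lv_simps apt_simps by (simp only: ring2 power4)
      finally have "v = 0" using c0 by simp
      then show False using Z \<open>Z \<noteq> Y\<close> by simp
    qed
    then show ?thesis
      by (intro that[of "u / u'"]) (use xa affine vw in \<open>auto simp del: apt_simps\<close>)
  qed
qed

lemma law_zeros:
  assumes x: "x \<in> C" and y: "y \<in> C" and z: "\<And>i. lv (n + 2) x y i = 0"
  shows "(proj_pt x, proj_pt y) \<in> Diag n"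
proof -
  have "lv 2 (\<lambda>k. x (k + n)) y i = 0" for i
    using z[of "i + n"] by (subst (asm) lv_normal) simp
  from law_zeros_diagonal[OF C_shift_inv[OF x] y this]
  obtain a where a: "a \<noteq> 0" "(\<lambda>k. x (k + n)) = (\<lambda>i. a * y i)" .
  have "x = (\<lambda>i. a * y (i - n))"
  proof
    fix i show "x i = a * y (i - n)" using fun_cong[OF a(2), of "i - n"] by simp
  qed
  then show ?thesis using a(1) mem_Diag[OF x y] by blast
qed

text \<open>A prime divisor inside the diagonal equals it. Any other one contains a point where some
  entry is nonzero, and that entry has order 0.\<close>

lemma common_zero_divisor_law:
  "common_zero_divisor c (mu4_laws c (n + 2)) = four_Delta c (proj_pt (Opt n))"
proof
  fix Z
  show "common_zero_divisor c (mu4_laws c (n + 2)) Z = four_Delta c (proj_pt (Opt n)) Z"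
  proof (cases "Z = Diag n")
    case True
    then show ?thesis using prime_divisor_Diag[of n]
      by (simp add: common_zero_divisor_def four_Delta_def order_law_Diag Diag_def[symmetric] numeral_eq_enat)
  next
    case False
    have "(INF i. order_along V (bicone Z) (mu4_laws c (n + 2) i)) = 0" if Z: "prime_divisor c Z"
    proof -
      have irr: "zirreducible c Z" using Z by (simp add: prime_divisor_def)
      then have sub: "Z \<subseteq> mu4_surface c" using zclosed_subset by (simp add: zirreducible_def)
      have "\<not> Z \<subseteq> Diag n"
        using Z False zirreducible_Diag[of n] prime_divisor_Diag[of n] unfolding prime_divisor_def by blast
      then obtain z where z: "z \<in> Z" "z \<notin> Diag n" by blast
      obtain x y where xy: "x \<in> C" "y \<in> C" "z = (proj_pt x, proj_pt y)" using surface_point z(1) sub by blast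
      obtain i where i: "lv (n + 2) x y i \<noteq> 0" using law_zeros[OF xy(1,2)] z(2) xy(3) by blast
      have "case_sum x y \<in> bicone Z" unfolding bicone_iff[OF sub] using xy z(1) by blast
      then have "mu4_laws c (n + 2) i \<notin> vanishing_ideal (bicone Z)"
        using i vanishing_idealD unfolding lv_def by blast
      then have "order_along V (bicone Z) (mu4_laws c (n + 2) i) = 0"
        by (rule order_along_zero[OF irred_if_zirreducible[OF irr] bicone_mono[OF sub]])
      then have "(INF i. order_along V (bicone Z) (mu4_laws c (n + 2) i)) \<le> 0" by (metis INF_lower UNIV_I)
      then show ?thesis by simp
    qed
    moreover have "the_enat 0 = 0" by (simp add: zero_enat_def)
    ultimately show ?thesis using False by (simp add: common_zero_divisor_def four_Delta_def Diag_def[symmetric])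
  qed
qed

end

section \<open>Descent to the ground field\<close>

lemma mpderiv_even_exponents:
  fixes p :: "('v, 'a::comm_ring_1) mpoly"
  assumes "CHAR('a) = 2" "\<And>m. m \<in> Poly_Mapping.keys p \<Longrightarrow> even (Poly_Mapping.lookup m v)"
  shows "mpderiv v p = 0"
  unfolding mpderiv_def
proof (rule sum.neutral, rule ballI)
  fix m assume "m \<in> Poly_Mapping.keys p"
  then have "CHAR('a) dvd Poly_Mapping.lookup m v" using assms by simp
  then have "of_nat (Poly_Mapping.lookup m v) = (0::'a)" by (simp add: of_nat_eq_0_iff_char_dvd)
  then show "Poly_Mapping.single (m - Poly_Mapping.single v 1) (of_nat (Poly_Mapping.lookup m v) * Poly_Mapping.lookup p m) = 0"
    by simp
qed

lemma mpderiv_square_sum: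
  assumes "CHAR('a::comm_ring_1) = 2"
  shows "mpderiv i ((Var u + Var w) ^ 2 :: ('v, 'a) mpoly) = 0"
proof (rule mpderiv_even_exponents[OF assms])
  have "(2::'a) = 0" using of_nat_CHAR[where 'a='a] assms by simp
  moreover have "(2 :: ('v, 'a) mpoly) = Const 2"
    unfolding Const_def one_add_one[symmetric] single_add by (simp add: single_one)
  ultimately have "(2 :: ('v, 'a) mpoly) = 0" by (simp add: Const_def)
  then have "(Var u + Var w) ^ 2 = (Var u ^ 2 + Var w ^ 2 :: ('v, 'a) mpoly)" by (simp add: power2_sum)
  then have "Poly_Mapping.keys ((Var u + Var w) ^ 2 :: ('v, 'a) mpoly) \<subseteq> {Poly_Mapping.single u 2} \<union> {Poly_Mapping.single w 2}"
    unfolding Var_power by (metis (no_types, lifting) Poly_Mapping.keys_add Un_mono keys_single order_trans subset_insertI subset_refl empty_subsetI)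
  moreover fix m assume "m \<in> Poly_Mapping.keys ((Var u + Var w) ^ 2 :: ('v, 'a) mpoly)"
  ultimately have "m = Poly_Mapping.single u 2 \<or> m = Poly_Mapping.single w 2" by auto
  then show "even (Poly_Mapping.lookup m i)" by (auto simp: lookup_single when_def)
qed

text \<open>For c = 0 both equations are squares of linear forms, so their gradients vanish in
  characteristic 2, against smoothness at (1:1:1:1).\<close>

lemma mu4_smooth_nonzero:
  assumes char: "CHAR('a::field) = 2" and smooth: "mu4_smooth (c :: 'a)"
  shows "c \<noteq> 0"
proof
  assume c: "c = 0"
  have two: "(2::'a) = 0" using of_nat_CHAR[where 'a='a] char by simp
  have "mpderiv i (mu4_eq1 c) = 0" "mpderiv i (mu4_eq2 c) = 0" for i
    using mpderiv_square_sum[OF char] by (simp_all add: c mu4_eq1_def mu4_eq2_def Const_def)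
  moreover have "(\<lambda>_. 1) \<in> cone (mu4_curve c)"
  proof -
    have "proj_pt (\<lambda>_. 1) \<in> mu4_curve c"
      unfolding mu4_curve_def by (intro CollectI exI[of _ "\<lambda>_. 1"]) (simp add: c two mu4_eq1_def mu4_eq2_def fun_eq_iff)
    then show ?thesis unfolding cone_def using self_mem_proj_pt by blast
  qed
  ultimately have "(1::'a) = 0" using smooth unfolding mu4_smooth_def by (metis eval_mpoly_zero mult_zero_right add_0_right)
  then show False by simp
qed

lemma bihomogeneous_Const_mult: "bihomogeneous d e p \<Longrightarrow> bihomogeneous d e (Const a * p)"
  using bihomogeneous_mult[OF bihomogeneous_Const, of d e p a] by simp

locale mu4_ground =
  fixes c :: "'a::field"
  assumes closure: "mu4 (to_ac c)"
begin

sublocale mu4 "to_ac c" by (rule closure)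

lemma ac_poly_laws: "ac_poly (mu4_laws c j i) = mu4_laws (to_ac c) j i"
  using exhaust_4[of j] exhaust_4[of i]
  by (elim disjE) (simp_all add: mu4_laws_def mu4_law0_def mu4_law1_def mu4_law2_def mu4_law3_def)

lemma bihomogeneous_laws: "bihomogeneous 2 2 (mu4_laws c j i)"
proof -
  have m: "bihomogeneous 1 1 (VX a * VY b :: (4 + 4, 'a) mpoly)" for a b
    using bihomogeneous_mult[OF bihomogeneous_Inl bihomogeneous_Inr, of a b] by (simp only: add_0_left add_0_right)
  have mult: "bihomogeneous 2 2 (p * q)" if "bihomogeneous 1 1 p" "bihomogeneous 1 1 q" for p q :: "(4 + 4, 'a) mpoly"
    using bihomogeneous_mult[OF that] by (simp only: one_add_one)
  have sq: "bihomogeneous 2 2 ((VX a * VY b + VX d * VY e :: (4 + 4, 'a) mpoly)^2)" for a b d e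
    unfolding power2_eq_square by (intro mult bihomogeneous_add m)
  have "bihomogeneous 2 2 (VX a * VX b * VY d * VY e :: (4 + 4, 'a) mpoly)" for a b d e
    using mult[OF m[of a d] m[of b e]] by (simp only: mult_ac)
  then have "bihomogeneous 2 2 (Const c * (VX a * VX b * VY d * VY e + VX a' * VX b' * VY d' * VY e'))" for a b d e a' b' d' e'
    by (intro bihomogeneous_Const_mult bihomogeneous_add)
  with sq show ?thesis
    using exhaust_4[of j] exhaust_4[of i]
    by (elim disjE) (simp_all add: mu4_laws_def mu4_law0_def mu4_law1_def mu4_law2_def mu4_law3_def)
qed

lemma bihomogeneous_lin_comb: "bihomogeneous 2 2 (lin_comb a (mu4_laws c) i)"
  unfolding lin_comb_def by (intro bihomogeneous_sum bihomogeneous_Const_mult bihomogeneous_laws)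

lemma tuple_at_lin_comb:
  "tuple_at (lin_comb a (mu4_laws c)) x y i = (\<Sum>j\<in>UNIV. to_ac (a j) * lv j x y i)"
  by (simp add: tuple_at_def lin_comb_def ac_poly_laws lv_def)

lemma tuple_cong_iff: "tuple_cong c p q \<longleftrightarrow> (\<forall>x\<in>C. \<forall>y\<in>C. \<forall>i. tuple_at p x y i = tuple_at q x y i)"
  by (auto simp: tuple_cong_def surface_ideal_def vanishing_V_iff tuple_at_def)

lemma addition_law_space_values:
  assumes p: "p \<in> addition_law_space c" and x: "x \<in> C" and y: "y \<in> C"
  shows "tuple_at p x y i * lv j x y k = tuple_at p x y k * lv j x y i"
proof -
  obtain z \<mu> where z: "ell_add (to_ac c) (proj_pt x) (proj_pt y) = proj_pt z" "\<And>j i. lv j x y i = \<mu> j * z i"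
    by (rule all_laws[OF x y]) blast
  have zero: "tuple_cong c p (\<lambda>_. 0) \<Longrightarrow> tuple_at p x y = (\<lambda>_. 0)"
    using x y unfolding tuple_cong_iff by (auto simp: tuple_at_def)
  show ?thesis
  proof (cases "tuple_at p x y = (\<lambda>_. 0)")
    case True then show ?thesis by simp
  next
    case False
    then have "addition_law c p" using p zero by (auto simp: addition_law_space_def)
    then have "proj_pt (tuple_at p x y) = proj_pt z"
      using False x y self_mem_proj_pt unfolding addition_law_def z(1)[symmetric] by (metis proj_pt_in_curve)
    then obtain b where "tuple_at p x y = (\<lambda>i. b * z i)"
      using self_mem_proj_pt[of "tuple_at p x y"] mem_proj_pt by metis
    then show ?thesis by (simp add: z(2) mult_ac)
  qed
qed

text \<open>At each pair the four laws are multiples of one vector representing the sum, hence so is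
  every combination.\<close>

lemma lin_comb_in_space: "lin_comb a (mu4_laws c) \<in> addition_law_space c"
proof -
  let ?p = "lin_comb a (mu4_laws c)"
  show ?thesis
  proof (cases "tuple_cong c ?p (\<lambda>_. 0)")
    case True then show ?thesis using bihomogeneous_lin_comb by (simp add: addition_law_space_def)
  next
    case False
    then obtain x0 y0 i0 where 0: "x0 \<in> C" "y0 \<in> C" "tuple_at ?p x0 y0 i0 \<noteq> 0"
      unfolding tuple_cong_iff by (auto simp: tuple_at_def)
    have "addition_law c ?p" unfolding addition_law_def
    proof (intro conjI ballI allI impI bihomogeneous_lin_comb)
      show "\<exists>P\<in>mu4_curve (to_ac c). \<exists>Q\<in>mu4_curve (to_ac c). \<exists>x\<in>P. \<exists>y\<in>Q. tuple_at ?p x y \<noteq> (\<lambda>_. 0)"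
        using 0 self_mem_proj_pt[of x0] self_mem_proj_pt[of y0]
        by (intro bexI[of _ "proj_pt x0"] bexI[of _ "proj_pt y0"] bexI[of _ x0] bexI[of _ y0]) auto
      fix P Q x y
      assume *: "P \<in> mu4_curve (to_ac c)" "Q \<in> mu4_curve (to_ac c)" "x \<in> P" "y \<in> Q" "tuple_at ?p x y \<noteq> (\<lambda>_. 0)"
      have x: "x \<in> C" "P = proj_pt x" using mem_curve_point[OF *(1,3)] by auto
      have y: "y \<in> C" "Q = proj_pt y" using mem_curve_point[OF *(2,4)] by auto
      obtain z \<mu> where z: "ell_add (to_ac c) (proj_pt x) (proj_pt y) = proj_pt z" "\<And>j i. lv j x y i = \<mu> j * z i"
        by (rule all_laws[OF x(1) y(1)]) blast
      define s where "s = (\<Sum>j\<in>UNIV. to_ac (a j) * \<mu> j)"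
      have t: "tuple_at ?p x y = (\<lambda>i. s * z i)"
        by (rule ext) (simp add: tuple_at_lin_comb z(2) s_def sum_distrib_right mult.assoc)
      then have "s \<noteq> 0" using *(5) by auto
      then show "proj_pt (tuple_at ?p x y) = ell_add (to_ac c) P Q"
        unfolding t x(2) y(2) z(1) by (rule proj_pt_scale)
    qed
    then show ?thesis using bihomogeneous_lin_comb by (simp add: addition_law_space_def)
  qed
qed

text \<open>At (x, O) law j is c^2 x_j times x, so a relation gives a linear form vanishing on the
  curve; its values at the four multiples of T force its coefficients to be 0.\<close>

lemma laws_independent:
  assumes "tuple_cong c (lin_comb a (mu4_laws c)) (\<lambda>_. 0)"
  shows "a j = 0"
proof -
  let ?a = "\<lambda>j. to_ac (a j)"
  have lin: "?a 0 * x 0 + ?a 1 * x 1 + ?a 2 * x 2 + ?a 3 * x 3 = 0" if x: "x \<in> C" for x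
  proof -
    obtain i where i: "x i \<noteq> 0" using C_nonzero[OF x] by blast
    have "(\<Sum>j\<in>UNIV. ?a j * lv j x (Opt 0) i) = 0"
      using assms x Opt_in_C[of 0] unfolding tuple_cong_iff tuple_at_lin_comb by (simp add: tuple_at_def)
    then have "(to_ac c)^2 * x i * (?a 0 * x 0 + ?a 1 * x 1 + ?a 2 * x 2 + ?a 3 * x 3) = 0"
      unfolding lv_O_right[OF x] sum_4 by (simp add: algebra_simps)
    then show ?thesis using i c0 by simp
  qed
  have "?a 0 * to_ac c + (?a 1 + ?a 3) = 0" "?a 1 * to_ac c + (?a 0 + ?a 2) = 0"
    "?a 2 * to_ac c + (?a 1 + ?a 3) = 0" "?a 3 * to_ac c + (?a 0 + ?a 2) = 0"
    using lin[OF Opt_in_C[of 0]] lin[OF Opt_in_C[of 1]] lin[OF Opt_in_C[of 2]] lin[OF Opt_in_C[of 3]]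
    by (simp_all add: Opt_def ac_simps)
  then have e: "?a 0 * to_ac c = ?a 1 + ?a 3" "?a 1 * to_ac c = ?a 0 + ?a 2" "?a 2 * to_ac c = ?a 1 + ?a 3" "?a 3 * to_ac c = ?a 0 + ?a 2"
    by (simp_all only: add_eq_0)
  have "?a 0 * to_ac c = ?a 2 * to_ac c" "?a 1 * to_ac c = ?a 3 * to_ac c" unfolding e by simp_all
  then have "?a 0 = ?a 2" "?a 1 = ?a 3" using c0 by simp_all
  with e have "?a 0 * to_ac c = 0" "?a 1 * to_ac c = 0" by (simp_all add: add_self)
  then have "?a 0 = 0" "?a 1 = 0" using c0 by simp_all
  with \<open>?a 0 = ?a 2\<close> \<open>?a 1 = ?a 3\<close> show ?thesis using exhaust_4[of j] by auto
qed

lemma bidegree_2_normal_form: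
  assumes "bihomogeneous 2 2 p"
  shows "\<exists>\<phi>. \<forall>x\<in>C. \<forall>y\<in>C.
    eval_mpoly (case_sum x y) (ac_poly p) = (\<Sum>a<8. B a x * (\<Sum>b<8. to_ac (\<phi> a b) * B b y))"
proof -
  define N where "N f \<longleftrightarrow> (\<exists>\<phi>. \<forall>x\<in>C. \<forall>y\<in>C. f x y = (\<Sum>a<8. B a x * (\<Sum>b<8. to_ac (\<phi> a b) * B b y)))"
    for f :: "(4 \<Rightarrow> 'a alg_closure) \<Rightarrow> (4 \<Rightarrow> 'a alg_closure) \<Rightarrow> 'a alg_closure"
  have sum: "N (\<lambda>x y. \<Sum>m\<in>S. f m x y)" if "finite S" "\<And>m. m \<in> S \<Longrightarrow> N (f m)" for S and f :: "_ \<Rightarrow> _"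
    using that
  proof (induction S)
    case empty
    show ?case unfolding N_def by (rule exI[of _ "\<lambda>_ _. 0"]) simp
  next
    case (insert m S)
    have "N (f m)" by (rule insert.prems) simp
    then obtain \<phi> where 1: "\<forall>x\<in>C. \<forall>y\<in>C. f m x y = (\<Sum>a<8. B a x * (\<Sum>b<8. to_ac (\<phi> a b) * B b y))"
      unfolding N_def by (elim exE)
    have "N (\<lambda>x y. \<Sum>m\<in>S. f m x y)" using insert.prems by (intro insert.IH) simp
    then obtain \<chi> where 2: "\<forall>x\<in>C. \<forall>y\<in>C. (\<Sum>m\<in>S. f m x y) = (\<Sum>a<8. B a x * (\<Sum>b<8. to_ac (\<chi> a b) * B b y))"
      unfolding N_def by (elim exE)
    show ?case unfolding N_def
    proof (intro exI ballI)
      fix x y assume "x \<in> C" "y \<in> C"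
      then show "(\<Sum>m\<in>insert m S. f m x y) = (\<Sum>a<8. B a x * (\<Sum>b<8. to_ac (\<phi> a b + \<chi> a b) * B b y))"
        using 1 2 insert.hyps by (simp add: distrib_left distrib_right sum.distrib)
    qed
  qed
  have nf: "\<exists>\<psi>. \<forall>x\<in>C. (\<Prod>i\<in>UNIV. x i ^ m i) = (\<Sum>a<8. to_ac (\<psi> a) * B a x)" if m: "(\<Sum>i\<in>UNIV. m (i::4)) = 2" for m
  proof -
    obtain \<psi> where psi: "\<forall>a. \<psi> a \<in> {0, 1, 1 / (to_ac c)^2}"
      "\<forall>x\<in>C. (\<Prod>i\<in>UNIV. x i ^ m i) = (\<Sum>a<8. \<psi> a * B a x)"
      using degree_2_normal_form[OF m] by (elim exE conjE)
    have "\<exists>w. \<psi> a = to_ac w" for a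
    proof -
      have "\<psi> a = to_ac 0 \<or> \<psi> a = to_ac 1 \<or> \<psi> a = to_ac (1 / c^2)" using spec[OF psi(1), of a] by simp
      then show ?thesis by blast
    qed
    then have "\<forall>a. \<exists>w. \<psi> a = to_ac w" by blast
    from choice[OF this] obtain \<omega> where \<omega>: "\<forall>a. \<psi> a = to_ac (\<omega> a)" by (elim exE)
    show ?thesis
    proof (intro exI ballI)
      fix x assume "x \<in> C"
      then show "(\<Prod>i\<in>UNIV. x i ^ m i) = (\<Sum>a<8. to_ac (\<omega> a) * B a x)" using psi(2) \<omega> by simp
    qed
  qed
  let ?term = "\<lambda>m x y. Poly_Mapping.lookup (ac_poly p) m * (\<Prod>v\<in>UNIV. case_sum x y v ^ Poly_Mapping.lookup m v)"
  have "N (?term m)" if m: "m \<in> Poly_Mapping.keys (ac_poly p)" for m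
  proof -
    have d: "(\<Sum>i\<in>UNIV. Poly_Mapping.lookup m (Inl i)) = 2" "(\<Sum>i\<in>UNIV. Poly_Mapping.lookup m (Inr i)) = 2"
      using assms m by (auto simp: bihomogeneous_def)
    obtain \<psi> where 1: "\<forall>x\<in>C. (\<Prod>i\<in>UNIV. x i ^ Poly_Mapping.lookup m (Inl i)) = (\<Sum>a<8. to_ac (\<psi> a) * B a x)"
      using nf[OF d(1)] by (elim exE)
    obtain \<chi> where 2: "\<forall>y\<in>C. (\<Prod>i\<in>UNIV. y i ^ Poly_Mapping.lookup m (Inr i)) = (\<Sum>b<8. to_ac (\<chi> b) * B b y)"
      using nf[OF d(2)] by (elim exE)
    show ?thesis unfolding N_def
    proof (intro exI ballI)
      fix x y assume xy: "x \<in> C" "y \<in> C"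
      show "?term m x y = (\<Sum>a<8. B a x * (\<Sum>b<8. to_ac (Poly_Mapping.lookup p m * \<psi> a * \<chi> b) * B b y))"
        unfolding UNIV_sum_prod sum.case bspec[OF 1 xy(1)] bspec[OF 2 xy(2)] sum_product lookup_ac_poly
        by (simp only: sum_distrib_left to_ac_mult) (simp only: mult_ac)
    qed
  qed
  then have "N (\<lambda>x y. eval_mpoly (case_sum x y) (ac_poly p))"
    unfolding eval_mpoly_def by (intro sum) simp_all
  then show ?thesis unfolding N_def .
qed

lemma laws_span:
  assumes p: "p \<in> addition_law_space c"
  shows "\<exists>a. tuple_cong c p (lin_comb a (mu4_laws c))"
proof -
  have hom: "bihomogeneous 2 2 (p i)" for i using p by (simp add: addition_law_space_def)
  obtain \<phi> where \<phi>: "\<forall>x\<in>C. \<forall>y\<in>C. tuple_at p x y 0 = (\<Sum>a<8. B a x * (\<Sum>b<8. to_ac (\<phi> a b) * B b y))"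
    using bidegree_2_normal_form[OF hom, of 0] unfolding tuple_at_def by (elim exE)
  obtain \<gamma> where \<gamma>: "\<forall>x\<in>C. \<forall>y\<in>C. tuple_at p x y 2 = (\<Sum>a<8. B a x * (\<Sum>b<8. to_ac (\<gamma> a b) * B b y))"
    using bidegree_2_normal_form[OF hom, of 2] unfolding tuple_at_def by (elim exE)
  \<comment> \<open>The scalars of \<open>law_coefficients\<close>, which lie in the ground field
    because the normal form does.\<close>
  define a where "a = tuple4 (\<phi> 0 0) (\<phi> 4 6 / c) (\<phi> 2 3) (\<phi> 6 4 / c)"
  let ?q = "lin_comb a (mu4_laws c)"
  have entry0: "tuple_at p x y 0 = tuple_at ?q x y 0" if xy: "x \<in> C" "y \<in> C" for x y
  proof -
    have "(\<Sum>a<8. B a x * (\<Sum>b<8. to_ac (\<phi> a b) * B b y)) =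
      to_ac (\<phi> 0 0) * lv 0 x y 0 + to_ac (\<phi> 4 6) / to_ac c * lv 1 x y 0 + to_ac (\<phi> 2 3) * lv 2 x y 0 + to_ac (\<phi> 6 4) / to_ac c * lv 3 x y 0"
    proof (rule law_coefficients[where \<gamma> = "\<lambda>a b. to_ac (\<gamma> a b)"])
      fix x y assume "x \<in> C" "y \<in> C"
      then show "(\<Sum>a<8. B a x * (\<Sum>b<8. to_ac (\<phi> a b) * B b y)) * lv 2 x y 2 =
         (\<Sum>a<8. B a x * (\<Sum>b<8. to_ac (\<gamma> a b) * B b y)) * lv 2 x y 0"
        using addition_law_space_values[OF p, of x y 0 2 2] \<phi> \<gamma> by simp
    qed
    then show ?thesis unfolding bspec[OF bspec[OF \<phi> xy(1)] xy(2)] by (simp add: tuple_at_lin_comb sum_4 a_def)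
  qed
  \<comment> \<open>Nonzero at (T, O), this entry can be cancelled from the proportionality on the
    irreducible surface.\<close>
  have "mu4_laws (to_ac c) 2 0 \<notin> vanishing_ideal V"
  proof
    assume "mu4_laws (to_ac c) 2 0 \<in> vanishing_ideal V"
    from vanishing_idealD[OF this case_sum_in_V[OF Opt_in_C[of 1] Opt_in_C[of 0]]]
    have "lv 2 (Opt 1) (Opt 0) 0 = 0" unfolding lv_def .
    then show False using c0 by (simp add: lv_O_right[OF Opt_in_C]) (simp add: Opt_def)
  qed
  moreover have "(ac_poly (p i) - ac_poly (?q i)) * mu4_laws (to_ac c) 2 0 \<in> vanishing_ideal V" for i
    unfolding vanishing_V_iff
  proof (intro ballI)
    fix x y assume xy: "x \<in> C" "y \<in> C"
    have "tuple_at p x y i * lv 2 x y 0 = tuple_at ?q x y i * lv 2 x y 0"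
      using addition_law_space_values[OF p xy, of i 2 0] addition_law_space_values[OF lin_comb_in_space xy, of a i 2 0] entry0[OF xy]
      by simp
    then show "eval_mpoly (case_sum x y) ((ac_poly (p i) - ac_poly (?q i)) * mu4_laws (to_ac c) 2 0) = 0"
      by (simp add: tuple_at_def lv_def left_diff_distrib)
  qed
  ultimately have "ac_poly (p i) - ac_poly (?q i) \<in> vanishing_ideal V" for i
    using irred_setD[OF irred_V] by blast
  then have "tuple_cong c p ?q" by (simp add: tuple_cong_def surface_ideal_def)
  then show ?thesis by blast
qed

text \<open>Law j belongs to the translation by (j - 2) T; a natural number congruent to j - 2
  modulo 4 serves as n.\<close>

lemma exceptional_divisor_law:
  "\<exists>n. exceptional_divisor c (mu4_laws c j) = four_Delta (to_ac c) (ell_mult (to_ac c) n (mu4_T (to_ac c)))"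
proof -
  have "\<exists>n. of_nat n = j - 2"
    using exhaust_4[of "j - 2"] of_nat_0 of_nat_1 of_nat_numeral by metis
  then obtain n where n: "of_nat n = j - 2" by blast
  have "exceptional_divisor c (mu4_laws c j) = common_zero_divisor (to_ac c) (mu4_laws (to_ac c) (j - 2 + 2))"
    by (simp add: exceptional_divisor_def ac_poly_laws)
  also have "\<dots> = four_Delta (to_ac c) (proj_pt (Opt (j - 2)))" by (rule common_zero_divisor_law)
  also have "proj_pt (Opt (j - 2)) = ell_mult (to_ac c) (int n) (mu4_T (to_ac c))" by (simp only: ell_mult_T n)
  finally show ?thesis by blast
qed

end

theorem theorem18:
  fixes c :: "'a::field"
  assumes "CHAR('a) = 2"
    and "mu4_smooth (to_ac c)"
  shows "basis_of_addition_laws c (mu4_laws c) \<and>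
    (\<forall>j. \<exists>n::int. exceptional_divisor c (mu4_laws c j)
           = four_Delta (to_ac c) (ell_mult (to_ac c) n (mu4_T (to_ac c))))"
proof -
  have char: "CHAR('a alg_closure) = 2" using assms(1) by simp
  interpret mu4_ground c
    by unfold_locales (use char mu4_smooth_nonzero[OF char assms(2)] in auto)
  show ?thesis
    using laws_independent lin_comb_in_space laws_span exceptional_divisor_law
    unfolding basis_of_addition_laws_def by blast
qed

end
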